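(* Let $n$ be a positive integer, $w\in S_n$, and $\lambda$ a weak composition of $n$ such that $R(w)\in\mathrm{RS}(\lambda)$. Then there exists an isomorphism of varieties $\widetilde\varphi_w:\mathbb{C}^{d_w}\to C_w\cap\mathcal{B}^{X_\lambda}$, where $d_w=|\mathrm{inv}_\lambda(w)|$, with image equal to $\mathcal{D}_w$.
   Context: Notation: $[n]=\{1,\dots,n\}$; $\mathbf{e}_1,\dots,\mathbf{e}_n$ is the standard basis of $\mathbb{C}^n$; $E_{ab}$ is the elementary matrix with $E_{ab}\mathbf{e}_b=\mathbf{e}_a$; permutations are identified with permutation matrices, $w\mathbf{e}_j=\mathbf{e}_{w(j)}$. $B\subset GL_n(\mathbb{C})$ is the group of upper triangular matrices. Flags: $\mathrm{Flags}(\mathbb{C}^n)\cong GL_n(\mathbb{C})/B$ is the variety of full flags $V_\bullet=(V_1\subset\cdots\subset V_n=\mathbb{C}^n)$, $\dim V_i=i$, $V_0=\{0\}$. $E_\bullet$ is the standard flag with $i$-th subspace $\mathrm{span}\{\mathbf{e}_1,\dots,\mathbf{e}_i\}$, and $gE_\bullet$ is its image under $g\in GL_n(\mathbb{C})$. The Schubert cell of $w$ is $C_w=BwE_\bullet$. For nilpotent $X$, the Springer fiber is $\mathcal{B}^X=\{V_\bullet: X(V_i)\subseteq V_{i-1}\ \forall i\in[n]\}$. Intersections are regarded as reduced locally closed subvarieties. Tableaux: a weak composition $\lambda$ of $n$ (a finite sequence of nonnegative integers with sum $n$) is drawn as a left-justified diagram whose $i$-th row from the top has $\lambda_i$ boxes.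 The base filling $R(e)$ labels the boxes by $1,\dots,n$, column by column from the leftmost column to the right, and from bottom to top in each column. $X_\lambda=\sum E_{ab}$, summed over all pairs $(a,b)$ such that $b$ labels the box directly to the right of the box labeled $a$ in $R(e)$. For $w\in S_n$, $R(w)$ is the filling of $\lambda$ in which the box labeled $i$ in $R(e)$ is labeled $w^{-1}(i)$. $\mathrm{RS}(\lambda)$ is the set of row-strict fillings, i.e. those whose rows are strictly increasing from left to right. Springer inversions: $(k,\ell)\in\mathrm{inv}_\lambda(w)$ iff $k>\ell$, (i) $k$ occurs in a box below $\ell$ in the same column, or in any column strictly to the left of the column containing $\ell$, in $R(w)$, and (ii) if the box directly to the right of $\ell$ in $R(w)$ exists and is labeled $r$, then $k\le r-1$. $\mathrm{inv}^k_\lambda(w)$ is the set of $(k,\ell)\in\mathrm{inv}_\lambda(w)$ with first entry $k$. Subgroups $B_k(w)$ (for $2\le k\le n$): $B_k(w)$ is the set of all $n\times n$ matrices $g_k$ for which there are scalars $x_{w(k)w(\ell)}\in\mathbb{C}$, one for each $(k,\ell)\in\mathrm{inv}_\lambda^k(w)$, such that for each $j\in[n]$: if $\mathbf{e}_{w(j)}=X_\lambda^m\mathbf{e}_{w(\ell)}$ for some $m\ge0$ and some $(k,\ell)\in\mathrm{inv}_\lambda^k(w)$, then $g_k\mathbf{e}_{w(j)}=\mathbf{e}_{w(j)}+x_{w(k)w(\ell)}X_\lambda^m\mathbf{e}_{w(k)}$; otherwise $g_k\mathbf{e}_{w(j)}=\mathbf{e}_{w(j)}$. Finally, $\mathcal{D}_w=\{g_ng_{n-1}\cdots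 g_2wE_\bullet: g_k\in B_k(w)\text{ for all }2\le k\le n\}$ (for $n=1$, $\mathcal{D}_w=\{wE_\bullet\}$). *)

theory Defs
  imports
    "HOL-Analysis.Abstract_Topology"
    "HOL-Combinatorics.Permutations"
    "Jordan_Normal_Form.VS_Connect"
begin

section \<open>Spaces with functions\<close>

text \<open>
  Varieties are treated in the classical way, as topological spaces together with a
  collection of regular complex-valued functions on each open subset. Functions are total in
  HOL; \<open>regular X U f\<close> is a condition on the restriction of \<open>f\<close> to the open set \<open>U\<close>.
\<close>

record 'a space_with_functions =
  top_of :: "'a topology"
  regular :: "'a set \<Rightarrow> ('a \<Rightarrow> complex) \<Rightarrow> bool"

definition morphism ::
  "'a space_with_functions \<Rightarrow> 'b space_with_functions \<Rightarrow> ('a \<Rightarrow> 'b) \<Rightarrow> bool" where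
  "morphism X Y \<phi> \<longleftrightarrow>
     continuous_map (top_of X) (top_of Y) \<phi> \<and>
     (\<forall>U f. openin (top_of Y) U \<longrightarrow> regular Y U f \<longrightarrow>
        regular X {x \<in> topspace (top_of X). \<phi> x \<in> U} (f \<circ> \<phi>))"

definition isomorphism ::
  "'a space_with_functions \<Rightarrow> 'b space_with_functions \<Rightarrow> ('a \<Rightarrow> 'b) \<Rightarrow> bool" where
  "isomorphism X Y \<phi> \<longleftrightarrow>
     morphism X Y \<phi> \<and>
     (\<exists>\<psi>. morphism Y X \<psi> \<and>
        (\<forall>x \<in> topspace (top_of X). \<psi> (\<phi> x) = x) \<and>
        (\<forall>y \<in> topspace (top_of Y). \<phi> (\<psi> y) = y))"

subsection \<open>Quasi-affine varieties\<close>

text \<open>The polynomial functions in a given set \<open>C\<close> of coordinate functions.\<close>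

inductive_set polynomials :: "('a \<Rightarrow> complex) set \<Rightarrow> ('a \<Rightarrow> complex) set"
  for C :: "('a \<Rightarrow> complex) set" where
  const: "(\<lambda>_. a) \<in> polynomials C"
| coord: "c \<in> C \<Longrightarrow> c \<in> polynomials C"
| add: "p \<in> polynomials C \<Longrightarrow> q \<in> polynomials C \<Longrightarrow> (\<lambda>x. p x + q x) \<in> polynomials C"
| mult: "p \<in> polynomials C \<Longrightarrow> q \<in> polynomials C \<Longrightarrow> (\<lambda>x. p x * q x) \<in> polynomials C"

definition zariski_open :: "'a set \<Rightarrow> ('a \<Rightarrow> complex) set \<Rightarrow> 'a set \<Rightarrow> bool" where
  "zariski_open S C U \<longleftrightarrow>
     (\<exists>P. P \<subseteq> polynomials C \<and> U = S - {x. \<forall>p \<in> P. p x = 0})"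

definition zariski_topology :: "'a set \<Rightarrow> ('a \<Rightarrow> complex) set \<Rightarrow> 'a topology" where
  "zariski_topology S C = topology (zariski_open S C)"

lemma istopology_zariski_open: "istopology (zariski_open S C)"
  unfolding istopology_def
proof (intro conjI allI impI)
  fix U V assume "zariski_open S C U" "zariski_open S C V"
  then obtain P Q where
    P: "P \<subseteq> polynomials C" "U = S - {x. \<forall>p \<in> P. p x = 0}" and
    Q: "Q \<subseteq> polynomials C" "V = S - {x. \<forall>q \<in> Q. q x = 0}"
    unfolding zariski_open_def by blast
  define R where "R = (\<lambda>(p, q) x. p x * q x) ` (P \<times> Q)"
  have "r \<in> polynomials C" if "r \<in> R" for r
    using that P(1) Q(1) unfolding R_def by (auto simp: subset_iff intro: polynomials.mult)
  then have R: "R \<subseteq> polynomials C" by (rule subsetI)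
  have "(\<forall>r \<in> R. r x = 0) \<longleftrightarrow> (\<forall>p \<in> P. p x = 0) \<or> (\<forall>q \<in> Q. q x = 0)" for x
    unfolding R_def by auto
  then have "U \<inter> V = S - {x. \<forall>r \<in> R. r x = 0}"
    unfolding P(2) Q(2) by (simp add: Collect_disj_eq Diff_Un)
  with R show "zariski_open S C (U \<inter> V)" unfolding zariski_open_def by (intro exI[of _ R] conjI)
next
  fix K assume K: "\<forall>U \<in> K. zariski_open S C U"
  then have "\<forall>U \<in> K. \<exists>P. P \<subseteq> polynomials C \<and> U = S - {x. \<forall>p \<in> P. p x = 0}"
    by (simp only: zariski_open_def)
  then have "\<exists>P. \<forall>U \<in> K. P U \<subseteq> polynomials C \<and> U = S - {x. \<forall>p \<in> P U. p x = 0}"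
    by (rule bchoice)
  then obtain P where
    P: "\<forall>U \<in> K. P U \<subseteq> polynomials C \<and> U = S - {x. \<forall>p \<in> P U. p x = 0}"
    by (elim exE)
  have PC: "P U \<subseteq> polynomials C" if "U \<in> K" for U
    using bspec[OF P that] by (rule conjunct1)
  have U: "U = S - {x. \<forall>p \<in> P U. p x = 0}" if "U \<in> K" for U
    using bspec[OF P that] by (rule conjunct2)
  have "\<Union> K = \<Union> ((\<lambda>U. U) ` K)" by simp
  also have "\<dots> = (\<Union>U \<in> K. S - {x. \<forall>p \<in> P U. p x = 0})"
    by (rule SUP_cong[OF refl]) (rule U)
  also have "\<dots> = S - {x. \<forall>p \<in> (\<Union>U \<in> K. P U). p x = 0}" by auto
  finally have "\<Union> K = S - {x. \<forall>p \<in> (\<Union>U \<in> K. P U). p x = 0}" .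
  moreover have "(\<Union>U \<in> K. P U) \<subseteq> polynomials C" by (rule UN_least) (rule PC)
  ultimately show "zariski_open S C (\<Union> K)" unfolding zariski_open_def by (intro exI conjI)
qed

lemma openin_zariski_topology: "openin (zariski_topology S C) = zariski_open S C"
  unfolding zariski_topology_def by (rule topology_inverse'[OF istopology_zariski_open])

lemma topspace_zariski_topology: "topspace (zariski_topology S C) = S"
proof
  show "topspace (zariski_topology S C) \<subseteq> S"
    unfolding topspace_def openin_zariski_topology zariski_open_def by blast
  have "zariski_open S C S"
    unfolding zariski_open_def
    by (rule exI[of _ "{\<lambda>_. 1}"]) (auto intro: polynomials.const)
  then show "S \<subseteq> topspace (zariski_topology S C)"
    unfolding topspace_def openin_zariski_topology by blast
qed

text \<open>Regular functions are locally quotients of polynomials.\<close>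

definition quasi_affine :: "'a set \<Rightarrow> ('a \<Rightarrow> complex) set \<Rightarrow> 'a space_with_functions" where
  "quasi_affine S C =
     \<lparr> top_of = zariski_topology S C,
       regular = (\<lambda>U f. \<forall>x \<in> U. \<exists>N p q.
         openin (zariski_topology S C) N \<and> x \<in> N \<and> N \<subseteq> U \<and>
         p \<in> polynomials C \<and> q \<in> polynomials C \<and>
         (\<forall>y \<in> N. q y \<noteq> 0 \<and> f y = p y / q y)) \<rparr>"

definition affine_space :: "nat \<Rightarrow> complex vec space_with_functions" where
  "affine_space d = quasi_affine (carrier_vec d) {\<lambda>v. v $ i |i. i < d}"

definition GL :: "nat \<Rightarrow> complex mat set" where
  "GL n = {g \<in> carrier_mat n n. invertible_mat g}"

definition GL_variety :: "nat \<Rightarrow> complex mat space_with_functions" where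
  "GL_variety n = quasi_affine (GL n) {\<lambda>g. g $$ (i, j) |i j. i < n \<and> j < n}"

subsection \<open>Quotients and subvarieties\<close>

text \<open>The quotient structure on \<open>Y\<close> along a surjection \<open>\<pi>\<close> from \<open>X\<close> onto \<open>Y\<close>.\<close>

definition quotient_open :: "'a topology \<Rightarrow> 'b set \<Rightarrow> ('a \<Rightarrow> 'b) \<Rightarrow> 'b set \<Rightarrow> bool" where
  "quotient_open T Y \<pi> U \<longleftrightarrow> U \<subseteq> Y \<and> openin T {x \<in> topspace T. \<pi> x \<in> U}"

lemma istopology_quotient_open: "istopology (quotient_open T Y \<pi>)"
  unfolding istopology_def
proof (intro conjI allI impI)
  fix U V assume UV: "quotient_open T Y \<pi> U" "quotient_open T Y \<pi> V"
  have "{x \<in> topspace T. \<pi> x \<in> U \<inter> V} =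
      {x \<in> topspace T. \<pi> x \<in> U} \<inter> {x \<in> topspace T. \<pi> x \<in> V}" by blast
  with UV show "quotient_open T Y \<pi> (U \<inter> V)"
    unfolding quotient_open_def by auto
next
  fix K assume K: "\<forall>U \<in> K. quotient_open T Y \<pi> U"
  have "{x \<in> topspace T. \<pi> x \<in> \<Union> K} = (\<Union>U \<in> K. {x \<in> topspace T. \<pi> x \<in> U})" by blast
  with K show "quotient_open T Y \<pi> (\<Union> K)"
    unfolding quotient_open_def by auto
qed

definition quotient_space ::
  "'a space_with_functions \<Rightarrow> 'b set \<Rightarrow> ('a \<Rightarrow> 'b) \<Rightarrow> 'b space_with_functions" where
  "quotient_space X Y \<pi> =
     \<lparr> top_of = topology (quotient_open (top_of X) Y \<pi>),
       regular = (\<lambda>U f. regular X {x \<in> topspace (top_of X). \<pi> x \<in> U} (f \<circ> \<pi>)) \<rparr>"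

lemma openin_quotient_space:
  "openin (top_of (quotient_space X Y \<pi>)) = quotient_open (top_of X) Y \<pi>"
  unfolding quotient_space_def by (simp add: topology_inverse'[OF istopology_quotient_open])

text \<open>
  The reduced induced structure on a locally closed subset \<open>Z\<close>: a function is regular if it is
  locally the restriction of a regular function on an open subset of the ambient space.
\<close>

definition subvariety :: "'a space_with_functions \<Rightarrow> 'a set \<Rightarrow> 'a space_with_functions" where
  "subvariety Y Z =
     \<lparr> top_of = subtopology (top_of Y) Z,
       regular = (\<lambda>U f. \<forall>x \<in> U. \<exists>V F.
         openin (top_of Y) V \<and> x \<in> V \<and> regular Y V F \<and> (\<forall>y \<in> V \<inter> U. f y = F y)) \<rparr>"

section \<open>The flag variety\<close>

text \<open>
  Indices in \<open>{1..n}\<close> are kept 1-based; vectors and matrices of the library are indexed from 0,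
  whence the shifts by one.
\<close>

definition std_basis :: "nat \<Rightarrow> nat \<Rightarrow> complex vec" where
  "std_basis n i = unit_vec n (i - 1)"

definition perm_matrix :: "nat \<Rightarrow> (nat \<Rightarrow> nat) \<Rightarrow> complex mat" where
  "perm_matrix n w = mat n n (\<lambda>(i, j). if i + 1 = w (j + 1) then 1 else 0)"

text \<open>A flag is the list of its subspaces \<open>V ! 0, \<dots>, V ! n\<close>.\<close>

definition Flags :: "nat \<Rightarrow> complex vec set list set" where
  "Flags n = {V. length V = n + 1 \<and>
     (\<forall>i \<le> n. VectorSpace.subspace class_ring (V ! i) (module_vec TYPE(complex) n) \<and>
        vectorspace.dim class_ring ((module_vec TYPE(complex) n)\<lparr>carrier := V ! i\<rparr>) = i) \<and>
     (\<forall>i < n. V ! i \<subseteq> V ! (i + 1))}"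

definition standard_flag :: "nat \<Rightarrow> complex vec set list" where
  "standard_flag n =
     map (\<lambda>i. LinearCombinations.module.span class_ring (module_vec TYPE(complex) n)
                (std_basis n ` {1..i}))
       [0..<n + 1]"

definition flag_image :: "complex mat \<Rightarrow> complex vec set list \<Rightarrow> complex vec set list" where
  "flag_image g V = map ((`) ((*\<^sub>v) g)) V"

text \<open>\<open>Flags n\<close> carries the structure of the quotient \<open>GL\<^sub>n / B\<close>.\<close>

definition flag_variety :: "nat \<Rightarrow> complex vec set list space_with_functions" where
  "flag_variety n =
     quotient_space (GL_variety n) (Flags n) (\<lambda>g. flag_image g (standard_flag n))"

definition Borel :: "nat \<Rightarrow> complex mat set" where
  "Borel n = {g \<in> GL n. upper_triangular g}"

definition schubert_cell :: "nat \<Rightarrow> (nat \<Rightarrow> nat) \<Rightarrow> complex vec set list set" where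
  "schubert_cell n w =
     (\<lambda>b. flag_image (b * perm_matrix n w) (standard_flag n)) ` Borel n"

definition springer_fiber :: "nat \<Rightarrow> complex mat \<Rightarrow> complex vec set list set" where
  "springer_fiber n X =
     {V \<in> Flags n. \<forall>i \<in> {1..n}. (*\<^sub>v) X ` (V ! i) \<subseteq> V ! (i - 1)}"

section \<open>Fillings and Springer inversions\<close>

text \<open>
  A weak composition is a list of naturals. The box \<open>(r, c)\<close> lies in row \<open>r\<close> from the top and
  column \<open>c\<close> from the left, both counted from 0.
\<close>

definition boxes :: "nat list \<Rightarrow> (nat \<times> nat) set" where
  "boxes lam = {(r, c). r < length lam \<and> c < lam ! r}"

text \<open>
  The position of a box in the reading order: columns from left to right, each column from
  bottom to top.
\<close>

definition base_filling :: "nat list \<Rightarrow> nat \<times> nat \<Rightarrow> nat" where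
  "base_filling lam = (\<lambda>(r, c).
     card {(r', c') \<in> boxes lam. c' < c \<or> (c' = c \<and> r \<le> r')})"

definition filling :: "nat list \<Rightarrow> (nat \<Rightarrow> nat) \<Rightarrow> nat \<times> nat \<Rightarrow> nat" where
  "filling lam w = (\<lambda>b. inv_into UNIV w (base_filling lam b))"

definition RS :: "nat list \<Rightarrow> (nat \<times> nat \<Rightarrow> nat) set" where
  "RS lam = {F. bij_betw F (boxes lam) {1..sum_list lam} \<and>
     (\<forall>r c c'. (r, c) \<in> boxes lam \<longrightarrow> (r, c') \<in> boxes lam \<longrightarrow> c < c' \<longrightarrow> F (r, c) < F (r, c'))}"

text \<open>
  The sum of the \<open>E\<^sub>a\<^sub>b\<close> over all pairs \<open>(a, b)\<close> of labels of horizontally adjacent boxes,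
  written entrywise.
\<close>

definition X_mat :: "nat list \<Rightarrow> complex mat" where
  "X_mat lam = mat (sum_list lam) (sum_list lam) (\<lambda>(i, j).
     if \<exists>r c. (r, c) \<in> boxes lam \<and> (r, c + 1) \<in> boxes lam \<and>
         base_filling lam (r, c) = i + 1 \<and> base_filling lam (r, c + 1) = j + 1
     then 1 else 0)"

definition springer_inv :: "nat list \<Rightarrow> (nat \<Rightarrow> nat) \<Rightarrow> (nat \<times> nat) set" where
  "springer_inv lam w = {(k, l). k > l \<and>
     (\<exists>r c r' c'. (r, c) \<in> boxes lam \<and> filling lam w (r, c) = k \<and>
        (r', c') \<in> boxes lam \<and> filling lam w (r', c') = l \<and>
        ((c = c' \<and> r > r') \<or> c < c') \<and>
        ((r', c' + 1) \<in> boxes lam \<longrightarrow> k \<le> filling lam w (r', c' + 1) - 1))}"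

definition springer_inv_at :: "nat list \<Rightarrow> (nat \<Rightarrow> nat) \<Rightarrow> nat \<Rightarrow> (nat \<times> nat) set" where
  "springer_inv_at lam w k = {p \<in> springer_inv lam w. fst p = k}"

section \<open>The sets \<open>B\<^sub>k(w)\<close> and \<open>\<D>\<^sub>w\<close>\<close>

definition B_sub :: "nat list \<Rightarrow> (nat \<Rightarrow> nat) \<Rightarrow> nat \<Rightarrow> complex mat set" where
  "B_sub lam w k = (let n = sum_list lam; e = std_basis n; X = X_mat lam in
     {g \<in> carrier_mat n n. \<exists>x :: nat \<Rightarrow> nat \<Rightarrow> complex. \<forall>j \<in> {1..n}.
        (\<forall>m l. (k, l) \<in> springer_inv_at lam w k \<longrightarrow> e (w j) = (X ^\<^sub>m m) *\<^sub>v e (w l) \<longrightarrow>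
           g *\<^sub>v e (w j) = e (w j) + x (w k) (w l) \<cdot>\<^sub>v ((X ^\<^sub>m m) *\<^sub>v e (w k))) \<and>
        ((\<nexists>m l. (k, l) \<in> springer_inv_at lam w k \<and> e (w j) = (X ^\<^sub>m m) *\<^sub>v e (w l)) \<longrightarrow>
           g *\<^sub>v e (w j) = e (w j))})"

definition D_set :: "nat list \<Rightarrow> (nat \<Rightarrow> nat) \<Rightarrow> complex vec set list set" where
  "D_set lam w = (let n = sum_list lam in
     {flag_image (foldr (*) (map g (rev [2..<n + 1])) (1\<^sub>m n) * perm_matrix n w)
        (standard_flag n) |g. \<forall>k \<in> {2..n}. g k \<in> B_sub lam w k})"

end

theory Submission
  imports Defs "Jordan_Normal_Form.DL_Rank"
begin

text \<open>
  Write \<open>W\<^sub>i\<close> for the span of \<open>e\<^sub>w\<^sub>(\<^sub>1\<^sub>), \<dots>, e\<^sub>w\<^sub>(\<^sub>i\<^sub>)\<close>. A flag in \<open>C\<^sub>w\<close> has the form \<open>b W\<^sub>\<bullet>\<close> with \<open>b\<close>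
  upper triangular. The factors \<open>g\<^sub>n, g\<^sub>n\<^sub>-\<^sub>1, \<dots>\<close> are split off from the left: if \<open>b\<close> already
  preserves \<open>W\<^sub>i\<close> for all \<open>i \<ge> k\<close>, the hyperplane \<open>b W\<^sub>k\<^sub>-\<^sub>1\<close> of \<open>W\<^sub>k\<close> is the kernel of a functional
  which vanishes on \<open>X W\<^sub>k\<close>. Together with \<open>b W\<^sub>\<bullet> \<in> C\<^sub>w\<close> this confines its coefficients to the
  Springer inversions with first entry \<open>k\<close>, and they determine \<open>g\<^sub>k\<close>. Since \<open>g\<^sub>k\<close> commutes with
  \<open>X\<close> on \<open>W\<^sub>k\<close>, the flag \<open>g\<^sub>k\<^sup>-\<^sup>1 b W\<^sub>\<bullet>\<close> is again in the Springer fiber, and it contains \<open>W\<^sub>k\<^sub>-\<^sub>1\<close>.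

  The inverse of the parametrization is regular because the functional cutting out the
  \<open>(k - 1)\<close>-st subspace of a flag is, on the opposite big cell, given by Cramer's rule, and the
  coordinates are obtained from these functionals by a polynomial recursion.
\<close>

subsection \<open>Sheaves of regular functions\<close>

text \<open>A factor \<open>G k y\<close> commutes with \<open>X\<close> only on \<open>W k\<close>.
  This forces the descending order: when the factor with index \<open>k\<close> is removed, the
  steps of the flag from \<open>k\<close> on are already coordinate spaces, and all smaller steps
  lie in \<open>W k\<close>. A flag does not determine the matrix representing it, so the inverse
  map cannot read its coordinates off a matrix. It uses functionals attached to the subspaces of the
  flag instead. The functional for the step of dimension k - 1 is normalised to have coefficient 1
  at the basis vector labelled \<open>k\<close>; it exists uniquely as soon as that step meets the
  span of the basis vectors labelled \<open>k\<close>, ..., \<open>n\<close> trivially. These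
  conditions cut out an open set of flags containing the whole Schubert cell, so one chart suffices.
  The functional still sees the outer factors, whose product H is unipotent. Evaluated on H(e_l + x
  e_k), with e_k, e_l the basis vectors labelled \<open>k\<close>, \<open>l\<close>, it gives a
  linear equation in which x has coefficient 1. Hence the only denominators are those of Cramer's
  rule.\<close>

locale function_sheaf =
  fixes X :: "'a space_with_functions"
  assumes regular_const: "openin (top_of X) U \<Longrightarrow> regular X U (\<lambda>_. a)"
    and regular_add: "openin (top_of X) U \<Longrightarrow> regular X U f \<Longrightarrow> regular X U g \<Longrightarrow>
      regular X U (\<lambda>x. f x + g x)"
    and regular_mult: "openin (top_of X) U \<Longrightarrow> regular X U f \<Longrightarrow> regular X U g \<Longrightarrow>
      regular X U (\<lambda>x. f x * g x)"
    and regular_divide: "openin (top_of X) U \<Longrightarrow> regular X U f \<Longrightarrow> regular X U g \<Longrightarrow>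
      (\<And>x. x \<in> U \<Longrightarrow> g x \<noteq> 0) \<Longrightarrow> regular X U (\<lambda>x. f x / g x)"
    and openin_nonvanishing: "openin (top_of X) U \<Longrightarrow> regular X U f \<Longrightarrow>
      openin (top_of X) {x \<in> U. f x \<noteq> 0}"
    and regular_restrict: "regular X U f \<Longrightarrow> openin (top_of X) U \<Longrightarrow> openin (top_of X) V \<Longrightarrow>
      V \<subseteq> U \<Longrightarrow> regular X V f"
    and regular_cong: "regular X U f \<Longrightarrow> (\<And>x. x \<in> U \<Longrightarrow> f x = g x) \<Longrightarrow> regular X U g"
    and regular_local: "openin (top_of X) U \<Longrightarrow>
      (\<And>x. x \<in> U \<Longrightarrow> \<exists>V. openin (top_of X) V \<and> x \<in> V \<and> V \<subseteq> U \<and> regular X V f) \<Longrightarrow>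
      regular X U f"
begin

lemma regular_sum:
  assumes "openin (top_of X) U" "\<And>i. i \<in> I \<Longrightarrow> regular X U (f i)"
  shows "regular X U (\<lambda>x. \<Sum>i\<in>I. f i x)"
proof (cases "finite I")
  case True
  then show ?thesis using assms(2)
    by (induction I) (auto intro: regular_add regular_const assms(1))
qed (simp add: regular_const assms(1))

lemma regular_prod:
  assumes "openin (top_of X) U" "\<And>i. i \<in> I \<Longrightarrow> regular X U (f i)"
  shows "regular X U (\<lambda>x. \<Prod>i\<in>I. f i x)"
proof (cases "finite I")
  case True
  then show ?thesis using assms(2)
    by (induction I) (auto intro: regular_mult regular_const assms(1))
qed (simp add: regular_const assms(1))

lemma regular_uminus:
  assumes "openin (top_of X) U" "regular X U f"
  shows "regular X U (\<lambda>x. - f x)"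
  using regular_mult[OF assms(1) regular_const[OF assms(1), of "-1"] assms(2)] by simp

lemma regular_diff:
  assumes "openin (top_of X) U" "regular X U f" "regular X U g"
  shows "regular X U (\<lambda>x. f x - g x)"
  using regular_add[OF assms(1,2) regular_uminus[OF assms(1,3)]] by simp

lemma regular_det:
  assumes "openin (top_of X) U" "\<And>i j. i < m \<Longrightarrow> j < m \<Longrightarrow> regular X U (\<lambda>x. a x i j)"
  shows "regular X U (\<lambda>x. det (mat m m (\<lambda>(i, j). a x i j)))"
proof -
  have *: "regular X U (\<lambda>x. \<Prod>i = 0..<m. a x i (p i))" if "p permutes {0..<m}" for p
    by (rule regular_prod[OF assms(1)], rule assms(2)) (use permutes_in_image[OF that] in auto)
  have "regular X U (\<lambda>x. \<Sum>p \<in> {p. p permutes {0..<m}}. signof p * (\<Prod>i = 0..<m. a x i (p i)))"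
    by (rule regular_sum[OF assms(1)], rule regular_mult[OF assms(1) regular_const[OF assms(1)]])
      (simp add: *)
  moreover have "(\<Sum>p \<in> {p. p permutes {0..<m}}. signof p * (\<Prod>i = 0..<m. a x i (p i))) =
      det (mat m m (\<lambda>(i, j). a x i j))" for x
    by (subst det_def'[of _ m])
      (auto intro!: sum.cong prod.cong arg_cong2[where f = "(*)"] simp: permutes_in_image)
  ultimately show ?thesis by simp
qed

lemma openin_Collect_nonvanishing:
  assumes "finite I" "\<And>i. i \<in> I \<Longrightarrow> regular X (topspace (top_of X)) (f i)"
  shows "openin (top_of X) {x \<in> topspace (top_of X). \<forall>i \<in> I. f i x \<noteq> 0}"
proof -
  have "openin (top_of X)
      {x \<in> topspace (top_of X). (\<Prod>i\<in>I. f i x) \<noteq> 0}"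
    by (intro openin_nonvanishing regular_prod assms(2)) auto
  then show ?thesis by (simp add: assms(1))
qed

end


text \<open>Every other space of the theorem arises from such a space by
  \<open>quotient_space\<close> and \<open>subvariety\<close>, which preserve
  \<open>function_sheaf\<close>; later regularity arguments can therefore use the closure rules
  alone.\<close>

lemma function_sheaf_quasi_affine: "function_sheaf (quasi_affine S C)"
proof -
  let ?X = "quasi_affine S C"
  have op: "openin (top_of ?X) {x \<in> U. p x \<noteq> 0}"
    if "openin (top_of ?X) U" "p \<in> polynomials C" for U p
  proof -
    have "zariski_open S C (S - {x. \<forall>q \<in> {p}. q x = 0})"
      unfolding zariski_open_def using that(2) by blast
    moreover have "U \<subseteq> S"
      using openin_subset[OF that(1)] by (simp add: quasi_affine_def topspace_zariski_topology)
    ultimately have "openin (top_of ?X) (U \<inter> (S - {x. \<forall>q \<in> {p}. q x = 0}))"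
      using that(1) by (auto simp: quasi_affine_def openin_zariski_topology[symmetric])
    moreover have "U \<inter> (S - {x. \<forall>q \<in> {p}. q x = 0}) = {x \<in> U. p x \<noteq> 0}"
      using \<open>U \<subseteq> S\<close> by auto
    ultimately show ?thesis by simp
  qed
  have reg: "regular ?X U f \<longleftrightarrow> (\<forall>x \<in> U. \<exists>N p q. openin (top_of ?X) N \<and> x \<in> N \<and> N \<subseteq> U \<and>
         p \<in> polynomials C \<and> q \<in> polynomials C \<and> (\<forall>y \<in> N. q y \<noteq> 0 \<and> f y = p y / q y))" for U f
    by (simp add: quasi_affine_def)
  \<comment> \<open>Sum, product and quotient are treated alike: two local fractions are restricted
    to a common neighbourhood, and the last premise supplies the fraction for the combined
    function.\<close>
  have comb: "regular ?X U h"
    if f: "regular ?X U f" and g: "regular ?X U g" and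
      *: "\<And>p q r s. p \<in> polynomials C \<Longrightarrow> q \<in> polynomials C \<Longrightarrow> r \<in> polynomials C \<Longrightarrow>
        s \<in> polynomials C \<Longrightarrow> \<exists>t u. t \<in> polynomials C \<and> u \<in> polynomials C \<and>
          (\<forall>y\<in>U. q y \<noteq> 0 \<longrightarrow> s y \<noteq> 0 \<longrightarrow> f y = p y / q y \<longrightarrow> g y = r y / s y \<longrightarrow>
            u y \<noteq> 0 \<and> h y = t y / u y)" for U f g h
    unfolding reg
  proof
    fix x assume "x \<in> U"
    obtain N p q where 1: "openin (top_of ?X) N" "x \<in> N" "N \<subseteq> U" "p \<in> polynomials C"
      "q \<in> polynomials C" "\<forall>y \<in> N. q y \<noteq> 0 \<and> f y = p y / q y"
      using bspec[OF f[unfolded reg] \<open>x \<in> U\<close>] by blast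
    obtain M r s where 2: "openin (top_of ?X) M" "x \<in> M" "M \<subseteq> U" "r \<in> polynomials C"
      "s \<in> polynomials C" "\<forall>y \<in> M. s y \<noteq> 0 \<and> g y = r y / s y"
      using bspec[OF g[unfolded reg] \<open>x \<in> U\<close>] by blast
    obtain t u where 3: "t \<in> polynomials C" "u \<in> polynomials C" 
      "\<forall>y\<in>U. q y \<noteq> 0 \<longrightarrow> s y \<noteq> 0 \<longrightarrow> f y = p y / q y \<longrightarrow> g y = r y / s y \<longrightarrow>
            u y \<noteq> 0 \<and> h y = t y / u y"
      using *[OF 1(4,5) 2(4,5)] by (elim exE conjE) (rule that)
    have "\<forall>y \<in> N \<inter> M. u y \<noteq> 0 \<and> h y = t y / u y"
    proof
      fix y assume "y \<in> N \<inter> M"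
      then have y: "y \<in> U" "q y \<noteq> 0" "f y = p y / q y" "s y \<noteq> 0" "g y = r y / s y"
        using 1(3,6) 2(6) by auto
      show "u y \<noteq> 0 \<and> h y = t y / u y"
        using bspec[OF 3(3) y(1)] y(2-) by (elim impE)
    qed
    moreover have "openin (top_of ?X) (N \<inter> M)" "x \<in> N \<inter> M" "N \<inter> M \<subseteq> U"
      using 1(1-3) 2(1-3) by auto
    ultimately show "\<exists>N p q. openin (top_of ?X) N \<and> x \<in> N \<and> N \<subseteq> U \<and>
         p \<in> polynomials C \<and> q \<in> polynomials C \<and> (\<forall>y \<in> N. q y \<noteq> 0 \<and> h y = p y / q y)"
      using 3(1,2) by blast
  qed
  show ?thesis
  proof
    fix U a assume "openin (top_of ?X) U"
    then show "regular ?X U (\<lambda>_. a)"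
      unfolding reg
      by (intro ballI) (rule exI[of _ U], rule exI[of _ "\<lambda>_. a"], rule exI[of _ "\<lambda>_. 1"],
        simp add: polynomials.const)
  next
    fix U f g assume "regular ?X U f" "regular ?X U g"
    then show "regular ?X U (\<lambda>x. f x + g x)"
    proof (rule comb)
      fix p q r s assume "p \<in> polynomials C" "q \<in> polynomials C" "r \<in> polynomials C" "s \<in> polynomials C"
      then show "\<exists>t u. t \<in> polynomials C \<and> u \<in> polynomials C \<and>
          (\<forall>y\<in>U. q y \<noteq> 0 \<longrightarrow> s y \<noteq> 0 \<longrightarrow> f y = p y / q y \<longrightarrow> g y = r y / s y \<longrightarrow>
            u y \<noteq> 0 \<and> f y + g y = t y / u y)"
        by (intro exI[of _ "\<lambda>x. p x * s x + r x * q x"] exI[of _ "\<lambda>x. q x * s x"])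
          (auto intro: polynomials.add polynomials.mult simp: add_frac_eq)
    qed
  next
    fix U f g assume "regular ?X U f" "regular ?X U g"
    then show "regular ?X U (\<lambda>x. f x * g x)"
    proof (rule comb)
      fix p q r s assume "p \<in> polynomials C" "q \<in> polynomials C" "r \<in> polynomials C" "s \<in> polynomials C"
      then show "\<exists>t u. t \<in> polynomials C \<and> u \<in> polynomials C \<and>
          (\<forall>y\<in>U. q y \<noteq> 0 \<longrightarrow> s y \<noteq> 0 \<longrightarrow> f y = p y / q y \<longrightarrow> g y = r y / s y \<longrightarrow>
            u y \<noteq> 0 \<and> f y * g y = t y / u y)"
        by (intro exI[of _ "\<lambda>x. p x * r x"] exI[of _ "\<lambda>x. q x * s x"])
          (auto intro: polynomials.add polynomials.mult)
    qed
  next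
    fix U f g assume "regular ?X U f" "regular ?X U g" and nz: "\<And>x. x \<in> U \<Longrightarrow> g x \<noteq> (0::complex)"
    from this(1,2) show "regular ?X U (\<lambda>x. f x / g x)"
    proof (rule comb)
      fix p q r s assume "p \<in> polynomials C" "q \<in> polynomials C" "r \<in> polynomials C" "s \<in> polynomials C"
      then show "\<exists>t u. t \<in> polynomials C \<and> u \<in> polynomials C \<and>
          (\<forall>y\<in>U. q y \<noteq> 0 \<longrightarrow> s y \<noteq> 0 \<longrightarrow> f y = p y / q y \<longrightarrow> g y = r y / s y \<longrightarrow>
            u y \<noteq> 0 \<and> f y / g y = t y / u y)"
        using nz by (intro exI[of _ "\<lambda>x. p x * s x"] exI[of _ "\<lambda>x. q x * r x"])
          (force intro: polynomials.add polynomials.mult)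
    qed
  next
    fix U f assume U: "openin (top_of ?X) U" and f: "regular ?X U f"
    show "openin (top_of ?X) {x \<in> U. f x \<noteq> 0}"
    proof (subst openin_subopen, intro ballI)
      fix x assume "x \<in> {x \<in> U. f x \<noteq> 0}"
      then obtain N p q where 1: "openin (top_of ?X) N" "x \<in> N" "N \<subseteq> U" "p \<in> polynomials C"
          "q \<in> polynomials C" "\<forall>y \<in> N. q y \<noteq> 0 \<and> f y = p y / q y" "f x \<noteq> 0"
        using f[unfolded reg, THEN bspec, of x] by blast
      then show "\<exists>T. openin (top_of ?X) T \<and> x \<in> T \<and> T \<subseteq> {x \<in> U. f x \<noteq> 0}"
        using op[OF 1(1,4)] by (intro exI[of _ "{x \<in> N. p x \<noteq> 0}"]) auto
    qed
  next
    fix U V f assume *: "regular ?X U f" "openin (top_of ?X) U" "openin (top_of ?X) V" "V \<subseteq> U"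
    show "regular ?X V f"
      unfolding reg
    proof
      fix x assume "x \<in> V"
      then obtain N p q where 1: "openin (top_of ?X) N" "x \<in> N" "N \<subseteq> U" "p \<in> polynomials C"
          "q \<in> polynomials C" "\<forall>y \<in> N. q y \<noteq> 0 \<and> f y = p y / q y"
        using *(1)[unfolded reg, THEN bspec, of x] *(4) by blast
      then show "\<exists>N p q. openin (top_of ?X) N \<and> x \<in> N \<and> N \<subseteq> V \<and> p \<in> polynomials C \<and>
          q \<in> polynomials C \<and> (\<forall>y \<in> N. q y \<noteq> 0 \<and> f y = p y / q y)"
        using \<open>x \<in> V\<close> *(3) by (intro exI[of _ "N \<inter> V"] exI[of _ p] exI[of _ q]) auto
    qed
  next
    fix U and f g :: "'a \<Rightarrow> complex"
    assume f: "regular ?X U f" and fg: "\<And>x. x \<in> U \<Longrightarrow> f x = g x"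
    show "regular ?X U g"
      unfolding reg
    proof
      fix x assume "x \<in> U"
      then obtain N p q where 1: "openin (top_of ?X) N" "x \<in> N" "N \<subseteq> U" "p \<in> polynomials C"
          "q \<in> polynomials C" "\<forall>y \<in> N. q y \<noteq> 0 \<and> f y = p y / q y"
        using f[unfolded reg, THEN bspec, of x] by blast
      then show "\<exists>N p q. openin (top_of ?X) N \<and> x \<in> N \<and> N \<subseteq> U \<and> p \<in> polynomials C \<and>
          q \<in> polynomials C \<and> (\<forall>y \<in> N. q y \<noteq> 0 \<and> g y = p y / q y)"
        using fg by (intro exI[of _ N] exI[of _ p] exI[of _ q]) (auto simp: subset_iff)
    qed
  next
    fix U f assume U: "openin (top_of ?X) U"
      and loc: "\<And>x. x \<in> U \<Longrightarrow> \<exists>V. openin (top_of ?X) V \<and> x \<in> V \<and> V \<subseteq> U \<and> regular ?X V f"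
    show "regular ?X U f"
      unfolding reg
    proof
      fix x assume "x \<in> U"
      then obtain V where V: "x \<in> V" "V \<subseteq> U" "regular ?X V f" using loc by blast
      then show "\<exists>N p q. openin (top_of ?X) N \<and> x \<in> N \<and> N \<subseteq> U \<and> p \<in> polynomials C \<and>
          q \<in> polynomials C \<and> (\<forall>y \<in> N. q y \<noteq> 0 \<and> f y = p y / q y)"
        using bspec[OF V(3)[unfolded reg] V(1)] V(2) by (meson order_trans)
    qed
  qed
qed

lemma regular_coordinate:
  assumes "c \<in> C"
  shows "regular (quasi_affine S C) S c"
proof -
  have "openin (zariski_topology S C) S"
    using openin_topspace[of "zariski_topology S C"] by (simp add: topspace_zariski_topology)
  moreover have "c \<in> polynomials C" "(\<lambda>_. 1) \<in> polynomials C"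
    using assms by (auto intro: polynomials.intros)
  ultimately show ?thesis
    unfolding quasi_affine_def
    by (simp, intro ballI) (rule exI[of _ S], simp, rule exI[of _ c], simp, rule exI[of _ "\<lambda>_. 1"], simp)
qed

lemma (in function_sheaf) quotient_space: "function_sheaf (quotient_space X Y \<pi>)"
proof -
  let ?Q = "quotient_space X Y \<pi>"
  let ?pre = "\<lambda>U. {x \<in> topspace (top_of X). \<pi> x \<in> U}"
  have op: "openin (top_of ?Q) U \<longleftrightarrow> U \<subseteq> Y \<and> openin (top_of X) (?pre U)" for U
    by (simp add: openin_quotient_space quotient_open_def)
  have reg: "regular ?Q U f \<longleftrightarrow> regular X (?pre U) (\<lambda>x. f (\<pi> x))" for U f
    by (simp add: quotient_space_def comp_def)
  show ?thesis
  proof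
    fix U f assume "openin (top_of ?Q) U" "regular ?Q U f"
    then have "U \<subseteq> Y" "openin (top_of X) {x \<in> ?pre U. f (\<pi> x) \<noteq> 0}"
      using openin_nonvanishing[of "?pre U" "\<lambda>x. f (\<pi> x)"] unfolding op reg by simp_all
    moreover have "{x \<in> ?pre U. f (\<pi> x) \<noteq> 0} = ?pre {x \<in> U. f x \<noteq> 0}" by auto
    ultimately show "openin (top_of ?Q) {x \<in> U. f x \<noteq> 0}" by (auto simp: op)
  next
    fix U V f assume "regular ?Q U f" "openin (top_of ?Q) U" "openin (top_of ?Q) V" "V \<subseteq> U"
    then show "regular ?Q V f"
      unfolding op reg by (auto elim!: regular_restrict)
  next
    fix U and f g :: "'b \<Rightarrow> complex"
    assume "regular ?Q U f" "\<And>x. x \<in> U \<Longrightarrow> f x = g x"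
    then show "regular ?Q U g"
      unfolding reg by (auto elim!: regular_cong)
  next
    fix U f assume U: "openin (top_of ?Q) U"
      and loc: "\<And>x. x \<in> U \<Longrightarrow> \<exists>V. openin (top_of ?Q) V \<and> x \<in> V \<and> V \<subseteq> U \<and> regular ?Q V f"
    show "regular ?Q U f"
      unfolding reg
    proof (rule regular_local)
      show "openin (top_of X) (?pre U)" using U by (simp add: op)
      fix x assume x: "x \<in> ?pre U"
      then obtain V where "openin (top_of ?Q) V" "\<pi> x \<in> V" "V \<subseteq> U" "regular ?Q V f"
        using loc by blast
      then show "\<exists>V. openin (top_of X) V \<and> x \<in> V \<and> V \<subseteq> ?pre U \<and> regular X V (\<lambda>x. f (\<pi> x))"
        using x by (intro exI[of _ "?pre V"]) (auto simp: op reg)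
    qed
  qed (auto simp: op reg intro: regular_const regular_add regular_mult regular_divide)
qed

lemma (in function_sheaf) subvariety: "function_sheaf (subvariety X Z)"
proof -
  let ?S = "subvariety X Z"
  have top: "top_of ?S = subtopology (top_of X) Z" by (simp add: subvariety_def)
  have reg: "regular ?S U f \<longleftrightarrow> (\<forall>x \<in> U. \<exists>V F. openin (top_of X) V \<and> x \<in> V \<and> regular X V F \<and>
      (\<forall>y \<in> V \<inter> U. f y = F y))" for U f
    by (simp add: subvariety_def)
  have comb: "regular ?S U (\<lambda>x. c (f x) (g x))"
    if f: "regular ?S U f" and g: "regular ?S U g" and
      *: "\<And>V F G. openin (top_of X) V \<Longrightarrow> regular X V F \<Longrightarrow> regular X V G \<Longrightarrow>
        regular X V (\<lambda>x. c (F x) (G x))" for U c f g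
    unfolding reg
  proof
    fix x assume "x \<in> U"
    obtain V F where 1: "openin (top_of X) V" "x \<in> V" "regular X V F" "\<forall>y \<in> V \<inter> U. f y = F y"
      using f[unfolded reg, THEN bspec, of x] \<open>x \<in> U\<close> by blast
    obtain W G where 2: "openin (top_of X) W" "x \<in> W" "regular X W G" "\<forall>y \<in> W \<inter> U. g y = G y"
      using g[unfolded reg, THEN bspec, of x] \<open>x \<in> U\<close> by blast
    have 3: "openin (top_of X) (V \<inter> W)" using 1 2 by auto
    have "regular X (V \<inter> W) F" "regular X (V \<inter> W) G"
      using regular_restrict[OF 1(3,1) 3] regular_restrict[OF 2(3,1) 3] by auto
    then show "\<exists>V F. openin (top_of X) V \<and> x \<in> V \<and> regular X V F \<and>
        (\<forall>y \<in> V \<inter> U. c (f y) (g y) = F y)"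
      using 1 2 3 by (intro exI[of _ "V \<inter> W"] exI[of _ "\<lambda>x. c (F x) (G x)"]) (auto intro: *)
  qed
  show ?thesis
  proof
    fix U a assume "openin (top_of ?S) U"
    then obtain T where "openin (top_of X) T" "U = T \<inter> Z"
      by (auto simp: top openin_subtopology)
    then show "regular ?S U (\<lambda>_. a)"
      unfolding reg by (auto intro!: exI[of _ T] exI[of _ "\<lambda>_. a"] regular_const)
  next
    fix U f g assume "regular ?S U f" "regular ?S U g"
    then show "regular ?S U (\<lambda>x. f x + g x)" by (rule comb) (rule regular_add)
  next
    fix U f g assume "regular ?S U f" "regular ?S U g"
    then show "regular ?S U (\<lambda>x. f x * g x)" by (rule comb) (rule regular_mult)
  next
    fix U f g assume f: "regular ?S U f" and g: "regular ?S U g"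
      and nz: "\<And>x. x \<in> U \<Longrightarrow> g x \<noteq> (0::complex)"
    have inv: "regular ?S U (\<lambda>x. 1 / g x)"
      unfolding reg
    proof
      fix x assume "x \<in> U"
      obtain W G where 2: "openin (top_of X) W" "x \<in> W" "regular X W G" "\<forall>y \<in> W \<inter> U. g y = G y"
        using g[unfolded reg, THEN bspec, of x] \<open>x \<in> U\<close> by blast
      \<comment> \<open>The extension \<open>G\<close> may vanish at points of \<open>W\<close>
        outside \<open>U\<close>, so the neighbourhood is shrunk before inverting.\<close>
      let ?W = "{x \<in> W. G x \<noteq> 0}"
      have W: "openin (top_of X) ?W" using openin_nonvanishing 2 by blast
      have "regular X ?W (\<lambda>x. 1 / G x)"
        by (rule regular_divide[OF W regular_const[OF W]])
          (use regular_restrict[OF 2(3,1) W] in auto)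
      then show "\<exists>V F. openin (top_of X) V \<and> x \<in> V \<and> regular X V F \<and> (\<forall>y \<in> V \<inter> U. 1 / g y = F y)"
        using W 2 nz[OF \<open>x \<in> U\<close>] \<open>x \<in> U\<close> by (intro exI[of _ ?W] exI[of _ "\<lambda>x. 1 / G x"]) auto
    qed
    have "regular ?S U (\<lambda>x. f x * (1 / g x))"
      using f inv by (rule comb) (rule regular_mult)
    then show "regular ?S U (\<lambda>x. f x / g x)" by simp
  next
    fix U f assume U: "openin (top_of ?S) U" and f: "regular ?S U f"
    show "openin (top_of ?S) {x \<in> U. f x \<noteq> 0}"
    proof (subst openin_subopen, intro ballI)
      fix x assume x: "x \<in> {x \<in> U. f x \<noteq> 0}"
      then obtain V F where 1: "openin (top_of X) V" "x \<in> V" "regular X V F" "\<forall>y \<in> V \<inter> U. f y = F y"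
        using f[unfolded reg, THEN bspec, of x] by blast
      have "openin (top_of ?S) (U \<inter> ({x \<in> V. F x \<noteq> 0} \<inter> Z))"
        using U openin_nonvanishing[OF 1(1,3)] unfolding top by (metis openin_Int openin_subtopology)
      then show "\<exists>T. openin (top_of ?S) T \<and> x \<in> T \<and> T \<subseteq> {x \<in> U. f x \<noteq> 0}"
        using 1 x openin_subset[OF U] by (intro exI[of _ "U \<inter> ({x \<in> V. F x \<noteq> 0} \<inter> Z)"]) (auto simp: top)
    qed
  next
    fix U V f assume f: "regular ?S U f" and "V \<subseteq> U"
    show "regular ?S V f"
      unfolding reg
    proof
      fix x assume "x \<in> V"
      then have "x \<in> U" using \<open>V \<subseteq> U\<close> by blast
      from bspec[OF f[unfolded reg] this] \<open>V \<subseteq> U\<close>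
      show "\<exists>W F. openin (top_of X) W \<and> x \<in> W \<and> regular X W F \<and> (\<forall>y \<in> W \<inter> V. f y = F y)"
        by fast
    qed
  next
    fix U and f g :: "'a \<Rightarrow> complex"
    assume f: "regular ?S U f" and fg: "\<And>x. x \<in> U \<Longrightarrow> f x = g x"
    show "regular ?S U g"
      unfolding reg
    proof
      fix x assume "x \<in> U"
      from bspec[OF f[unfolded reg] this] fg
      show "\<exists>W F. openin (top_of X) W \<and> x \<in> W \<and> regular X W F \<and> (\<forall>y \<in> W \<inter> U. g y = F y)"
        by force
    qed
  next
    fix U f assume U: "openin (top_of ?S) U"
      and loc: "\<And>x. x \<in> U \<Longrightarrow> \<exists>V. openin (top_of ?S) V \<and> x \<in> V \<and> V \<subseteq> U \<and> regular ?S V f"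
    show "regular ?S U f"
      unfolding reg
    proof
      fix x assume "x \<in> U"
      then obtain V T where V: "x \<in> V" "V \<subseteq> U" "regular ?S V f" "V = T \<inter> Z" "openin (top_of X) T"
        using loc by (metis openin_subtopology top)
      then obtain W F where W: "openin (top_of X) W" "x \<in> W" "regular X W F" "\<forall>y \<in> W \<inter> V. f y = F y"
        using V(3)[unfolded reg, THEN bspec, of x] by blast
      have "U \<subseteq> Z" using openin_subset[OF U] by (simp add: top)
      have o: "openin (top_of X) (W \<inter> T)" using V W by auto
      show "\<exists>V F. openin (top_of X) V \<and> x \<in> V \<and> regular X V F \<and> (\<forall>y \<in> V \<inter> U. f y = F y)"
        using o regular_restrict[OF W(3,1) o] V W \<open>U \<subseteq> Z\<close>
        by (intro exI[of _ "W \<inter> T"] exI[of _ F]) auto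
    qed
  qed
qed

lemma regular_subvariety:
  assumes "openin (top_of X) V" "regular X V F" "U \<subseteq> V"
  shows "regular (subvariety X Z) U F"
  using assms unfolding subvariety_def by auto

text \<open>Once the coordinates pull back to regular functions, so do polynomials; preimages of
  open sets are then unions of nonvanishing loci, and local fractions pull back to local
  fractions.\<close>

lemma (in function_sheaf) morphism_quasi_affine:
  assumes into: "\<And>x. x \<in> topspace (top_of X) \<Longrightarrow> \<psi> x \<in> T"
    and coord: "\<And>c. c \<in> C \<Longrightarrow> regular X (topspace (top_of X)) (\<lambda>x. c (\<psi> x))"
  shows "morphism X (quasi_affine T C) \<psi>"
proof -
  let ?A = "topspace (top_of X)"
  have poly: "regular X ?A (\<lambda>x. p (\<psi> x))" if "p \<in> polynomials C" for p
    using that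
    by induction (auto intro: regular_const regular_add regular_mult coord)
  have open_pre: "openin (top_of X) {x \<in> ?A. \<psi> x \<in> U}" if U: "zariski_open T C U" for U
  proof -
    obtain P where P: "P \<subseteq> polynomials C" "U = T - {x. \<forall>p \<in> P. p x = 0}"
      using U unfolding zariski_open_def by blast
    have "openin (top_of X) (\<Union>p \<in> P. {x \<in> ?A. p (\<psi> x) \<noteq> 0})"
      using P(1) by (intro openin_Union) (auto intro!: openin_nonvanishing poly)
    also have "(\<Union>p \<in> P. {x \<in> ?A. p (\<psi> x) \<noteq> 0}) = {x \<in> ?A. \<psi> x \<in> U}"
      using P(2) into by auto
    finally show ?thesis .
  qed
  have "continuous_map (top_of X) (top_of (quasi_affine T C)) \<psi>"
    unfolding continuous_map_def quasi_affine_def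
    using into open_pre by (auto simp: topspace_zariski_topology openin_zariski_topology)
  moreover have "regular X {x \<in> ?A. \<psi> x \<in> U} (f \<circ> \<psi>)"
    if U: "openin (top_of (quasi_affine T C)) U" and f: "regular (quasi_affine T C) U f" for U f
  proof (rule regular_local)
    show "openin (top_of X) {x \<in> ?A. \<psi> x \<in> U}"
      using U by (intro open_pre) (simp add: quasi_affine_def openin_zariski_topology)
    fix x assume x: "x \<in> {x \<in> ?A. \<psi> x \<in> U}"
    then obtain N p q where N: "zariski_open T C N" "\<psi> x \<in> N" "N \<subseteq> U"
      "p \<in> polynomials C" "q \<in> polynomials C" "\<forall>y \<in> N. q y \<noteq> 0 \<and> f y = p y / q y"
      using f unfolding quasi_affine_def by (auto simp: openin_zariski_topology)
    let ?V = "{x \<in> ?A. \<psi> x \<in> N}"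
    have V: "openin (top_of X) ?V" by (rule open_pre[OF N(1)])
    have "regular X ?V (\<lambda>x. p (\<psi> x) / q (\<psi> x))"
      using N(4-6) V by (intro regular_divide)
        (auto intro: regular_restrict[OF poly openin_topspace V])
    then have "regular X ?V (f \<circ> \<psi>)"
      by (rule regular_cong) (use N(6) in auto)
    then show "\<exists>V. openin (top_of X) V \<and> x \<in> V \<and> V \<subseteq> {x \<in> ?A. \<psi> x \<in> U} \<and> regular X V (f \<circ> \<psi>)"
      using V N x by (intro exI[of _ ?V]) auto
  qed
  ultimately show ?thesis by (simp add: morphism_def)
qed

lemma morphism_compose:
  assumes "morphism X Y f" "morphism Y Z g"
  shows "morphism X Z (g \<circ> f)"
proof -
  have c: "continuous_map (top_of X) (top_of Y) f" "continuous_map (top_of Y) (top_of Z) g"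
    using assms by (auto simp: morphism_def)
  have "regular X {x \<in> topspace (top_of X). (g \<circ> f) x \<in> U} (h \<circ> (g \<circ> f))"
    if U: "openin (top_of Z) U" "regular Z U h" for U h
  proof -
    let ?V = "{y \<in> topspace (top_of Y). g y \<in> U}"
    have "openin (top_of Y) ?V" "regular Y ?V (h \<circ> g)"
      using assms(2) U by (simp_all add: morphism_def continuous_map_def)
    then have "regular X {x \<in> topspace (top_of X). f x \<in> ?V} ((h \<circ> g) \<circ> f)"
      using assms(1) unfolding morphism_def by blast
    moreover have "{x \<in> topspace (top_of X). f x \<in> ?V} =
        {x \<in> topspace (top_of X). (g \<circ> f) x \<in> U}"
      using c(1) by (auto simp: continuous_map_def)
    ultimately show ?thesis by (simp only: comp_assoc)
  qed
  with continuous_map_compose[OF c] show ?thesis unfolding morphism_def by simp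
qed

lemma (in function_sheaf) morphism_subvariety:
  assumes f: "morphism X Y f" and into: "f ` topspace (top_of X) \<subseteq> Z"
  shows "morphism X (subvariety Y Z) f"
  unfolding morphism_def
proof (intro conjI allI impI)
  show c: "continuous_map (top_of X) (top_of (subvariety Y Z)) f"
    using assms by (auto simp: morphism_def subvariety_def continuous_map_in_subtopology)
  fix U h assume U: "openin (top_of (subvariety Y Z)) U" and h: "regular (subvariety Y Z) U h"
  show "regular X {x \<in> topspace (top_of X). f x \<in> U} (h \<circ> f)"
  proof (rule regular_local)
    show U': "openin (top_of X) {x \<in> topspace (top_of X). f x \<in> U}"
      using c U by (auto simp: continuous_map_def)
    fix x assume x: "x \<in> {x \<in> topspace (top_of X). f x \<in> U}"
    then obtain V F where V: "openin (top_of Y) V" "f x \<in> V" "regular Y V F" "\<forall>y \<in> V \<inter> U. h y = F y"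
      using h unfolding subvariety_def by auto
    let ?W = "{x \<in> topspace (top_of X). f x \<in> V}"
    have W: "openin (top_of X) ?W" "regular X ?W (F \<circ> f)"
      using V f by (auto simp: morphism_def continuous_map_def)
    let ?N = "?W \<inter> {x \<in> topspace (top_of X). f x \<in> U}"
    have N: "openin (top_of X) ?N" using W U' by auto
    have "regular X ?N (h \<circ> f)"
      by (rule regular_cong[OF regular_restrict[OF W(2,1) N]]) (use V in auto)
    then show "\<exists>V. openin (top_of X) V \<and> x \<in> V \<and> V \<subseteq> {x \<in> topspace (top_of X). f x \<in> U} \<and>
        regular X V (h \<circ> f)"
      using N x V by (intro exI[of _ ?N]) auto
  qed
qed

lemma morphism_quotient_space:
  assumes "\<pi> ` topspace (top_of X) \<subseteq> Y"
  shows "morphism X (quotient_space X Y \<pi>) \<pi>"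
proof -
  let ?Q = "quotient_space X Y \<pi>"
  let ?A = "topspace (top_of X)"
  have op: "openin (top_of ?Q) U \<longleftrightarrow> U \<subseteq> Y \<and> openin (top_of X) {x \<in> ?A. \<pi> x \<in> U}" for U
    by (simp add: openin_quotient_space quotient_open_def)
  have "{x \<in> ?A. \<pi> x \<in> Y} = ?A" using assms by blast
  then have "openin (top_of ?Q) Y" by (simp add: op)
  moreover have "topspace (top_of ?Q) \<subseteq> Y"
    by (auto simp: topspace_def op)
  ultimately have "topspace (top_of ?Q) = Y" by (simp add: openin_subset subset_antisym)
  then have "continuous_map (top_of X) (top_of ?Q) \<pi>"
    using assms by (auto simp: continuous_map_def op)
  then show ?thesis
    unfolding morphism_def by (simp add: quotient_space_def)
qed

subsection \<open>Coordinate subspaces and flags\<close>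

lemma mult_mat_vec_index:
  assumes "A \<in> carrier_mat nr nc" "v \<in> carrier_vec nc" "i < nr"
  shows "(A *\<^sub>v v) $ i = (\<Sum>c<nc. A $$ (i, c) * v $ c)"
  using assms by (simp add: scalar_prod_def atLeast0LessThan)

lemma mult_unit_vec:
  fixes A :: "'a :: comm_semiring_1 mat"
  assumes "A \<in> carrier_mat nr nc" "c < nc"
  shows "A *\<^sub>v unit_vec nc c = col A c"
  using assms by (intro eq_vecI) auto

lemma GL_iff: "A \<in> GL n \<longleftrightarrow> A \<in> carrier_mat n n \<and> det A \<noteq> (0::complex)"
proof
  assume A: "A \<in> GL n"
  then obtain B where B: "A * B = 1\<^sub>m n" "B * A = 1\<^sub>m (dim_row B)" and Ac: "A \<in> carrier_mat n n"
    by (auto simp: GL_def invertible_mat_def inverts_mat_def)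
  \<comment> \<open>The inverse comes without a size; it is read off from the two identity
    products.\<close>
  have "dim_col (B * A) = n" using Ac by simp
  then have "dim_row B = n" unfolding B(2) by simp
  moreover have "dim_col (A * B) = n" unfolding B(1) by simp
  then have "dim_col B = n" by simp
  ultimately have Bc: "B \<in> carrier_mat n n" by auto
  have "det A * det B = 1" using det_mult[OF Ac Bc] B(1) by simp
  then show "A \<in> carrier_mat n n \<and> det A \<noteq> 0" using Ac by auto
next
  assume A: "A \<in> carrier_mat n n \<and> det A \<noteq> 0"
  then obtain B where "B \<in> carrier_mat n n" "A * B = 1\<^sub>m n" "B * A = 1\<^sub>m n"
    using det_non_zero_imp_unit[of A n] unfolding Units_def ring_mat_def by auto
  with A show "A \<in> GL n"
    by (auto simp: GL_def invertible_mat_def inverts_mat_def)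
qed

lemma GL_carrier: "A \<in> GL n \<Longrightarrow> A \<in> carrier_mat n n"
  by (simp add: GL_def)

lemma GL_mult: "A \<in> GL n \<Longrightarrow> B \<in> GL n \<Longrightarrow> A * B \<in> GL n"
  by (auto simp: GL_iff det_mult)

lemma GL_I: "A \<in> carrier_mat n n \<Longrightarrow> B \<in> carrier_mat n n \<Longrightarrow> A * B = 1\<^sub>m n \<Longrightarrow> A \<in> GL n"
  using det_mult[of A n B] by (auto simp: GL_iff)

lemma GL_inverse:
  assumes "A \<in> GL n"
  obtains B where "B \<in> carrier_mat n n" "A * B = 1\<^sub>m n" "B * A = 1\<^sub>m n"
  using assms det_non_zero_imp_unit[of A n]
  unfolding Units_def ring_mat_def GL_iff by auto

lemma GL_eq_zeroD:
  assumes "A \<in> GL n" "v \<in> carrier_vec n" "A *\<^sub>v v = 0\<^sub>v n"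
  shows "v = 0\<^sub>v n"
  using assms det_0_iff_vec_prod_zero_field[of A n] by (auto simp: GL_iff)

lemma Borel_diag:
  assumes "b \<in> Borel n" "i < n"
  shows "b $$ (i, i) \<noteq> 0"
proof -
  have "b \<in> carrier_mat n n" "upper_triangular b" "det b \<noteq> 0"
    using assms(1) by (auto simp: Borel_def GL_iff)
  then show ?thesis
    using upper_triangular_imp_det_eq_0_iff[of b n] assms(2)
    by (auto simp: diag_mat_def)
qed

text \<open>Back substitution from the bottom row upwards: in row \<open>a\<close> the columns in
  \<open>S\<close> drop out by assumption and the later columns outside \<open>S\<close> by
  induction, which leaves the nonzero diagonal entry times \<open>u $ a\<close>. It serves both for
  \<open>u\<close> vanishing on \<open>S\<close> and for \<open>b\<close> preserving the coordinate
  space of \<open>S\<close>.\<close>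

lemma upper_triangular_solve:
  assumes b: "b \<in> Borel n" and u: "u \<in> carrier_vec n"
    and off: "\<And>a c. a < c \<Longrightarrow> c < n \<Longrightarrow> a \<notin> S \<Longrightarrow> c \<in> S \<Longrightarrow> b $$ (a, c) * u $ c = 0"
    and bu: "\<And>a. a < n \<Longrightarrow> a \<notin> S \<Longrightarrow> (b *\<^sub>v u) $ a = 0"
    and a: "a < n" "a \<notin> S"
  shows "u $ a = 0"
  using a
proof (induction "n - a" arbitrary: a rule: less_induct)
  case less
  have bc: "b \<in> carrier_mat n n" and ut: "upper_triangular b"
    using b by (auto simp: Borel_def GL_def)
  have "0 = (\<Sum>c<n. b $$ (a, c) * u $ c)"
    using bu[OF less.prems] mult_mat_vec_index[OF bc u less.prems(1)] by simp
  also have "\<dots> = (\<Sum>c<n. if c = a then b $$ (a, a) * u $ a else 0)"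
  proof (rule sum.cong[OF refl])
    fix c assume "c \<in> {..<n}"
    then have c: "c < n" by simp
    consider "c < a" | "c = a" | "a < c" "c \<in> S" | "a < c" "c \<notin> S" by linarith
    then show "b $$ (a, c) * u $ c = (if c = a then b $$ (a, a) * u $ a else 0)"
    proof cases
      case 1
      then show ?thesis using ut bc less.prems(1) unfolding upper_triangular_def by auto
    next
      case 3
      then show ?thesis using off c less.prems by simp
    next
      case 4
      then show ?thesis using less.hyps[of c] c less.prems by simp
    qed simp
  qed
  also have "\<dots> = b $$ (a, a) * u $ a" using less.prems(1) by simp
  finally show ?case using Borel_diag[OF b less.prems(1)] by simp
qed

text \<open>For \<open>w = id\<close> this is the \<open>i\<close>-th subspace of the standard flag.\<close>

definition coord_space :: "nat \<Rightarrow> (nat \<Rightarrow> nat) \<Rightarrow> nat \<Rightarrow> complex vec set" where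
  "coord_space n w i = {v \<in> carrier_vec n. \<forall>j \<in> {1..n}. i < j \<longrightarrow> v $ (w j - 1) = 0}"

lemma coord_space_carrier: "v \<in> coord_space n w i \<Longrightarrow> v \<in> carrier_vec n"
  by (simp add: coord_space_def)

lemma coord_space_mono: "i \<le> j \<Longrightarrow> coord_space n w i \<subseteq> coord_space n w j"
  unfolding coord_space_def by (auto dest: le_less_trans)

lemma coord_space_id: "coord_space n id i = {v \<in> carrier_vec n. \<forall>c<n. i \<le> c \<longrightarrow> v $ c = 0}"
proof -
  have "(\<forall>j \<in> {1..n}. i < j \<longrightarrow> v $ (j - 1) = 0) \<longleftrightarrow> (\<forall>c<n. i \<le> c \<longrightarrow> v $ c = 0)" for v :: "complex vec"
  proof safe
    fix c assume "\<forall>j \<in> {1..n}. i < j \<longrightarrow> v $ (j - 1) = 0" "c < n" "i \<le> c"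
    then show "v $ c = 0" by (auto dest!: bspec[of _ _ "Suc c"])
  qed auto
  then show ?thesis unfolding coord_space_def by simp
qed

lemma mult_padded_vec:
  fixes g :: "'a :: comm_semiring_1 mat"
  assumes g: "g \<in> carrier_mat n n" and i: "i \<le> n" and x: "x \<in> carrier_vec i"
  shows "g *\<^sub>v vec n (\<lambda>c. if c < i then x $ c else 0) = mat n i (\<lambda>rc. g $$ rc) *\<^sub>v x"
    (is "g *\<^sub>v ?y = ?A *\<^sub>v x")
proof (rule eq_vecI)
  fix r assume "r < dim_vec (?A *\<^sub>v x)"
  then have r: "r < n" by simp
  have "(g *\<^sub>v ?y) $ r = (\<Sum>c<n. g $$ (r, c) * (if c < i then x $ c else 0))"
    using r g by (subst mult_mat_vec_index[of _ n n]) auto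
  also have "\<dots> = (\<Sum>c<i. g $$ (r, c) * x $ c)"
    using i by (intro sum.mono_neutral_cong_right) auto
  also have "\<dots> = (?A *\<^sub>v x) $ r"
    using r x by (subst mult_mat_vec_index[of _ n i]) auto
  finally show "(g *\<^sub>v ?y) $ r = (?A *\<^sub>v x) $ r" .
qed (use g in auto)

lemma GL_columns_inj:
  assumes g: "g \<in> GL n" and i: "i \<le> n" and x: "x \<in> carrier_vec i"
    and 0: "mat n i (\<lambda>rc. g $$ rc) *\<^sub>v x = 0\<^sub>v n"
  shows "x = 0\<^sub>v i"
proof -
  let ?y = "vec n (\<lambda>c. if c < i then x $ c else 0)"
  have "g *\<^sub>v ?y = 0\<^sub>v n" using mult_padded_vec[OF GL_carrier[OF g] i x] 0 by simp
  then have y: "?y = 0\<^sub>v n" using GL_eq_zeroD[OF g] by simp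
  have "x $ c = 0" if "c < i" for c
    using arg_cong[OF y, of "\<lambda>y. y $ c"] that i by simp
  then show ?thesis using x by (intro eq_vecI) auto
qed

lemma mult_coord_space_id:
  assumes g: "g \<in> carrier_mat n n" and i: "i \<le> n"
  shows "(*\<^sub>v) g ` coord_space n id i =
    {y. \<exists>x \<in> carrier_vec i. mat n i (\<lambda>rc. g $$ rc) *\<^sub>v x = y}" (is "?L = ?R")
proof -
  let ?A = "mat n i (\<lambda>rc. g $$ rc)"
  note eq = mult_padded_vec[OF g i]
  show ?thesis
  proof (intro equalityI subsetI)
    fix y assume "y \<in> ?L"
    then obtain v where v: "v \<in> coord_space n id i" "y = g *\<^sub>v v" by blast
    let ?x = "vec i (\<lambda>c. v $ c)"
    have "v = vec n (\<lambda>c. if c < i then ?x $ c else 0)"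
      using v(1) by (intro eq_vecI) (auto simp: coord_space_id)
    then show "y \<in> ?R" using eq[of ?x] v(2) by (auto intro!: bexI[of _ ?x])
  next
    fix y assume "y \<in> ?R"
    then obtain x where x: "x \<in> carrier_vec i" "y = ?A *\<^sub>v x" by blast
    then show "y \<in> ?L"
      using eq[OF x(1)]
      by (intro image_eqI[of _ _ "vec n (\<lambda>c. if c < i then x $ c else 0)"]) (auto simp: coord_space_id)
  qed
qed

text \<open>The span is rewritten as the column space of the first \<open>i\<close> columns of the
  identity, so that span and image of a matrix are compared through
  \<open>col_space_eq\<close>.\<close>

lemma standard_flag_nth:
  assumes "i \<le> n"
  shows "standard_flag n ! i = coord_space n id i"
proof -
  interpret vec_space "TYPE(complex)" n .
  let ?A = "mat n i (\<lambda>rc. 1\<^sub>m n $$ rc) :: complex mat"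
  have A: "?A \<in> carrier_mat n i" by simp
  have "std_basis n ` {1..i} = set (cols ?A)"
  proof -
    have "col ?A c = std_basis n (Suc c)" if "c < i" for c
      using that assms by (intro eq_vecI) (auto simp: std_basis_def)
    then have "set (cols ?A) = (\<lambda>c. std_basis n (Suc c)) ` {0..<i}"
      by (auto simp: cols_def)
    also have "\<dots> = std_basis n ` Suc ` {0..<i}" by (simp only: image_image)
    also have "Suc ` {0..<i} = {1..i}" by auto
    finally show ?thesis by (rule sym)
  qed
  then have "span (std_basis n ` {1..i}) = col_space ?A" by (simp add: col_space_def)
  also have "\<dots> = (*\<^sub>v) (1\<^sub>m n) ` coord_space n id i"
    unfolding mult_coord_space_id[OF one_carrier_mat assms] col_space_eq[OF A] by (auto intro!: mult_mat_vec_carrier[OF A])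
  also have "\<dots> = coord_space n id i" by (force simp: coord_space_id)
  finally show ?thesis using assms by (simp add: standard_flag_def nth_map del: upt_Suc)
qed

lemma length_flag_image [simp]: "length (flag_image g V) = length V"
  by (simp add: flag_image_def)

lemma length_standard_flag [simp]: "length (standard_flag n) = n + 1"
  by (simp add: standard_flag_def)

lemma flag_image_nth:
  "i \<le> n \<Longrightarrow> flag_image g (standard_flag n) ! i = (*\<^sub>v) g ` coord_space n id i"
  by (simp add: flag_image_def standard_flag_nth[symmetric] del: upt_Suc)

lemma flag_image_in_Flags:
  assumes g: "g \<in> GL n"
  shows "flag_image g (standard_flag n) \<in> Flags n"
proof -
  interpret vec_space "TYPE(complex)" n .
  have gc: "g \<in> carrier_mat n n" using g by (rule GL_carrier)
  let ?V = "flag_image g (standard_flag n)"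
  have main: "subspace class_ring (?V ! i) V \<and> vectorspace.dim class_ring (vs (?V ! i)) = i"
    if i: "i \<le> n" for i
  proof -
    let ?A = "mat n i (\<lambda>rc. g $$ rc)"
    have A: "?A \<in> carrier_mat n i" by simp
    have V: "?V ! i = span (set (cols ?A))"
      unfolding flag_image_nth[OF i] mult_coord_space_id[OF gc i]
        col_space_def[symmetric] col_space_eq[OF A] by (auto intro!: mult_mat_vec_carrier[OF A])
    have sub: "set (cols ?A) \<subseteq> carrier_vec n" using cols_dim[of ?A] by simp
    note inj = GL_columns_inj[OF g i]
    \<comment> \<open>Independence concerns the set of columns, so the rank is \<open>i\<close> only
      if no two columns coincide; equal columns would put a difference of unit vectors into the
      kernel.\<close>
    have dist: "distinct (cols ?A)"
    proof (rule ccontr)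
      assume "\<not> distinct (cols ?A)"
      then obtain c d where cd: "c < i" "d < i" "c \<noteq> d" "col ?A c = col ?A d"
        unfolding distinct_conv_nth by (metis A carrier_matD(2) cols_length cols_nth)
      let ?x = "unit_vec i c - unit_vec i d :: complex vec"
      have "?A *\<^sub>v ?x = ?A *\<^sub>v unit_vec i c - ?A *\<^sub>v unit_vec i d"
        by (rule mult_minus_distrib_mat_vec[of _ n i]) auto
      also have "\<dots> = col ?A c - col ?A d"
        using cd by (simp add: mult_unit_vec[OF A])
      also have "\<dots> = 0\<^sub>v n" unfolding cd(4) by (intro eq_vecI) auto
      finally have "?x = 0\<^sub>v i" by (rule inj[rotated]) auto
      then have "?x $ c = 0" using cd by simp
      then show False using cd by simp
    qed
    have li: "lin_indpt (set (cols ?A))"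
    proof
      assume "lin_dep (set (cols ?A))"
      from lin_depE[OF A this dist] inj show False by metis
    qed
    have "vectorspace.dim class_ring (vs (?V ! i)) = i"
      using lin_indpt_full_rank[OF A dist li] by (simp add: rank_def V)
    moreover have "subspace class_ring (?V ! i) V"
      unfolding V using span_is_submodule[OF sub] vec_vs
      by (simp add: subspace_def)
    ultimately show ?thesis by blast
  qed
  have "?V ! i \<subseteq> ?V ! (i + 1)" if "i < n" for i
    using that coord_space_mono[of i "i + 1" n id] by (auto simp: flag_image_nth)
  with main show ?thesis unfolding Flags_def by simp
qed


text \<open>The preimage of \<open>v\<close> under \<open>b\<close> is shown to vanish outside the
  positions \<open>S\<close> of the labels up to \<open>i\<close>. Since \<open>b\<close> maps the
  unit vectors of \<open>S\<close> into the coordinate space, its entries with column in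
  \<open>S\<close> and row outside are zero, which is what back substitution needs.\<close>

lemma Borel_coord_space:
  assumes b: "b \<in> Borel n" and sub: "(*\<^sub>v) b ` coord_space n w i \<subseteq> coord_space n w i"
    and w: "w permutes {1..n}"
  shows "(*\<^sub>v) b ` coord_space n w i = coord_space n w i"
proof
  show "coord_space n w i \<subseteq> (*\<^sub>v) b ` coord_space n w i"
  proof
    fix v assume v: "v \<in> coord_space n w i"
    have bG: "b \<in> GL n" using b by (simp add: Borel_def)
    then have bc: "b \<in> carrier_mat n n" by (rule GL_carrier)
    obtain B where B: "B \<in> carrier_mat n n" "b * B = 1\<^sub>m n"
      using GL_inverse[OF bG] by metis
    let ?u = "B *\<^sub>v v"
    have vc: "v \<in> carrier_vec n" using v by (rule coord_space_carrier)
    have bu: "b *\<^sub>v ?u = v" using assoc_mult_mat_vec[OF bc B(1) vc] B(2) vc by simp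
    define S where "S = {c. c < n \<and> (\<exists>j \<in> {1..n}. j \<le> i \<and> c = w j - 1)}"
    have wn: "w j - 1 < n" if "j \<in> {1..n}" for j
    proof -
      have "w j \<in> {1..n}" using that permutes_in_image[OF w] by blast
      then show ?thesis by auto
    qed
    have inj: "j = j'" if "w j - 1 = w j' - 1" "j \<in> {1..n}" "j' \<in> {1..n}" for j j'
    proof -
      have "w j \<in> {1..n}" "w j' \<in> {1..n}" using that permutes_in_image[OF w] by auto
      with that(1) have "w j = w j'" by auto
      then show ?thesis using permutes_inj[OF w] by (auto dest: injD)
    qed
    have notS: "\<exists>j \<in> {1..n}. i < j \<and> a = w j - 1" if "a < n" "a \<notin> S" for a
    proof -
      have "Suc a \<in> {1..n}" using that by auto
      then obtain j where "j \<in> {1..n}" "w j = Suc a"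
        using permutes_image[OF w] by (metis imageE)
      moreover from this have "\<not> j \<le> i" using that by (auto simp: S_def)
      ultimately show ?thesis by (intro bexI[of _ j]) auto
    qed
    have out: "w j - 1 \<notin> S" if "j \<in> {1..n}" "i < j" for j
    proof
      assume "w j - 1 \<in> S"
      then obtain j' where "j' \<in> {1..n}" "j' \<le> i" "w j - 1 = w j' - 1" unfolding S_def by blast
      with inj[of j j'] that show False by simp
    qed
    have "?u $ a = 0" if "a < n" "a \<notin> S" for a
    proof (rule upper_triangular_solve[OF b _ _ _ that])
      show uc: "?u \<in> carrier_vec n" using B(1) vc by (rule mult_mat_vec_carrier)
      fix a c assume "a < c" "c < n" "a \<notin> S" "c \<in> S"
      then have "a < n" by simp
      then obtain j where j: "j \<in> {1..n}" "i < j" "a = w j - 1" using notS \<open>a \<notin> S\<close> by blast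
      have "unit_vec n c $ (w j - 1) = 0" if "j \<in> {1..n}" "i < j" for j
        using wn[OF that(1)] out[OF that] \<open>c \<in> S\<close> \<open>c < n\<close> by (metis index_unit_vec(1))
      then have "unit_vec n c \<in> coord_space n w i"
        unfolding coord_space_def using unit_vec_carrier by blast
      then have "b *\<^sub>v unit_vec n c \<in> coord_space n w i" using sub by blast
      then have "(b *\<^sub>v unit_vec n c) $ a = 0" using j by (auto simp: coord_space_def)
      then show "b $$ (a, c) * ?u $ c = 0"
        using \<open>c < n\<close> \<open>a < n\<close> bc by (simp add: mult_unit_vec[OF bc])
    next
      fix a assume "a < n" "a \<notin> S"
      then show "(b *\<^sub>v ?u) $ a = 0"
        using notS v unfolding bu by (auto simp: coord_space_def)
    qed
    then have "?u \<in> coord_space n w i"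
      using mult_mat_vec_carrier[OF B(1) vc] out wn unfolding coord_space_def by blast
    then show "v \<in> (*\<^sub>v) b ` coord_space n w i" using bu by (metis imageI)
  qed
qed (rule sub)

lemma perm_matrix_carrier: "perm_matrix n w \<in> carrier_mat n n"
  by (simp add: perm_matrix_def)

lemma perm_matrix_mult:
  assumes w: "w permutes {1..n}" and v: "v \<in> carrier_vec n" and j: "j \<in> {1..n}"
  shows "(perm_matrix n w *\<^sub>v v) $ (w j - 1) = v $ (j - 1)"
proof -
  have wj: "w j \<in> {1..n}" using permutes_in_image[OF w] j by blast
  have "(perm_matrix n w *\<^sub>v v) $ (w j - 1) = (\<Sum>c<n. perm_matrix n w $$ (w j - 1, c) * v $ c)"
    using wj by (intro mult_mat_vec_index[OF perm_matrix_carrier v]) auto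
  also have "\<dots> = (\<Sum>c<n. if c = j - 1 then v $ c else 0)"
  proof (rule sum.cong[OF refl])
    fix c assume c: "c \<in> {..<n}"
    have "w j = w (c + 1) \<longleftrightarrow> j = c + 1" using permutes_inj[OF w] by (auto dest: injD)
    then show "perm_matrix n w $$ (w j - 1, c) * v $ c = (if c = j - 1 then v $ c else 0)"
      using c wj j by (auto simp: perm_matrix_def)
  qed
  also have "\<dots> = v $ (j - 1)" using j by auto
  finally show ?thesis .
qed

lemma perm_matrix_GL:
  assumes w: "w permutes {1..n}"
  shows "perm_matrix n w \<in> GL n"
proof -
  have "v = 0\<^sub>v n" if v: "v \<in> carrier_vec n" "perm_matrix n w *\<^sub>v v = 0\<^sub>v n" for v
  proof (rule eq_vecI)
    fix c assume "c < dim_vec (0\<^sub>v n :: complex vec)"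
    then have c: "Suc c \<in> {1..n}" by auto
    have "w (Suc c) \<in> {1..n}" using permutes_in_image[OF w] c by blast
    then show "v $ c = 0\<^sub>v n $ c"
      using perm_matrix_mult[OF w v(1) c] c unfolding v(2) by auto
  qed (use v in auto)
  then show ?thesis
    using det_0_iff_vec_prod_zero_field[OF perm_matrix_carrier[of n w]] perm_matrix_carrier
    by (auto simp: GL_iff)
qed

lemma perm_matrix_coord_space:
  assumes w: "w permutes {1..n}"
  shows "(*\<^sub>v) (perm_matrix n w) ` coord_space n id i = coord_space n w i"
proof (intro equalityI subsetI)
  fix y assume "y \<in> (*\<^sub>v) (perm_matrix n w) ` coord_space n id i"
  then show "y \<in> coord_space n w i"
    using perm_matrix_mult[OF w]
    by (auto simp: coord_space_def intro!: mult_mat_vec_carrier[OF perm_matrix_carrier])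
next
  fix y assume y: "y \<in> coord_space n w i"
  let ?v = "vec n (\<lambda>c. y $ (w (c + 1) - 1))"
  have "?v \<in> coord_space n id i" using y by (auto simp: coord_space_def)
  moreover have "perm_matrix n w *\<^sub>v ?v = y"
  proof (rule eq_vecI)
    fix a assume "a < dim_vec y"
    then have "Suc a \<in> {1..n}" using coord_space_carrier[OF y] by auto
    then obtain j where j: "j \<in> {1..n}" "w j = Suc a"
      using permutes_image[OF w] by (metis imageE)
    show "(perm_matrix n w *\<^sub>v ?v) $ a = y $ a"
      using perm_matrix_mult[OF w _ j(1), of ?v] j by auto
  qed (use coord_space_carrier[OF y] in \<open>auto simp: perm_matrix_def\<close>)
  ultimately show "y \<in> (*\<^sub>v) (perm_matrix n w) ` coord_space n id i" by (metis image_eqI)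
qed

lemma flag_image_perm_nth:
  assumes "g \<in> carrier_mat n n" "w permutes {1..n}" "i \<le> n"
  shows "flag_image (g * perm_matrix n w) (standard_flag n) ! i = (*\<^sub>v) g ` coord_space n w i"
proof -
  have "(*\<^sub>v) (g * perm_matrix n w) ` coord_space n id i =
      (*\<^sub>v) g ` (*\<^sub>v) (perm_matrix n w) ` coord_space n id i"
    unfolding image_image
    by (intro image_cong refl assoc_mult_mat_vec[OF assms(1) perm_matrix_carrier])
      (rule coord_space_carrier)
  then show ?thesis by (simp add: flag_image_nth[OF assms(3)] perm_matrix_coord_space[OF assms(2)])
qed

subsection \<open>Functionals vanishing on the steps of a flag\<close>

text \<open>\<open>f\<close> encodes the functional with coefficient \<open>1\<close> at \<open>e\<^sub>w\<^sub>(\<^sub>k\<^sub>)\<close> and \<open>-f i\<close> at \<open>e\<^sub>w\<^sub>(\<^sub>i\<^sub>)\<close> for \<open>i < k\<close>.\<close>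

definition annihilates :: "(nat \<Rightarrow> nat) \<Rightarrow> nat \<Rightarrow> complex vec set \<Rightarrow> (nat \<Rightarrow> complex) \<Rightarrow> bool" where
  "annihilates w k U f \<longleftrightarrow>
     (\<forall>v \<in> U. v $ (w k - 1) = (\<Sum>i\<in>{1..<k}. f i * v $ (w i - 1)))"

text \<open>Trivial intersection with the span of the basis vectors labelled \<open>k\<close>, ...,
  \<open>n\<close>. For \<open>U\<close> of dimension k - 1 the projection to the remaining
  coordinates is then bijective, so \<open>U\<close> is annihilated by exactly one normalised
  functional.\<close>

definition transversal :: "nat \<Rightarrow> (nat \<Rightarrow> nat) \<Rightarrow> nat \<Rightarrow> complex vec set \<Rightarrow> bool" where
  "transversal n w k U \<longleftrightarrow> (\<forall>v \<in> U. (\<forall>i\<in>{1..<k}. v $ (w i - 1) = 0) \<longrightarrow> v = 0\<^sub>v n)"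

text \<open>A transposed submatrix of \<open>g\<close>: the unknowns of the linear system are the
  coefficients of the functional, so rows of \<open>g\<close> become columns here.\<close>

definition minor_mat :: "(nat \<Rightarrow> nat) \<Rightarrow> nat \<Rightarrow> complex mat \<Rightarrow> complex mat" where
  "minor_mat w k g = mat (k - 1) (k - 1) (\<lambda>(c, i). g $$ (w (i + 1) - 1, c))"

lemma sum_Suc_lessThan: "(\<Sum>i\<in>{1..<k}. h i) = (\<Sum>i<k - 1. h (Suc i))"
  by (rule sum.reindex_bij_witness[of _ Suc "\<lambda>i. i - 1"]) auto

text \<open>\<open>U\<close> is spanned by the first k - 1 columns of \<open>g\<close>. Testing the
  functional on these columns gives the square system; a vector of \<open>U\<close> with vanishing
  coordinates at the labels below \<open>k\<close> is a kernel vector of the transpose.\<close>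

lemma
  assumes w: "w permutes {1..n}" and k: "k \<in> {1..n}" and g: "g \<in> carrier_mat n n"
  defines "U \<equiv> (*\<^sub>v) g ` coord_space n id (k - 1)"
  shows annihilates_iff:
      "annihilates w k U f \<longleftrightarrow>
       minor_mat w k g *\<^sub>v vec (k - 1) (\<lambda>i. f (Suc i)) = vec (k - 1) (\<lambda>c. g $$ (w k - 1, c))"
    and transversal_iff: "g \<in> GL n \<Longrightarrow> transversal n w k U \<longleftrightarrow> det (minor_mat w k g) \<noteq> 0"
proof -
  let ?m = "k - 1"
  let ?M = "minor_mat w k g"
  have M: "?M \<in> carrier_mat ?m ?m" by (simp add: minor_mat_def)
  have m: "?m \<le> n" "?m < n" using k by auto
  have wn: "w j - 1 < n" if "j \<in> {1..n}" for j
  proof -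
    have "w j \<in> {1..n}" using permutes_in_image[OF w] that by blast
    then show ?thesis by auto
  qed
  let ?A = "mat n ?m (\<lambda>rc. g $$ rc)"
  have U: "U = {y. \<exists>x \<in> carrier_vec ?m. ?A *\<^sub>v x = y}"
    unfolding U_def by (rule mult_coord_space_id[OF g m(1)])
  have Ax: "(?A *\<^sub>v x) $ (w j - 1) = (\<Sum>c<?m. g $$ (w j - 1, c) * x $ c)"
    if "x \<in> carrier_vec ?m" "j \<in> {1..n}" for x j
    using that wn[OF that(2)] m by (subst mult_mat_vec_index[of _ n ?m]) auto
  have Mf: "(?M *\<^sub>v vec ?m (\<lambda>i. f (Suc i))) $ c = (\<Sum>i\<in>{1..<k}. f i * g $$ (w i - 1, c))"
    if "c < ?m" for c
    using that unfolding sum_Suc_lessThan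
    by (subst mult_mat_vec_index[OF M]) (auto simp: minor_mat_def mult.commute intro!: sum.cong)
  show "annihilates w k U f \<longleftrightarrow>
      ?M *\<^sub>v vec ?m (\<lambda>i. f (Suc i)) = vec ?m (\<lambda>c. g $$ (w k - 1, c))"
  proof
    assume *: "annihilates w k U f"
    show "?M *\<^sub>v vec ?m (\<lambda>i. f (Suc i)) = vec ?m (\<lambda>c. g $$ (w k - 1, c))"
    proof (rule eq_vecI)
      fix c assume "c < dim_vec (vec ?m (\<lambda>c. g $$ (w k - 1, c)))"
      then have c: "c < ?m" by simp
      have e: "(?A *\<^sub>v unit_vec ?m c) $ (w j - 1) = g $$ (w j - 1, c)" if "j \<in> {1..n}" for j
        using c wn[OF that] by (simp add: mult_unit_vec[of _ n ?m])
      have "?A *\<^sub>v unit_vec ?m c \<in> U" unfolding U by auto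
      with * have "(?A *\<^sub>v unit_vec ?m c) $ (w k - 1) =
          (\<Sum>i\<in>{1..<k}. f i * (?A *\<^sub>v unit_vec ?m c) $ (w i - 1))"
        unfolding annihilates_def by blast
      also have "\<dots> = (\<Sum>i\<in>{1..<k}. f i * g $$ (w i - 1, c))"
        using k by (intro sum.cong refl arg_cong2[where f = "(*)"] e) auto
      finally show "(?M *\<^sub>v vec ?m (\<lambda>i. f (Suc i))) $ c = vec ?m (\<lambda>c. g $$ (w k - 1, c)) $ c"
        using c by (simp only: e[OF k] Mf index_vec)
    qed (simp add: minor_mat_def)
  next
    assume *: "?M *\<^sub>v vec ?m (\<lambda>i. f (Suc i)) = vec ?m (\<lambda>c. g $$ (w k - 1, c))"
    have gc: "g $$ (w k - 1, c) = (\<Sum>i\<in>{1..<k}. f i * g $$ (w i - 1, c))" if "c < ?m" for c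
      using Mf[OF that] that unfolding * by simp
    show "annihilates w k U f"
      unfolding annihilates_def
    proof
      fix v assume "v \<in> U"
      then obtain x where x: "x \<in> carrier_vec ?m" "v = ?A *\<^sub>v x" unfolding U by blast
      have "v $ (w k - 1) = (\<Sum>c<?m. (\<Sum>i\<in>{1..<k}. f i * g $$ (w i - 1, c)) * x $ c)"
        unfolding x(2) Ax[OF x(1) k] by (intro sum.cong refl arg_cong2[where f = "(*)"] gc) simp
      also have "\<dots> = (\<Sum>i\<in>{1..<k}. f i * (\<Sum>c<?m. g $$ (w i - 1, c) * x $ c))"
        unfolding sum_distrib_left sum_distrib_right
        by (subst sum.swap) (simp add: mult.assoc)
      also have "\<dots> = (\<Sum>i\<in>{1..<k}. f i * v $ (w i - 1))"
        unfolding x(2) using k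
        by (intro sum.cong refl arg_cong2[where f = "(*)"] Ax[OF x(1), symmetric]) auto
      finally show "v $ (w k - 1) = (\<Sum>i\<in>{1..<k}. f i * v $ (w i - 1))" .
    qed
  qed
  assume gG: "g \<in> GL n"
  have MT: "(transpose_mat ?M *\<^sub>v x) $ i = (?A *\<^sub>v x) $ (w (Suc i) - 1)"
    if "x \<in> carrier_vec ?m" "i < ?m" for x i
  proof -
    have "Suc i \<in> {1..n}" using that(2) k by auto
    then show ?thesis
      unfolding Ax[OF that(1) \<open>Suc i \<in> {1..n}\<close>] using that M
      by (subst mult_mat_vec_index[of _ ?m ?m]) (auto simp: minor_mat_def)
  qed
  note A0 = GL_columns_inj[OF gG m(1)]
  have "transversal n w k U \<longleftrightarrow>
      (\<forall>x \<in> carrier_vec ?m. transpose_mat ?M *\<^sub>v x = 0\<^sub>v ?m \<longrightarrow> x = 0\<^sub>v ?m)"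
  proof
    assume *: "transversal n w k U"
    show "\<forall>x \<in> carrier_vec ?m. transpose_mat ?M *\<^sub>v x = 0\<^sub>v ?m \<longrightarrow> x = 0\<^sub>v ?m"
    proof (intro ballI impI)
      fix x assume x: "x \<in> carrier_vec ?m" "transpose_mat ?M *\<^sub>v x = 0\<^sub>v ?m"
      have "(?A *\<^sub>v x) $ (w i - 1) = 0" if "i \<in> {1..<k}" for i
        using MT[OF x(1), of "i - 1"] that x(2) by auto
      moreover have "?A *\<^sub>v x \<in> U" using x(1) unfolding U by blast
      ultimately have "?A *\<^sub>v x = 0\<^sub>v n" using * unfolding transversal_def by blast
      then show "x = 0\<^sub>v ?m" using A0 x(1) by blast
    qed
  next
    assume *: "\<forall>x \<in> carrier_vec ?m. transpose_mat ?M *\<^sub>v x = 0\<^sub>v ?m \<longrightarrow> x = 0\<^sub>v ?m"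
    show "transversal n w k U"
      unfolding transversal_def
    proof (intro ballI impI)
      fix v assume "v \<in> U" and v: "\<forall>i\<in>{1..<k}. v $ (w i - 1) = 0"
      then obtain x where x: "x \<in> carrier_vec ?m" "v = ?A *\<^sub>v x" unfolding U by blast
      have "transpose_mat ?M *\<^sub>v x = 0\<^sub>v ?m"
        by (rule eq_vecI) (use MT[OF x(1)] v x(2) M in auto)
      then have "x = 0\<^sub>v ?m" using * x(1) by blast
      then show "v = 0\<^sub>v n" unfolding x(2) by (intro eq_vecI) auto
    qed
  qed
  also have "\<dots> \<longleftrightarrow> det (transpose_mat ?M) \<noteq> 0"
    using det_0_iff_vec_prod_zero_field[of "transpose_mat ?M" ?m] M by auto
  also have "det (transpose_mat ?M) = det ?M" by (rule det_transpose[OF M])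
  finally show "transversal n w k U \<longleftrightarrow> det ?M \<noteq> 0" .
qed

lemma annihilates_exists:
  assumes w: "w permutes {1..n}" and k: "k \<in> {1..n}" and g: "g \<in> GL n"
    and tr: "transversal n w k ((*\<^sub>v) g ` coord_space n id (k - 1))"
  shows "\<exists>f. annihilates w k ((*\<^sub>v) g ` coord_space n id (k - 1)) f"
proof -
  let ?M = "minor_mat w k g" and ?a = "vec (k - 1) (\<lambda>c. g $$ (w k - 1, c))"
  have M: "?M \<in> carrier_mat (k - 1) (k - 1)" by (simp add: minor_mat_def)
  have "det ?M \<noteq> 0" using tr transversal_iff[OF w k GL_carrier[OF g] g] by simp
  then obtain N where N: "N \<in> carrier_mat (k - 1) (k - 1)" "?M * N = 1\<^sub>m (k - 1)"
    using GL_inverse[of ?M "k - 1"] M by (auto simp: GL_iff)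
  let ?x = "N *\<^sub>v ?a"
  have "?M *\<^sub>v ?x = ?a" using assoc_mult_mat_vec[OF M N(1), of ?a] N(2) by simp
  moreover have "vec (k - 1) (\<lambda>i. ?x $ (Suc i - 1)) = ?x" using N(1) by (intro eq_vecI) auto
  ultimately have "annihilates w k ((*\<^sub>v) g ` coord_space n id (k - 1)) (\<lambda>i. ?x $ (i - 1))"
    unfolding annihilates_iff[OF w k GL_carrier[OF g]] by simp
  then show ?thesis by blast
qed

text \<open>Besides exhibiting the coefficients as quotients of polynomials in the entries of
  \<open>g\<close>, this shows that they are unique, so that choosing a functional by
  \<open>SOME\<close> does no harm.\<close>

lemma annihilates_cramer:
  assumes w: "w permutes {1..n}" and k: "k \<in> {1..n}" and g: "g \<in> GL n"
    and tr: "transversal n w k ((*\<^sub>v) g ` coord_space n id (k - 1))"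
    and f: "annihilates w k ((*\<^sub>v) g ` coord_space n id (k - 1)) f"
    and i: "i \<in> {1..<k}"
  shows "f i = det (mat (k - 1) (k - 1) (\<lambda>(c, j). g $$ ((if Suc j = i then w k else w (Suc j)) - 1, c)))
    / det (minor_mat w k g)"
proof -
  let ?M = "minor_mat w k g" and ?a = "vec (k - 1) (\<lambda>c. g $$ (w k - 1, c))"
  have M: "?M \<in> carrier_mat (k - 1) (k - 1)" by (simp add: minor_mat_def)
  have "det ?M \<noteq> 0" using tr transversal_iff[OF w k GL_carrier[OF g] g] by simp
  moreover have Mf: "?M *\<^sub>v vec (k - 1) (\<lambda>i. f (Suc i)) = ?a"
    using f annihilates_iff[OF w k GL_carrier[OF g]] by simp
  have "det (replace_col ?M ?a (i - 1)) = f i * det ?M"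
    using cramer_lemma_mat[OF M, of "vec (k - 1) (\<lambda>i. f (Suc i))" "i - 1"] i unfolding Mf by auto
  moreover have "replace_col ?M ?a (i - 1) =
      mat (k - 1) (k - 1) (\<lambda>(c, j). g $$ ((if Suc j = i then w k else w (Suc j)) - 1, c))"
    using i by (intro eq_matI) (auto simp: replace_col_def minor_mat_def)
  ultimately show ?thesis by (simp add: field_simps)
qed

subsection \<open>The opposite big cell\<close>

text \<open>The translate by \<open>w\<close> of the opposite big cell: the chart on which all
  normalised functionals exist. It is open and contains the Schubert cell of
  \<open>w\<close>.\<close>

definition big_cell :: "nat \<Rightarrow> (nat \<Rightarrow> nat) \<Rightarrow> complex vec set list set" where
  "big_cell n w = {V \<in> Flags n. \<forall>k \<in> {1..n}. transversal n w k (V ! (k - 1))}"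

text \<open>On \<open>big_cell\<close> the values at arguments in \<open>{1..<k}\<close> are
  determined by the flag; values at other arguments are arbitrary and \<open>annihilates\<close>
  ignores them.\<close>

definition annihilator :: "(nat \<Rightarrow> nat) \<Rightarrow> complex vec set list \<Rightarrow> nat \<Rightarrow> nat \<Rightarrow> complex" where
  "annihilator w V k = (SOME f. annihilates w k (V ! (k - 1)) f)"

lemma function_sheaf_GL_variety: "function_sheaf (GL_variety n)"
  unfolding GL_variety_def by (rule function_sheaf_quasi_affine)

lemma topspace_GL_variety: "topspace (top_of (GL_variety n)) = GL n"
  by (simp add: GL_variety_def quasi_affine_def topspace_zariski_topology)

lemma regular_GL_entry:
  "r < n \<Longrightarrow> c < n \<Longrightarrow> regular (GL_variety n) (GL n) (\<lambda>g. g $$ (r, c))"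
  unfolding GL_variety_def by (rule regular_coordinate) blast

text \<open>By the definition of the quotient structure both claims live on the preimage in
  \<open>GL n\<close>. There the chart is the locus where finitely many minors do not vanish, and
  the functional is a quotient of two determinants.\<close>

lemma
  assumes w: "w permutes {1..n}"
  shows openin_big_cell: "openin (top_of (flag_variety n)) (big_cell n w)"
    and regular_annihilator: "k \<in> {1..n} \<Longrightarrow> i \<in> {1..<k} \<Longrightarrow>
      regular (flag_variety n) (big_cell n w) (\<lambda>V. annihilator w V k i)"
proof -
  interpret G: function_sheaf "GL_variety n" by (rule function_sheaf_GL_variety)
  let ?\<pi> = "\<lambda>g. flag_image g (standard_flag n)"
  let ?P = "{g \<in> GL n. ?\<pi> g \<in> big_cell n w}"
  have wn: "w j - 1 < n" if "j \<in> {1..n}" for j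
  proof -
    have "w j \<in> {1..n}" using that permutes_in_image[OF w] by blast
    then show ?thesis by auto
  qed
  have GLo: "openin (top_of (GL_variety n)) (GL n)"
    using openin_topspace[of "top_of (GL_variety n)"] by (simp add: topspace_GL_variety)
  have nth: "?\<pi> g ! (k - 1) = (*\<^sub>v) g ` coord_space n id (k - 1)" if "k \<in> {1..n}" for g k
    using that by (intro flag_image_nth) auto
  have minor: "regular (GL_variety n) (GL n) (\<lambda>g. det (minor_mat w k g))" if "k \<in> {1..n}" for k
    unfolding minor_mat_def using that
    by (intro G.regular_det[OF GLo] regular_GL_entry wn) auto
  have tr: "transversal n w k (?\<pi> g ! (k - 1)) \<longleftrightarrow> det (minor_mat w k g) \<noteq> 0"
    if "k \<in> {1..n}" "g \<in> GL n" for k g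
    unfolding nth[OF that(1)] using transversal_iff[OF w that(1) GL_carrier[OF that(2)] that(2)] .
  have P: "?P = {g \<in> GL n. \<forall>k\<in>{1..n}. det (minor_mat w k g) \<noteq> 0}"
    using flag_image_in_Flags tr unfolding big_cell_def by blast
  have "openin (top_of (GL_variety n)) {x \<in> topspace (top_of (GL_variety n)).
      \<forall>k\<in>{1..n}. det (minor_mat w k x) \<noteq> 0}"
    using minor by (intro G.openin_Collect_nonvanishing) (simp_all add: topspace_GL_variety)
  then have Po: "openin (top_of (GL_variety n)) ?P"
    unfolding P by (simp add: topspace_GL_variety)
  then show "openin (top_of (flag_variety n)) (big_cell n w)"
    unfolding flag_variety_def openin_quotient_space quotient_open_def
    by (auto simp: topspace_GL_variety big_cell_def)
  assume k: "k \<in> {1..n}" and i: "i \<in> {1..<k}"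
  let ?D = "\<lambda>g. det (mat (k - 1) (k - 1)
    (\<lambda>(c, j). g $$ ((if Suc j = i then w k else w (Suc j)) - 1, c)))"
  have "regular (GL_variety n) (GL n) ?D"
    using k by (intro G.regular_det[OF GLo] regular_GL_entry) (auto intro!: wn[simplified])
  then have "regular (GL_variety n) ?P ?D" "regular (GL_variety n) ?P (\<lambda>g. det (minor_mat w k g))"
    using minor[OF k] by (auto elim!: G.regular_restrict[OF _ GLo Po])
  then have "regular (GL_variety n) ?P (\<lambda>g. ?D g / det (minor_mat w k g))"
    by (intro G.regular_divide[OF Po]) (use P k in blast)+
  then have "regular (GL_variety n) ?P (\<lambda>g. annihilator w (?\<pi> g) k i)"
  proof (rule G.regular_cong)
    fix g assume g: "g \<in> ?P"
    then have gG: "g \<in> GL n" and tr: "transversal n w k (?\<pi> g ! (k - 1))"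
      using k by (auto simp: big_cell_def)
    have "annihilates w k (?\<pi> g ! (k - 1)) (annihilator w (?\<pi> g) k)"
      unfolding annihilator_def nth[OF k]
      by (rule someI_ex[of "annihilates w k ((*\<^sub>v) g ` coord_space n id (k - 1))"])
        (rule annihilates_exists[OF w k gG tr[unfolded nth[OF k]]])
    then show "?D g / det (minor_mat w k g) = annihilator w (?\<pi> g) k i"
      using annihilates_cramer[OF w k gG tr[unfolded nth[OF k]] _ i, symmetric]
      unfolding nth[OF k] by blast
  qed
  then show "regular (flag_variety n) (big_cell n w) (\<lambda>V. annihilator w V k i)"
    unfolding flag_variety_def quotient_space_def
    by (simp add: topspace_GL_variety comp_def)
qed

subsection \<open>Row-strict fillings\<close>

text \<open>For products of 0/1 matrices that move boxes along rows: at most one intermediate label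
  contributes, so an entry of the product is again an \<open>of_bool\<close>.\<close>

lemma sum_of_bool_unique:
  assumes "finite A" "\<And>b b'. b \<in> A \<Longrightarrow> b' \<in> A \<Longrightarrow> P b \<Longrightarrow> P b' \<Longrightarrow> b = b'"
  shows "(\<Sum>b\<in>A. of_bool (P b)) = (of_bool (\<exists>b\<in>A. P b) :: 'a :: semiring_1)"
proof (cases "\<exists>b\<in>A. P b")
  case True
  then obtain b where b: "b \<in> A" "P b" by blast
  then have "(\<Sum>b'\<in>A. of_bool (P b')) = (\<Sum>b'\<in>A. if b' = b then 1 else 0 :: 'a)"
    using assms(2) by (intro sum.cong) auto
  then show ?thesis using b assms(1) by auto
qed auto

lemma mat_eqI_mult_vec:
  fixes A B :: "'a :: comm_semiring_1 mat"
  assumes "A \<in> carrier_mat nr n" "B \<in> carrier_mat nr n"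
    and "\<And>v. v \<in> carrier_vec n \<Longrightarrow> A *\<^sub>v v = B *\<^sub>v v"
  shows "A = B"
proof (rule mat_col_eqI)
  fix c assume "c < dim_col B"
  then show "col A c = col B c"
    using assms(3)[of "unit_vec n c"] assms(1,2) by (simp add: mult_unit_vec[of _ nr])
qed (use assms in auto)

lemma
  assumes "g \<in> Borel n" "h \<in> Borel n"
  shows Borel_mult: "g * h \<in> Borel n"
    and Borel_mult_diag: "i < n \<Longrightarrow> (g * h) $$ (i, i) = g $$ (i, i) * h $$ (i, i)"
proof -
  have c: "g \<in> carrier_mat n n" "h \<in> carrier_mat n n"
    using assms by (auto simp: Borel_def intro: GL_carrier)
  have u: "g $$ (i, j) = 0" "h $$ (i, j) = 0" if "j < i" "i < n" for i j
    using assms that c by (auto simp: Borel_def upper_triangular_def)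
  have e: "(g * h) $$ (i, j) = (\<Sum>a<n. g $$ (i, a) * h $$ (a, j))" if "i < n" "j < n" for i j
    using that c by (simp add: scalar_prod_def atLeast0LessThan)
  have "(g * h) $$ (i, j) = 0" if "j < i" "i < n" for i j
  proof -
    have "g $$ (i, a) * h $$ (a, j) = 0" if "a < n" for a
      using u(1)[of a i] u(2)[of j a] that \<open>j < i\<close> \<open>i < n\<close> by (cases "a < i") auto
    then have "(\<Sum>a<n. g $$ (i, a) * h $$ (a, j)) = 0" by (intro sum.neutral) blast
    then show ?thesis using that by (simp add: e)
  qed
  then show "g * h \<in> Borel n"
    using assms c by (auto simp: Borel_def upper_triangular_def intro: GL_mult)
  show "(g * h) $$ (i, i) = g $$ (i, i) * h $$ (i, i)" if i: "i < n"
  proof -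
    have "(\<Sum>a<n. g $$ (i, a) * h $$ (a, i)) = (\<Sum>a<n. if a = i then g $$ (i, i) * h $$ (i, i) else 0)"
    proof (rule sum.cong[OF refl])
      fix a assume "a \<in> {..<n}"
      then show "g $$ (i, a) * h $$ (a, i) = (if a = i then g $$ (i, i) * h $$ (i, i) else 0)"
        using u(1)[of a i] u(2)[of i a] i by (cases a i rule: linorder_cases) auto
    qed
    then show ?thesis using i by (simp add: e)
  qed
qed

lemma finite_boxes: "finite (boxes lam)"
proof -
  have "boxes lam = Sigma {..<length lam} (\<lambda>r. {..<lam ! r})" by (auto simp: boxes_def)
  then show ?thesis by simp
qed

lemma base_filling_less:
  assumes "(r', c') \<in> boxes lam" "c < c' \<or> (c = c' \<and> r' < r)"
  shows "base_filling lam (r, c) < base_filling lam (r', c')"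
proof -
  let ?S = "\<lambda>r c. {(r', c') \<in> boxes lam. c' < c \<or> (c' = c \<and> r \<le> r')}"
  have "?S r c \<subseteq> ?S r' c'" using assms(2) by auto
  moreover have "(r', c') \<in> ?S r' c' - ?S r c" using assms by auto
  ultimately have "?S r c \<subset> ?S r' c'" by blast
  moreover have "finite (?S r' c')" by (rule finite_subset[OF _ finite_boxes[of lam]]) auto
  ultimately show ?thesis unfolding base_filling_def by (simp add: psubset_card_mono)
qed

text \<open>
  A label \<open>k\<close> stands for the basis vector \<open>e\<^sub>w\<^sub>(\<^sub>k\<^sub>)\<close>, which has index \<open>pos k\<close> in the library's
  numbering; \<open>(rw k, cl k)\<close> is the box of \<open>R(w)\<close> labelled \<open>k\<close>.
\<close>

locale row_strict_filling =
  fixes n :: nat and w :: "nat \<Rightarrow> nat" and lam :: "nat list"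
  assumes w: "w permutes {1..n}"
    and sum_lam: "sum_list lam = n"
    and row_strict: "filling lam w \<in> RS lam"
begin

definition pos :: "nat \<Rightarrow> nat" where "pos k = w k - 1"
definition rw :: "nat \<Rightarrow> nat" where "rw k = fst (inv_into (boxes lam) (filling lam w) k)"
definition cl :: "nat \<Rightarrow> nat" where "cl k = snd (inv_into (boxes lam) (filling lam w) k)"

lemma w_in: "k \<in> {1..n} \<Longrightarrow> w k \<in> {1..n}"
  using permutes_in_image[OF w] by blast

lemma Suc_pos: "k \<in> {1..n} \<Longrightarrow> Suc (pos k) = w k"
  using w_in by (force simp: pos_def)

lemma pos_less: "k \<in> {1..n} \<Longrightarrow> pos k < n"
  using w_in[of k] Suc_pos[of k] by auto

lemma pos_inj: "j \<in> {1..n} \<Longrightarrow> k \<in> {1..n} \<Longrightarrow> pos j = pos k \<longleftrightarrow> j = k"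
  using Suc_pos permutes_inj[OF w] by (metis injD)

lemma pos_surj:
  assumes "i < n"
  obtains k where "k \<in> {1..n}" "i = pos k"
proof -
  have "Suc i \<in> {1..n}" using assms by auto
  then obtain k where "k \<in> {1..n}" "w k = Suc i" using permutes_image[OF w] by (metis imageE)
  then show thesis by (intro that[of k]) (auto simp: pos_def)
qed

lemma pos_mono: "j \<in> {1..n} \<Longrightarrow> k \<in> {1..n} \<Longrightarrow> pos j < pos k \<longleftrightarrow> w j < w k"
  using Suc_pos by (metis Suc_less_eq)

lemma bij_pos: "bij_betw pos {1..n} {..<n}"
  unfolding bij_betw_def inj_on_def using pos_inj pos_less pos_surj by (auto, metis image_eqI atLeastAtMost_iff One_nat_def)

lemma sum_pos: "(\<Sum>i<n. h i) = (\<Sum>a\<in>{1..n}. h (pos a))"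
  by (rule sum.reindex_bij_betw[OF bij_pos, symmetric])

lemma vec_pos_eqI:
  assumes "u \<in> carrier_vec n" "v \<in> carrier_vec n" "\<And>a. a \<in> {1..n} \<Longrightarrow> u $ pos a = v $ pos a"
  shows "u = v"
proof (rule eq_vecI)
  fix i assume "i < dim_vec v"
  then have "i < n" using assms(2) by simp
  then show "u $ i = v $ i" using assms(3) by (metis pos_surj)
qed (use assms in auto)

lemma mult_pos:
  assumes "A \<in> carrier_mat n n" "v \<in> carrier_vec n" "a \<in> {1..n}"
  shows "(A *\<^sub>v v) $ pos a = (\<Sum>b\<in>{1..n}. A $$ (pos a, pos b) * v $ pos b)"
  unfolding mult_mat_vec_index[OF assms(1,2) pos_less[OF assms(3)]] sum_pos ..

lemma unit_vec_pos: "a \<in> {1..n} \<Longrightarrow> b \<in> {1..n} \<Longrightarrow> unit_vec n (pos b) $ pos a = of_bool (a = b)"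
  using pos_inj pos_less by auto

lemma mult_unit_vec_pos:
  fixes A :: "complex mat"
  assumes "A \<in> carrier_mat n n" "a \<in> {1..n}" "b \<in> {1..n}"
  shows "(A *\<^sub>v unit_vec n (pos b)) $ pos a = A $$ (pos a, pos b)"
  using assms pos_less by (simp add: mult_unit_vec[of _ n n])

lemma coord_space_iff:
  "v \<in> coord_space n w i \<longleftrightarrow> v \<in> carrier_vec n \<and> (\<forall>j\<in>{1..n}. i < j \<longrightarrow> v $ pos j = 0)"
  by (simp add: coord_space_def pos_def)

subsection \<open>Boxes and labels\<close>

lemma bij_filling: "bij_betw (filling lam w) (boxes lam) {1..n}"
  using row_strict sum_lam by (simp add: RS_def)

lemma box_in: "k \<in> {1..n} \<Longrightarrow> (rw k, cl k) \<in> boxes lam"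
  and filling_box: "k \<in> {1..n} \<Longrightarrow> filling lam w (rw k, cl k) = k"
  using bij_filling unfolding rw_def cl_def bij_betw_def
  by (auto simp: inv_into_into f_inv_into_f)

lemma box_inj: "j \<in> {1..n} \<Longrightarrow> k \<in> {1..n} \<Longrightarrow> rw j = rw k \<Longrightarrow> cl j = cl k \<Longrightarrow> j = k"
  using filling_box by metis

lemma filling_in: "b \<in> boxes lam \<Longrightarrow> filling lam w b \<in> {1..n}"
  using bij_filling by (auto simp: bij_betw_def)

lemma box_filling:
  assumes "(r, c) \<in> boxes lam"
  shows "rw (filling lam w (r, c)) = r" "cl (filling lam w (r, c)) = c"
  using assms bij_filling unfolding rw_def cl_def bij_betw_def by auto

lemma base_filling_box: "k \<in> {1..n} \<Longrightarrow> base_filling lam (rw k, cl k) = w k"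
  using filling_box[of k] surj_f_inv_f[OF permutes_surj[OF w]]
  unfolding filling_def by metis

lemma base_filling_eq:
  assumes "(r, c) \<in> boxes lam" "k \<in> {1..n}"
  shows "base_filling lam (r, c) = w k \<longleftrightarrow> r = rw k \<and> c = cl k"
proof
  assume "base_filling lam (r, c) = w k"
  then have "filling lam w (r, c) = k"
    using inv_f_f[OF permutes_inj[OF w]] by (simp add: filling_def)
  then show "r = rw k \<and> c = cl k" using box_filling[OF assms(1)] by simp
next
  assume "r = rw k \<and> c = cl k"
  then show "base_filling lam (r, c) = w k" using base_filling_box[OF assms(2)] by blast
qed

text \<open>The reading order of boxes is total and \<open>base_filling\<close> increases along it.
  This turns the positional condition on a Springer inversion into the inequality
  \<open>w k < w l\<close>.\<close>

lemma w_less_iff: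
  assumes "j \<in> {1..n}" "k \<in> {1..n}"
  shows "w j < w k \<longleftrightarrow> cl j < cl k \<or> (cl j = cl k \<and> rw k < rw j)"
proof -
  have *: "w j < w k" if "j \<in> {1..n}" "k \<in> {1..n}" "cl j < cl k \<or> (cl j = cl k \<and> rw k < rw j)" for j k
    using base_filling_less[OF box_in[OF that(2)] that(3)] base_filling_box that by simp
  show ?thesis
    using *[OF assms] *[OF assms(2,1)] box_inj[OF assms] by (metis less_asym linorder_neqE_nat)
qed

lemma label_strict:
  assumes "j \<in> {1..n}" "k \<in> {1..n}" "rw j = rw k" "cl j < cl k"
  shows "j < k"
proof -
  have "filling lam w (r, c) < filling lam w (r, c')"
    if "(r, c) \<in> boxes lam" "(r, c') \<in> boxes lam" "c < c'" for r c c'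
    using row_strict that unfolding RS_def by blast
  from this[of "rw j" "cl j" "cl k"] show ?thesis
    using box_in[OF assms(1)] box_in[OF assms(2)] filling_box[OF assms(1)] filling_box[OF assms(2)] assms
    by simp
qed

lemma label_le:
  assumes "j \<in> {1..n}" "k \<in> {1..n}" "rw j = rw k" "cl j \<le> cl k"
  shows "j \<le> k"
  using label_strict[OF assms(1-3)] box_inj[OF assms(1-3)] assms(4) by (cases "cl j = cl k") auto

lemma left_label:
  assumes "k \<in> {1..n}" "c \<le> cl k"
  obtains j where "j \<in> {1..n}" "rw j = rw k" "cl j = c"
proof -
  have "(rw k, c) \<in> boxes lam" using box_in[OF assms(1)] assms(2) by (auto simp: boxes_def)
  then show thesis using that[of "filling lam w (rw k, c)"] filling_in box_filling by simp
qed

subsection \<open>The nilpotent matrix\<close>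

abbreviation X :: "complex mat" where "X \<equiv> X_mat lam"

lemma X_carrier: "X \<in> carrier_mat n n"
  by (simp add: X_mat_def sum_lam)

lemma X_entry:
  assumes a: "a \<in> {1..n}" and b: "b \<in> {1..n}"
  shows "X $$ (pos a, pos b) = of_bool (rw a = rw b \<and> cl b = cl a + 1)"
proof -
  have "(\<exists>r c. (r, c) \<in> boxes lam \<and> (r, c + 1) \<in> boxes lam \<and>
      base_filling lam (r, c) = w a \<and> base_filling lam (r, c + 1) = w b) \<longleftrightarrow>
      rw a = rw b \<and> cl b = cl a + 1"
  proof
    assume "\<exists>r c. (r, c) \<in> boxes lam \<and> (r, c + 1) \<in> boxes lam \<and>
      base_filling lam (r, c) = w a \<and> base_filling lam (r, c + 1) = w b"
    then show "rw a = rw b \<and> cl b = cl a + 1"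
      using base_filling_eq[OF _ a] base_filling_eq[OF _ b] by fastforce
  next
    assume *: "rw a = rw b \<and> cl b = cl a + 1"
    then show "\<exists>r c. (r, c) \<in> boxes lam \<and> (r, c + 1) \<in> boxes lam \<and>
      base_filling lam (r, c) = w a \<and> base_filling lam (r, c + 1) = w b"
      using base_filling_box[OF a] base_filling_box[OF b] box_in[OF a] box_in[OF b]
      by (intro exI[of _ "rw a"] exI[of _ "cl a"]) simp
  qed
  then show ?thesis
    using pos_less[OF a] pos_less[OF b] Suc_pos[OF a] Suc_pos[OF b]
    by (simp add: X_mat_def sum_lam)
qed

lemma X_pow_carrier: "X ^\<^sub>m m \<in> carrier_mat n n"
  by (rule pow_carrier_mat[OF X_carrier])

lemma X_pow_entry:
  assumes a: "a \<in> {1..n}" and b: "b \<in> {1..n}"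
  shows "(X ^\<^sub>m m) $$ (pos a, pos b) = of_bool (rw a = rw b \<and> cl a + m = cl b)"
  using a b
proof (induction m arbitrary: b)
  case 0
  then have "rw a = rw b \<and> cl a = cl b \<longleftrightarrow> a = b" using box_inj[of a b] by blast
  then show ?case
    using X_carrier pos_less[OF 0(1)] pos_less[OF 0(2)] pos_inj[OF 0] by simp
next
  case (Suc m)
  have "(X ^\<^sub>m Suc m) $$ (pos a, pos b) = (X ^\<^sub>m m *\<^sub>v (X *\<^sub>v unit_vec n (pos b))) $ pos a"
    using mult_unit_vec_pos[OF X_pow_carrier[of "Suc m"] Suc.prems]
      assoc_mult_mat_vec[OF X_pow_carrier X_carrier, of "unit_vec n (pos b)" m] by simp
  also have "\<dots> = (\<Sum>c\<in>{1..n}. (X ^\<^sub>m m) $$ (pos a, pos c) * (X *\<^sub>v unit_vec n (pos b)) $ pos c)"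
    by (rule mult_pos[OF X_pow_carrier mult_mat_vec_carrier[OF X_carrier] Suc.prems(1)]) simp
  also have "\<dots> = (\<Sum>c\<in>{1..n}. of_bool ((rw a = rw c \<and> cl a + m = cl c) \<and> rw c = rw b \<and> cl b = cl c + 1))"
    using Suc.prems
    by (intro sum.cong) (simp_all only: Suc.IH mult_unit_vec_pos[OF X_carrier] X_entry of_bool_conj)
  also have "\<dots> = of_bool (\<exists>c\<in>{1..n}. (rw a = rw c \<and> cl a + m = cl c) \<and> rw c = rw b \<and> cl b = cl c + 1)"
  proof (rule sum_of_bool_unique)
    fix c c' assume c: "c \<in> {1..n}" "c' \<in> {1..n}"
      and "(rw a = rw c \<and> cl a + m = cl c) \<and> rw c = rw b \<and> cl b = cl c + 1"
        "(rw a = rw c' \<and> cl a + m = cl c') \<and> rw c' = rw b \<and> cl b = cl c' + 1"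
    then have "rw c = rw c'" "cl c = cl c'" by linarith+
    then show "c = c'" by (rule box_inj[OF c])
  qed simp
  also have "(\<exists>c\<in>{1..n}. (rw a = rw c \<and> cl a + m = cl c) \<and> rw c = rw b \<and> cl b = cl c + 1) \<longleftrightarrow>
      rw a = rw b \<and> cl a + Suc m = cl b"
  proof
    assume *: "rw a = rw b \<and> cl a + Suc m = cl b"
    then have "cl a + m \<le> cl b" by simp
    then obtain c where c: "c \<in> {1..n}" "rw c = rw b" "cl c = cl a + m"
      by (rule left_label[OF Suc.prems(2)])
    show "\<exists>c\<in>{1..n}. (rw a = rw c \<and> cl a + m = cl c) \<and> rw c = rw b \<and> cl b = cl c + 1"
      by (rule bexI[OF _ c(1)]) (use * c(2,3) in simp)
  qed auto
  finally show ?case .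
qed

text \<open>\<open>X\<close> sends the basis vector of a box to that of its left neighbour, whose
  label is smaller by row-strictness. So the permutation flag itself lies in the Springer
  fiber.\<close>

lemma X_coord_space:
  assumes v: "v \<in> coord_space n w i" and i: "i \<ge> 1"
  shows "X *\<^sub>v v \<in> coord_space n w (i - 1)"
proof -
  have vc: "v \<in> carrier_vec n" using v by (rule coord_space_carrier)
  have "(X *\<^sub>v v) $ pos a = 0" if a: "a \<in> {1..n}" "i - 1 < a" for a
    unfolding mult_pos[OF X_carrier vc a(1)]
  proof (rule sum.neutral, rule ballI)
    fix b assume b: "b \<in> {1..n}"
    show "X $$ (pos a, pos b) * v $ pos b = 0"
    proof (cases "rw a = rw b \<and> cl b = cl a + 1")
      case True
      then have "a < b" using label_strict[OF a(1) b] by simp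
      then show ?thesis using v b a(2) by (simp add: coord_space_iff)
    qed (simp only: X_entry[OF a(1) b], simp)
  qed
  then show ?thesis
    using mult_mat_vec_carrier[OF X_carrier vc] by (simp add: coord_space_iff)
qed

subsection \<open>Springer inversions\<close>

definition invs :: "nat \<Rightarrow> nat set" where "invs k = {l. (k, l) \<in> springer_inv lam w}"

lemma springer_inv_iff:
  "(k, l) \<in> springer_inv lam w \<longleftrightarrow> k \<in> {1..n} \<and> l \<in> {1..n} \<and> l < k \<and> w k < w l \<and>
    (\<forall>r\<in>{1..n}. rw r = rw l \<longrightarrow> cl r = cl l + 1 \<longrightarrow> k < r)"
proof
  assume "(k, l) \<in> springer_inv lam w"
  then obtain r c r' c' where *: "l < k" "(r, c) \<in> boxes lam" "filling lam w (r, c) = k"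
    "(r', c') \<in> boxes lam" "filling lam w (r', c') = l" "(c = c' \<and> r > r') \<or> c < c'"
    "(r', c' + 1) \<in> boxes lam \<longrightarrow> k \<le> filling lam w (r', c' + 1) - 1"
    unfolding springer_inv_def by blast
  have kl: "k \<in> {1..n}" "l \<in> {1..n}" using * filling_in by auto
  have box: "rw k = r" "cl k = c" "rw l = r'" "cl l = c'" using box_filling * by auto
  \<comment> \<open>Truncated subtraction is harmless in the defining condition because
    \<open>k\<close> is at least 1.\<close>
  have "k < s" if "s \<in> {1..n}" "rw s = rw l" "cl s = cl l + 1" for s
    using *(7) box_in[OF that(1)] filling_box[OF that(1)] that kl(1) box by force
  then show "k \<in> {1..n} \<and> l \<in> {1..n} \<and> l < k \<and> w k < w l \<and>
    (\<forall>r\<in>{1..n}. rw r = rw l \<longrightarrow> cl r = cl l + 1 \<longrightarrow> k < r)"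
    using * kl box w_less_iff[OF kl] by auto
next
  assume *: "k \<in> {1..n} \<and> l \<in> {1..n} \<and> l < k \<and> w k < w l \<and>
    (\<forall>r\<in>{1..n}. rw r = rw l \<longrightarrow> cl r = cl l + 1 \<longrightarrow> k < r)"
  then have kl: "k \<in> {1..n}" "l \<in> {1..n}" by auto
  have "k \<le> filling lam w (rw l, cl l + 1) - 1" if "(rw l, cl l + 1) \<in> boxes lam"
    using * filling_in[OF that] box_filling[OF that] by fastforce
  then show "(k, l) \<in> springer_inv lam w"
    unfolding springer_inv_def using * w_less_iff[OF kl] box_in[OF kl(1)] box_in[OF kl(2)]
      filling_box[OF kl(1)] filling_box[OF kl(2)] by blast
qed

lemma finite_springer_inv: "finite (springer_inv lam w)"
  by (rule finite_subset[of _ "{1..n} \<times> {1..n}"]) (auto simp: springer_inv_iff)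

lemma finite_invs: "finite (invs k)"
  by (rule finite_subset[of _ "{1..n}"]) (auto simp: invs_def springer_inv_iff)

lemma invs_iff:
  "l \<in> invs k \<longleftrightarrow> k \<in> {1..n} \<and> l \<in> {1..n} \<and> l < k \<and> w k < w l \<and>
    (\<forall>r\<in>{1..n}. rw r = rw l \<longrightarrow> cl r = cl l + 1 \<longrightarrow> k < r)"
  by (simp only: invs_def mem_Collect_eq springer_inv_iff)

lemma invsD:
  assumes "l \<in> invs k"
  shows "k \<in> {1..n}" "l \<in> {1..n}" "l < k" "w k < w l" "cl k \<le> cl l"
    "r \<in> {1..n} \<Longrightarrow> rw r = rw l \<Longrightarrow> cl r = cl l + 1 \<Longrightarrow> k < r"
  using assms w_less_iff unfolding invs_iff by auto

text \<open>Since \<open>cl k \<le> cl l\<close>, a common row would force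
  \<open>k \<le> l\<close>.\<close>

lemma invs_row:
  assumes "l \<in> invs k"
  shows "rw l \<noteq> rw k"
  using label_le[of k l] invsD[OF assms] by auto

text \<open>If \<open>l\<close> stood to the left of \<open>l'\<close> in one row, the right
  neighbour \<open>r\<close> of \<open>l\<close> would satisfy k < r and r \<le> l', against l' < k.
  Hence the prescriptions defining \<open>B_sub\<close> for different inversions never concern the
  same basis vector.\<close>

lemma invs_row_inj:
  assumes "l \<in> invs k" "l' \<in> invs k" "rw l = rw l'"
  shows "l = l'"
proof -
  have *: False if l: "l \<in> invs k" "l' \<in> invs k" "rw l = rw l'" "cl l < cl l'" for l l'
  proof -
    have "cl l + 1 \<le> cl l'" using l(4) by simp
    then obtain r where r: "r \<in> {1..n}" "rw r = rw l'" "cl r = cl l + 1"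
      by (rule left_label[OF invsD(2)[OF l(2)]])
    then have "k < r" "r \<le> l'"
      using invsD(6)[OF l(1) r(1)] label_le[OF r(1) invsD(2)[OF l(2)]] l by auto
    then show False using invsD(3)[OF l(2)] by simp
  qed
  show ?thesis
    using *[OF assms] *[OF assms(2,1)] assms box_inj[OF invsD(2)[OF assms(1)] invsD(2)[OF assms(2)]]
    by (metis linorder_neqE_nat)
qed

subsection \<open>The subgroups\<close>

text \<open>
  \<open>shift k l\<close> is the relation of the matrix sending \<open>X\<^sup>m e\<^sub>w\<^sub>(\<^sub>l\<^sub>)\<close> to \<open>X\<^sup>m e\<^sub>w\<^sub>(\<^sub>k\<^sub>)\<close> for all \<open>m\<close> and
  killing the remaining basis vectors.
\<close>

definition shift :: "nat \<Rightarrow> nat \<Rightarrow> nat \<Rightarrow> nat \<Rightarrow> bool" where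
  "shift k l a b \<longleftrightarrow> rw a = rw k \<and> rw b = rw l \<and> cl a + cl l = cl b + cl k \<and> cl b \<le> cl l"

text \<open>The general element of \<open>B_sub lam w k\<close> in closed form, with the scalars
  indexed by \<open>l\<close> alone. The inverse of \<open>w\<close> turns the matrix indices back
  into labels.\<close>

definition G :: "nat \<Rightarrow> (nat \<Rightarrow> complex) \<Rightarrow> complex mat" where
  "G k y = mat n n (\<lambda>(i, j). of_bool (i = j) +
     (\<Sum>l\<in>invs k. y l * of_bool (shift k l (inv_into UNIV w (Suc i)) (inv_into UNIV w (Suc j)))))"

lemma G_carrier: "G k y \<in> carrier_mat n n"
  by (simp add: G_def)

lemma G_entry:
  assumes "a \<in> {1..n}" "b \<in> {1..n}"
  shows "G k y $$ (pos a, pos b) = of_bool (a = b) + (\<Sum>l\<in>invs k. y l * of_bool (shift k l a b))"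
  using assms pos_less pos_inj by (simp add: G_def Suc_pos permutes_inverses(2)[OF w])

lemma G_mult:
  assumes v: "v \<in> carrier_vec n" and a: "a \<in> {1..n}"
  shows "(G k y *\<^sub>v v) $ pos a =
    v $ pos a + (\<Sum>l\<in>invs k. y l * (\<Sum>b\<in>{1..n}. of_bool (shift k l a b) * v $ pos b))"
proof -
  have "(G k y *\<^sub>v v) $ pos a = (\<Sum>b\<in>{1..n}. of_bool (a = b) * v $ pos b +
      (\<Sum>l\<in>invs k. y l * of_bool (shift k l a b)) * v $ pos b)"
    unfolding mult_pos[OF G_carrier v a]
    by (intro sum.cong refl) (simp only: G_entry[OF a] distrib_right)
  also have "\<dots> = (\<Sum>b\<in>{1..n}. of_bool (a = b) * v $ pos b) +
      (\<Sum>b\<in>{1..n}. (\<Sum>l\<in>invs k. y l * of_bool (shift k l a b)) * v $ pos b)"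
    by (rule sum.distrib)
  also have "(\<Sum>b\<in>{1..n}. of_bool (a = b) * v $ pos b) = (\<Sum>b\<in>{1..n}. if b = a then v $ pos a else 0)"
    by (intro sum.cong) auto
  also have "\<dots> = v $ pos a" using a by simp
  also have "(\<Sum>b\<in>{1..n}. (\<Sum>l\<in>invs k. y l * of_bool (shift k l a b)) * v $ pos b) =
      (\<Sum>l\<in>invs k. y l * (\<Sum>b\<in>{1..n}. of_bool (shift k l a b) * v $ pos b))"
    unfolding sum_distrib_left sum_distrib_right by (subst sum.swap) (simp add: mult.assoc)
  finally show ?thesis .
qed

lemma G_cong: "(\<And>l. l \<in> invs k \<Longrightarrow> y l = y' l) \<Longrightarrow> G k y = G k y'"
  unfolding G_def by (intro arg_cong[of _ _ "mat n n"] ext) auto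

text \<open>The boxes of \<open>k\<close> and \<open>l\<close> are moved left by the same number of
  columns, which preserves their reading order. This makes \<open>G k y\<close>
  unitriangular.\<close>

lemma shift_less:
  assumes "l \<in> invs k" "a \<in> {1..n}" "b \<in> {1..n}" "shift k l a b"
  shows "w a < w b"
  using assms invsD[OF assms(1)] w_less_iff[of k l] w_less_iff[of a b] unfolding shift_def by auto

text \<open>The box of \<open>a\<close> lies in the row of \<open>k\<close>, weakly to its left, and
  rows increase.\<close>

lemma shift_le:
  assumes "l \<in> invs k" "a \<in> {1..n}" "shift k l a b"
  shows "a \<le> k"
  using assms invsD[OF assms(1)] label_le[of a k] unfolding shift_def by auto

text \<open>\<open>G k y\<close> minus the identity maps into the span of the row of
  \<open>k\<close> and, by \<open>invs_row\<close>, kills that span. Products of two such nilpotent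
  parts vanish, so inversion only changes the sign of \<open>y\<close>.\<close>

lemma G_inverse: "G k y * G k (\<lambda>l. - y l) = 1\<^sub>m n"
proof (rule mat_eqI_mult_vec[of _ n n])
  fix v :: "complex vec" assume v: "v \<in> carrier_vec n"
  let ?u = "G k (\<lambda>l. - y l) *\<^sub>v v"
  let ?S = "\<lambda>l a v. \<Sum>b\<in>{1..n}. of_bool (shift k l a b) * v $ pos b"
  have u: "?u \<in> carrier_vec n" by (rule mult_mat_vec_carrier[OF G_carrier v])
  have uv: "?u $ pos b = v $ pos b" if "b \<in> {1..n}" "rw b \<noteq> rw k" for b
    using that by (simp add: G_mult[OF v] shift_def)
  have S: "?S l a ?u = ?S l a v" if "l \<in> invs k" for l a
    using uv invs_row[OF that] by (intro sum.cong) (auto simp: shift_def)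
  have "G k y *\<^sub>v ?u = v"
  proof (rule vec_pos_eqI)
    fix a assume a: "a \<in> {1..n}"
    have "(G k y *\<^sub>v ?u) $ pos a = ?u $ pos a + (\<Sum>l\<in>invs k. y l * ?S l a v)"
      unfolding G_mult[OF u a] by (intro arg_cong2[where f = "(+)"] sum.cong refl) (simp only: S)
    also have "?u $ pos a = v $ pos a - (\<Sum>l\<in>invs k. y l * ?S l a v)"
      unfolding G_mult[OF v a] by (simp add: sum_negf)
    finally show "(G k y *\<^sub>v ?u) $ pos a = v $ pos a" by simp
  qed (use v u in \<open>auto intro: mult_mat_vec_carrier[OF G_carrier]\<close>)
  then show "G k y * G k (\<lambda>l. - y l) *\<^sub>v v = 1\<^sub>m n *\<^sub>v v"
    using assoc_mult_mat_vec[OF G_carrier G_carrier v] v by simp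
qed (auto intro: mult_carrier_mat[OF G_carrier G_carrier])

lemma G_GL: "G k y \<in> GL n"
  by (rule GL_I[OF G_carrier G_carrier G_inverse])

definition unitri :: "complex mat \<Rightarrow> bool" where
  "unitri g \<longleftrightarrow> g \<in> Borel n \<and> (\<forall>i<n. g $$ (i, i) = 1)"

lemma unitri_mult: "unitri g \<Longrightarrow> unitri h \<Longrightarrow> unitri (g * h)"
  by (auto simp: unitri_def Borel_mult Borel_mult_diag)

lemma unitri_one: "unitri (1\<^sub>m n)"
  by (auto simp: unitri_def Borel_def upper_triangular_def GL_iff)

lemma G_unitri: "unitri (G k y)"
proof -
  have e: "G k y $$ (pos a, pos b) = of_bool (a = b)"
    if "a \<in> {1..n}" "b \<in> {1..n}" "pos b \<le> pos a" for a b
  proof -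
    have "w b \<le> w a" using that pos_mono[of a b] by auto
    then show ?thesis
      unfolding G_entry[OF that(1,2)] using shift_less[OF _ that(1,2), of _ k]
      by (auto intro!: sum.neutral)
  qed
  have "G k y $$ (i, j) = of_bool (i = j)" if ij: "i < n" "j \<le> i" for i j
  proof -
    obtain a where a: "a \<in> {1..n}" "i = pos a" using pos_surj[OF ij(1)] .
    obtain b where b: "b \<in> {1..n}" "j = pos b" using pos_surj[OF le_less_trans[OF ij(2,1)]] .
    show ?thesis using e[OF a(1) b(1)] ij(2) pos_inj[OF a(1) b(1)] by (simp add: a(2) b(2))
  qed
  then show ?thesis
    using G_GL G_carrier[of k y] by (auto simp: unitri_def Borel_def upper_triangular_def)
qed

lemma G_coord_space:
  assumes "k \<le> i"
  shows "(*\<^sub>v) (G k y) ` coord_space n w i = coord_space n w i"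
proof (rule Borel_coord_space[OF _ _ w])
  show "G k y \<in> Borel n" using G_unitri[of k y] by (simp add: unitri_def)
  show "(*\<^sub>v) (G k y) ` coord_space n w i \<subseteq> coord_space n w i"
  proof
    fix u assume "u \<in> (*\<^sub>v) (G k y) ` coord_space n w i"
    then obtain v where v: "v \<in> coord_space n w i" "u = G k y *\<^sub>v v" by blast
    have vc: "v \<in> carrier_vec n" using v(1) by (rule coord_space_carrier)
    have "u $ pos a = 0" if a: "a \<in> {1..n}" "i < a" for a
    proof -
      have "\<not> shift k l a b" if "l \<in> invs k" for l b
        using shift_le[OF that a(1)] a(2) assms by fastforce
      then have "u $ pos a = v $ pos a" unfolding v(2) G_mult[OF vc a(1)] by simp
      then show ?thesis using v(1) a by (simp add: coord_space_iff)
    qed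
    then show "u \<in> coord_space n w i"
      unfolding coord_space_iff v(2) using mult_mat_vec_carrier[OF G_carrier vc] by blast
  qed
qed

text \<open>This is where the second condition on a Springer inversion is needed.\<close>

lemma X_G_commute:
  assumes k: "k \<in> {1..n}" and v: "v \<in> coord_space n w k"
  shows "X *\<^sub>v (G k y *\<^sub>v v) = G k y *\<^sub>v (X *\<^sub>v v)"
proof (rule vec_pos_eqI)
  have vc: "v \<in> carrier_vec n" using v by (rule coord_space_carrier)
  have Gv: "G k y *\<^sub>v v \<in> carrier_vec n" by (rule mult_mat_vec_carrier[OF G_carrier vc])
  have Xv: "X *\<^sub>v v \<in> carrier_vec n" by (rule mult_mat_vec_carrier[OF X_carrier vc])
  show "X *\<^sub>v (G k y *\<^sub>v v) \<in> carrier_vec n" by (rule mult_mat_vec_carrier[OF X_carrier Gv])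
  show "G k y *\<^sub>v (X *\<^sub>v v) \<in> carrier_vec n" by (rule mult_mat_vec_carrier[OF G_carrier Xv])
  fix a assume a: "a \<in> {1..n}"
  let ?R = "\<lambda>a b. rw a = rw b \<and> cl b = cl a + 1"
  let ?r = "\<lambda>a b. of_bool (?R a b) :: complex"
  let ?s = "\<lambda>l a b. of_bool (shift k l a b) :: complex"
  let ?I = "{1..n}"
  have Xm: "(X *\<^sub>v u) $ pos a = (\<Sum>b\<in>?I. ?r a b * u $ pos b)"
    if "u \<in> carrier_vec n" "a \<in> ?I" for u a
    unfolding mult_pos[OF X_carrier that] using that(2)
    by (intro sum.cong refl) (simp only: X_entry)
  \<comment> \<open>By linearity it suffices that each single shift commutes with \<open>X\<close>
    on vectors supported on labels up to \<open>k\<close>. In the comparison below, both composites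
    lead from the box of \<open>c\<close> to the box of \<open>a\<close>, through different
    intermediate boxes.\<close>
  have main: "(\<Sum>b\<in>?I. ?r a b * (\<Sum>c\<in>?I. ?s l b c * v $ pos c)) =
      (\<Sum>b\<in>?I. ?s l a b * (\<Sum>c\<in>?I. ?r b c * v $ pos c))" if l: "l \<in> invs k" for l
  proof -
    have "(\<Sum>b\<in>?I. ?r a b * (\<Sum>c\<in>?I. ?s l b c * v $ pos c)) =
        (\<Sum>c\<in>?I. (\<Sum>b\<in>?I. of_bool (?R a b \<and> shift k l b c)) * v $ pos c)"
      unfolding sum_distrib_left sum_distrib_right
      by (subst sum.swap) (simp only: of_bool_conj mult.assoc)
    also have "\<dots> = (\<Sum>c\<in>?I. (\<Sum>b\<in>?I. of_bool (shift k l a b \<and> ?R b c)) * v $ pos c)"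
    proof (rule sum.cong[OF refl])
      fix c assume c: "c \<in> ?I"
      have "(\<Sum>b\<in>?I. of_bool (?R a b \<and> shift k l b c)) = (of_bool (\<exists>b\<in>?I. ?R a b \<and> shift k l b c) :: complex)"
        by (rule sum_of_bool_unique, simp, rule box_inj) (auto simp: shift_def)
      moreover have "(\<Sum>b\<in>?I. of_bool (shift k l a b \<and> ?R b c)) = (of_bool (\<exists>b\<in>?I. shift k l a b \<and> ?R b c) :: complex)"
        by (rule sum_of_bool_unique, simp, rule box_inj) (auto simp: shift_def)
      moreover have "(\<exists>b\<in>?I. ?R a b \<and> shift k l b c) \<longleftrightarrow> (\<exists>b\<in>?I. shift k l a b \<and> ?R b c)" if "c \<le> k"
      proof
        assume "\<exists>b\<in>?I. ?R a b \<and> shift k l b c"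
        then have *: "rw a = rw k" "rw c = rw l" "cl a + 1 + cl l = cl c + cl k" "cl c \<le> cl l"
          by (auto simp: shift_def)
        then have "cl c \<ge> 1" using invsD(5)[OF l] by simp
        moreover obtain b where "b \<in> ?I" "rw b = rw c" "cl b = cl c - 1"
          using left_label[OF c, of "cl c - 1"] by auto
        ultimately show "\<exists>b\<in>?I. shift k l a b \<and> ?R b c"
          using * by (intro bexI[of _ b]) (auto simp: shift_def)
      next
        assume "\<exists>b\<in>?I. shift k l a b \<and> ?R b c"
        then have *: "rw a = rw k" "rw c = rw l" "cl a + cl l + 1 = cl c + cl k" "cl c \<le> cl l + 1"
          by (auto simp: shift_def)
        \<comment> \<open>The only obstruction: if \<open>c\<close> were the right neighbour of
          \<open>l\<close>, then \<open>X\<close> would move it into the domain of the shift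
          although the shift kills it. The inversion condition gives k < c in that case.\<close>
        have "cl c \<noteq> cl l + 1" using invsD(6)[OF l c] * \<open>c \<le> k\<close> by auto
        with * have "cl c \<le> cl l" "cl a + 1 \<le> cl k" by auto
        then obtain b where "b \<in> ?I" "rw b = rw k" "cl b = cl a + 1"
          using left_label[OF k, of "cl a + 1"] by auto
        then show "\<exists>b\<in>?I. ?R a b \<and> shift k l b c"
          using * \<open>cl c \<le> cl l\<close> by (intro bexI[of _ b]) (auto simp: shift_def)
      qed
      moreover have "v $ pos c = 0" if "\<not> c \<le> k" using v c that by (simp add: coord_space_iff)
      ultimately show "(\<Sum>b\<in>?I. of_bool (?R a b \<and> shift k l b c)) * v $ pos c =
          (\<Sum>b\<in>?I. of_bool (shift k l a b \<and> ?R b c)) * v $ pos c" by (cases "c \<le> k") simp_all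
    qed
    also have "\<dots> = (\<Sum>b\<in>?I. ?s l a b * (\<Sum>c\<in>?I. ?r b c * v $ pos c))"
      unfolding sum_distrib_left sum_distrib_right
      by (subst sum.swap) (simp only: of_bool_conj mult.assoc)
    finally show ?thesis .
  qed
  have "(X *\<^sub>v (G k y *\<^sub>v v)) $ pos a =
      (\<Sum>b\<in>?I. ?r a b * v $ pos b + (\<Sum>l\<in>invs k. y l * (?r a b * (\<Sum>c\<in>?I. ?s l b c * v $ pos c))))"
    unfolding Xm[OF Gv a]
    by (intro sum.cong refl) (simp add: G_mult[OF vc] distrib_left sum_distrib_left mult.left_commute)
  also have "\<dots> = (\<Sum>b\<in>?I. ?r a b * v $ pos b) +
      (\<Sum>l\<in>invs k. y l * (\<Sum>b\<in>?I. ?r a b * (\<Sum>c\<in>?I. ?s l b c * v $ pos c)))"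
    unfolding sum.distrib by (subst sum.swap) (simp only: sum_distrib_left)
  also have "\<dots> = (\<Sum>b\<in>?I. ?r a b * v $ pos b) +
      (\<Sum>l\<in>invs k. y l * (\<Sum>b\<in>?I. ?s l a b * (\<Sum>c\<in>?I. ?r b c * v $ pos c)))"
    by (intro arg_cong2[where f = "(+)"] sum.cong refl) (simp only: main)
  also have "\<dots> = (G k y *\<^sub>v (X *\<^sub>v v)) $ pos a"
    unfolding G_mult[OF Xv a] Xm[OF vc a]
    by (intro arg_cong2[where f = "(+)"] sum.cong refl arg_cong2[where f = "(*)"])
      (simp_all only: Xm[OF vc])
  finally show "(X *\<^sub>v (G k y *\<^sub>v v)) $ pos a = (G k y *\<^sub>v (X *\<^sub>v v)) $ pos a" .
qed

lemma X_pow_unit: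
  assumes "j \<in> {1..n}" "l \<in> {1..n}"
  shows "unit_vec n (pos j) = (X ^\<^sub>m m) *\<^sub>v unit_vec n (pos l) \<longleftrightarrow> rw j = rw l \<and> cl j + m = cl l"
proof -
  have X: "((X ^\<^sub>m m) *\<^sub>v unit_vec n (pos l)) $ pos a = of_bool (rw a = rw l \<and> cl a + m = cl l)"
    if "a \<in> {1..n}" for a
    using mult_unit_vec_pos[OF X_pow_carrier that assms(2)] X_pow_entry[OF that assms(2)] by simp
  show ?thesis
  proof
    assume "unit_vec n (pos j) = (X ^\<^sub>m m) *\<^sub>v unit_vec n (pos l)"
    then have "unit_vec n (pos j) $ pos j = ((X ^\<^sub>m m) *\<^sub>v unit_vec n (pos l)) $ pos j" by simp
    then show "rw j = rw l \<and> cl j + m = cl l"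
      unfolding X[OF assms(1)] unit_vec_pos[OF assms(1,1)] by (auto split: if_splits)
  next
    assume *: "rw j = rw l \<and> cl j + m = cl l"
    show "unit_vec n (pos j) = (X ^\<^sub>m m) *\<^sub>v unit_vec n (pos l)"
    proof (rule vec_pos_eqI)
      fix a assume a: "a \<in> {1..n}"
      have "a = j \<longleftrightarrow> rw a = rw l \<and> cl a + m = cl l" using * box_inj[OF a assms(1)] by auto
      then show "unit_vec n (pos j) $ pos a = ((X ^\<^sub>m m) *\<^sub>v unit_vec n (pos l)) $ pos a"
        by (simp only: X[OF a] unit_vec_pos[OF a assms(1)])
    qed (auto intro: mult_mat_vec_carrier[OF X_pow_carrier])
  qed
qed

lemma G_unit_inv:
  assumes l: "l \<in> invs k" and j: "j \<in> {1..n}" and jl: "rw j = rw l" "cl j + m = cl l"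
  shows "G k y *\<^sub>v unit_vec n (pos j) =
    unit_vec n (pos j) + y l \<cdot>\<^sub>v ((X ^\<^sub>m m) *\<^sub>v unit_vec n (pos k))"
proof (rule vec_pos_eqI)
  have k: "k \<in> {1..n}" using invsD[OF l] by simp
  have Xc: "(X ^\<^sub>m m) *\<^sub>v unit_vec n (pos k) \<in> carrier_vec n"
    by (rule mult_mat_vec_carrier[OF X_pow_carrier]) simp
  then show "unit_vec n (pos j) + y l \<cdot>\<^sub>v ((X ^\<^sub>m m) *\<^sub>v unit_vec n (pos k)) \<in> carrier_vec n" by simp
  show "G k y *\<^sub>v unit_vec n (pos j) \<in> carrier_vec n"
    by (rule mult_mat_vec_carrier[OF G_carrier]) simp
  fix a assume a: "a \<in> {1..n}"
  \<comment> \<open>Inversions with first entry \<open>k\<close> occupy distinct rows, so only the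
    one in the row of \<open>j\<close> contributes.\<close>
  have "(\<Sum>l'\<in>invs k. y l' * of_bool (shift k l' a j)) =
      (\<Sum>l'\<in>invs k. if l' = l then y l * of_bool (rw a = rw k \<and> cl a + m = cl k) else 0)"
  proof (rule sum.cong[OF refl])
    fix l' assume "l' \<in> invs k"
    then show "y l' * of_bool (shift k l' a j) =
        (if l' = l then y l * of_bool (rw a = rw k \<and> cl a + m = cl k) else 0)"
      using invs_row_inj[OF _ l, of l'] jl by (auto simp: shift_def)
  qed
  also have "\<dots> = y l * of_bool (rw a = rw k \<and> cl a + m = cl k)"
    using l finite_invs by simp
  finally have S: "(\<Sum>l'\<in>invs k. y l' * of_bool (shift k l' a j)) =
      y l * of_bool (rw a = rw k \<and> cl a + m = cl k)" .
  show "(G k y *\<^sub>v unit_vec n (pos j)) $ pos a =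
      (unit_vec n (pos j) + y l \<cdot>\<^sub>v ((X ^\<^sub>m m) *\<^sub>v unit_vec n (pos k))) $ pos a"
  proof -
    let ?u = "(X ^\<^sub>m m) *\<^sub>v unit_vec n (pos k)"
    have "pos a < dim_vec ?u" using carrier_vecD[OF Xc] pos_less[OF a] by simp
    then have "(unit_vec n (pos j) + y l \<cdot>\<^sub>v ?u) $ pos a = unit_vec n (pos j) $ pos a + y l * ?u $ pos a"
      by (simp only: index_add_vec(1) index_smult_vec)
    then show ?thesis
      by (simp only: S mult_unit_vec_pos[OF G_carrier a j] mult_unit_vec_pos[OF X_pow_carrier a k]
        unit_vec_pos[OF a j] G_entry[OF a j] X_pow_entry[OF a k])
  qed
qed

lemma G_unit_other:
  assumes j: "j \<in> {1..n}" and no: "\<And>l. l \<in> invs k \<Longrightarrow> rw j = rw l \<Longrightarrow> cl l < cl j"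
  shows "G k y *\<^sub>v unit_vec n (pos j) = unit_vec n (pos j)"
proof (rule vec_pos_eqI)
  show "G k y *\<^sub>v unit_vec n (pos j) \<in> carrier_vec n"
    by (rule mult_mat_vec_carrier[OF G_carrier]) simp
  fix a assume a: "a \<in> {1..n}"
  have "\<not> shift k l a j" if "l \<in> invs k" for l using no[OF that] by (auto simp: shift_def)
  then show "(G k y *\<^sub>v unit_vec n (pos j)) $ pos a = unit_vec n (pos j) $ pos a"
    unfolding mult_unit_vec_pos[OF G_carrier a j] unit_vec_pos[OF a j] G_entry[OF a j] by simp
qed simp

text \<open>Membership prescribes the image of every basis vector, and \<open>G k y\<close> has
  exactly these images: those on or to the left of an inversion \<open>l\<close> in its row get the
  term with \<open>y l\<close>, the others stay fixed.\<close>

lemma B_sub_eq: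
  assumes k: "k \<in> {1..n}"
  shows "B_sub lam w k = range (G k)"
proof -
  have e: "std_basis n (w j) = unit_vec n (pos j)" for j by (simp add: std_basis_def pos_def)
  have mem: "(k, l) \<in> springer_inv_at lam w k \<longleftrightarrow> l \<in> invs k" for l
    by (simp add: springer_inv_at_def invs_def)
  have ex: "(\<nexists>m l. l \<in> invs k \<and> unit_vec n (pos j) = (X ^\<^sub>m m) *\<^sub>v unit_vec n (pos l)) \<longleftrightarrow>
      (\<forall>l\<in>invs k. rw j = rw l \<longrightarrow> cl l < cl j)" if j: "j \<in> {1..n}" for j
  proof -
    have "(\<exists>m. unit_vec n (pos j) = (X ^\<^sub>m m) *\<^sub>v unit_vec n (pos l)) \<longleftrightarrow> rw j = rw l \<and> cl j \<le> cl l"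
      if "l \<in> invs k" for l
    proof -
      have "(\<exists>m. unit_vec n (pos j) = (X ^\<^sub>m m) *\<^sub>v unit_vec n (pos l)) \<longleftrightarrow>
          (\<exists>m. rw j = rw l \<and> cl j + m = cl l)"
        by (simp only: X_pow_unit[OF j invsD(2)[OF that]])
      also have "\<dots> \<longleftrightarrow> rw j = rw l \<and> cl j \<le> cl l" by (auto dest!: le_Suc_ex)
      finally show ?thesis .
    qed
    then show ?thesis by (meson not_le)
  qed
  have char: "g \<in> B_sub lam w k \<longleftrightarrow> g \<in> carrier_mat n n \<and> (\<exists>x. \<forall>j\<in>{1..n}.
      (\<forall>m l. l \<in> invs k \<longrightarrow> unit_vec n (pos j) = (X ^\<^sub>m m) *\<^sub>v unit_vec n (pos l) \<longrightarrow>
        g *\<^sub>v unit_vec n (pos j) =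
          unit_vec n (pos j) + x (w k) (w l) \<cdot>\<^sub>v ((X ^\<^sub>m m) *\<^sub>v unit_vec n (pos k))) \<and>
      ((\<nexists>m l. l \<in> invs k \<and> unit_vec n (pos j) = (X ^\<^sub>m m) *\<^sub>v unit_vec n (pos l)) \<longrightarrow>
        g *\<^sub>v unit_vec n (pos j) = unit_vec n (pos j)))" for g
    unfolding B_sub_def Let_def sum_lam e mem by blast
  show ?thesis
  proof (intro equalityI subsetI)
    fix g assume "g \<in> B_sub lam w k"
    then obtain x where g: "g \<in> carrier_mat n n" and
      1: "\<And>j m l. j \<in> {1..n} \<Longrightarrow> l \<in> invs k \<Longrightarrow>
        unit_vec n (pos j) = (X ^\<^sub>m m) *\<^sub>v unit_vec n (pos l) \<Longrightarrow>
        g *\<^sub>v unit_vec n (pos j) =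
          unit_vec n (pos j) + x (w k) (w l) \<cdot>\<^sub>v ((X ^\<^sub>m m) *\<^sub>v unit_vec n (pos k))" and
      2: "\<And>j. j \<in> {1..n} \<Longrightarrow>
        (\<nexists>m l. l \<in> invs k \<and> unit_vec n (pos j) = (X ^\<^sub>m m) *\<^sub>v unit_vec n (pos l)) \<Longrightarrow>
        g *\<^sub>v unit_vec n (pos j) = unit_vec n (pos j)"
      unfolding char by blast
    let ?y = "\<lambda>l. x (w k) (w l)"
    have "g *\<^sub>v unit_vec n (pos j) = G k ?y *\<^sub>v unit_vec n (pos j)" if j: "j \<in> {1..n}" for j
    proof (cases "\<forall>l\<in>invs k. rw j = rw l \<longrightarrow> cl l < cl j")
      case True
      then show ?thesis using 2[OF j] ex[OF j] G_unit_other[OF j, of k ?y] by simp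
    next
      case False
      then obtain l where l: "l \<in> invs k" "rw j = rw l" "cl j \<le> cl l" by (auto simp: not_less)
      then obtain m where m: "cl j + m = cl l" using le_Suc_ex by metis
      then show ?thesis
        using 1[OF j l(1), of m] X_pow_unit[OF j invsD(2)[OF l(1)], of m]
          G_unit_inv[OF l(1) j l(2) m, of ?y] l(2) by simp
    qed
    then have e: "g $$ (pos a, pos b) = G k ?y $$ (pos a, pos b)" if "a \<in> {1..n}" "b \<in> {1..n}" for a b
      using mult_unit_vec_pos[OF g that] mult_unit_vec_pos[OF G_carrier that] that by metis
    have "g = G k ?y"
    proof (rule eq_matI)
      fix i j assume "i < dim_row (G k ?y)" "j < dim_col (G k ?y)"
      then have ij: "i < n" "j < n" using G_carrier[of k ?y] by auto
      obtain a b where "a \<in> {1..n}" "i = pos a" "b \<in> {1..n}" "j = pos b"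
        using pos_surj[OF ij(1)] pos_surj[OF ij(2)] by metis
      then show "g $$ (i, j) = G k ?y $$ (i, j)" using e by blast
    qed (use g G_carrier[of k ?y] in auto)
    then show "g \<in> range (G k)" by blast
  next
    fix g assume "g \<in> range (G k)"
    then obtain y where g: "g = G k y" by blast
    \<comment> \<open>The scalars of \<open>B_sub\<close> are indexed by values of \<open>w\<close>;
      the first index is always \<open>w k\<close> and may be ignored.\<close>
    let ?x = "\<lambda>i j. y (inv_into UNIV w j)"
    have x: "?x (w k) (w l) = y l" for l using permutes_inverses(2)[OF w] by simp
    show "g \<in> B_sub lam w k"
      unfolding char g x
    proof (intro conjI exI[of _ ?x] ballI allI impI G_carrier)
      fix j m l assume j: "j \<in> {1..n}" and l: "l \<in> invs k"
        and "unit_vec n (pos j) = (X ^\<^sub>m m) *\<^sub>v unit_vec n (pos l)"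
      then have "rw j = rw l" "cl j + m = cl l" using X_pow_unit[OF j invsD(2)[OF l]] by auto
      from G_unit_inv[OF l j this]
      show "G k y *\<^sub>v unit_vec n (pos j) = unit_vec n (pos j) +
          ?x (w k) (w l) \<cdot>\<^sub>v ((X ^\<^sub>m m) *\<^sub>v unit_vec n (pos k))" unfolding x .
    next
      fix j assume j: "j \<in> {1..n}"
        and "\<nexists>m l. l \<in> invs k \<and> unit_vec n (pos j) = (X ^\<^sub>m m) *\<^sub>v unit_vec n (pos l)"
      then show "G k y *\<^sub>v unit_vec n (pos j) = unit_vec n (pos j)"
        unfolding ex[OF j] using G_unit_other[OF j] by blast
    qed
  qed
qed

end

lemma mult_mat_vec_image:
  assumes "A \<in> carrier_mat n n" "B \<in> carrier_mat n n"
  shows "(*\<^sub>v) (A * B) ` coord_space n w i = (*\<^sub>v) A ` (*\<^sub>v) B ` coord_space n w i"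
  unfolding image_image
  by (intro image_cong refl assoc_mult_mat_vec[OF assms]) (rule coord_space_carrier)

lemma foldr_mult_mat:
  fixes c :: "'a :: semiring_1 mat"
  assumes "set As \<subseteq> carrier_mat n n" "c \<in> carrier_mat n n"
  shows "foldr (*) As (1\<^sub>m n) \<in> carrier_mat n n \<and> foldr (*) As c = foldr (*) As (1\<^sub>m n) * c"
  using assms(1)
proof (induction As)
  case Nil
  then show ?case using assms(2) by simp
next
  case (Cons A As)
  then have "A \<in> carrier_mat n n" "foldr (*) As (1\<^sub>m n) \<in> carrier_mat n n"
    "foldr (*) As c = foldr (*) As (1\<^sub>m n) * c" by auto
  then show ?case using assms(2) by (simp add: assoc_mult_mat[of _ n n _ n _ n])
qed

context row_strict_filling
begin

abbreviation W :: "nat \<Rightarrow> complex vec set" where "W i \<equiv> coord_space n w i"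

lemma w_less_flip: "\<not> w i < w j \<Longrightarrow> i \<noteq> j \<Longrightarrow> w j < w i"
  using inj_eq[OF permutes_inj[OF w], of i j] by auto

lemma unit_vec_in_coord_space:
  assumes i: "i \<in> {1..n}" and "i \<le> m"
  shows "unit_vec n (pos i) \<in> W m"
  unfolding coord_space_iff
proof (intro conjI ballI impI)
  fix j assume "j \<in> {1..n}" "m < j"
  then show "unit_vec n (pos i) $ pos j = (0 :: complex)"
    using unit_vec_pos[of j i] i \<open>i \<le> m\<close> by simp
qed simp

definition flag :: "complex mat \<Rightarrow> complex vec set list" where
  "flag g = flag_image (g * perm_matrix n w) (standard_flag n)"

lemma flag_nth: "g \<in> carrier_mat n n \<Longrightarrow> i \<le> n \<Longrightarrow> flag g ! i = (*\<^sub>v) g ` W i"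
  unfolding flag_def by (rule flag_image_perm_nth[OF _ w])

lemma flag_eqI:
  assumes "g \<in> carrier_mat n n" "h \<in> carrier_mat n n"
    and "\<And>i. i \<le> n \<Longrightarrow> (*\<^sub>v) g ` W i = (*\<^sub>v) h ` W i"
  shows "flag g = flag h"
proof (rule nth_equalityI)
  fix i assume "i < length (flag g)"
  then have "i \<le> n" by (simp add: flag_def)
  then show "flag g ! i = flag h ! i" by (simp only: flag_nth assms)
qed (simp add: flag_def)

lemma Borel_GL: "b \<in> Borel n \<Longrightarrow> b \<in> GL n"
  by (simp add: Borel_def)

lemma Borel_carrier: "b \<in> Borel n \<Longrightarrow> b \<in> carrier_mat n n"
  by (rule GL_carrier[OF Borel_GL])

lemma flag_in_Flags: "b \<in> Borel n \<Longrightarrow> flag b \<in> Flags n"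
  unfolding flag_def by (intro flag_image_in_Flags GL_mult Borel_GL perm_matrix_GL[OF w])

lemma schubert_cell_eq: "schubert_cell n w = flag ` Borel n"
  by (simp add: schubert_cell_def flag_def[abs_def])

subsection \<open>Flags in the Schubert cell\<close>

text \<open>A vector \<open>u\<close> of \<open>W (k - 1)\<close> vanishes at the positions of
  labels from \<open>k\<close> on. If \<open>b\<close> sends it to a vector vanishing at all other
  positions, back substitution gives u = 0. This places the Schubert cell in the chart.\<close>

lemma transversal_Borel:
  assumes b: "b \<in> Borel n" and k: "k \<in> {1..n}"
  shows "transversal n w k ((*\<^sub>v) b ` W (k - 1))"
  unfolding transversal_def
proof (intro ballI impI)
  fix v assume "v \<in> (*\<^sub>v) b ` W (k - 1)" and v0: "\<forall>i\<in>{1..<k}. v $ (w i - 1) = 0"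
  then obtain u where u: "u \<in> W (k - 1)" and v: "v = b *\<^sub>v u" by blast
  have uc: "u \<in> carrier_vec n" using u by (rule coord_space_carrier)
  have u0: "u $ pos j = 0" if "j \<in> {1..n}" "k \<le> j" for j
    using u that k by (auto simp: coord_space_iff)
  let ?S = "pos ` {k..n}"
  have uS: "u $ c = 0" if "c \<in> ?S" for c using that u0 k by auto
  have "u $ a = 0" if "a < n" "a \<notin> ?S" for a
  proof (rule upper_triangular_solve[OF b uc _ _ that])
    fix a c assume "c \<in> ?S"
    then show "b $$ (a, c) * u $ c = 0" by (simp add: uS)
  next
    fix a assume "a < n" "a \<notin> ?S"
    then obtain i where i: "i \<in> {1..n}" "a = pos i" using pos_surj by blast
    with \<open>a \<notin> ?S\<close> have "i < k" by (auto simp: not_le[symmetric])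
    then show "(b *\<^sub>v u) $ a = 0" using v0 i by (simp add: v pos_def)
  qed
  with uS have "u $ a = 0" if "a < n" for a using that by blast
  then have "u = 0\<^sub>v n" using uc by (intro eq_vecI) auto
  then show "v = 0\<^sub>v n" using Borel_carrier[OF b] unfolding v by (intro eq_vecI) auto
qed

lemma flag_in_big_cell:
  assumes b: "b \<in> Borel n"
  shows "flag b \<in> big_cell n w"
  unfolding big_cell_def
proof (intro CollectI conjI ballI flag_in_Flags[OF b])
  fix k assume k: "k \<in> {1..n}"
  then have "flag b ! (k - 1) = (*\<^sub>v) b ` W (k - 1)" using Borel_carrier[OF b] by (intro flag_nth) auto
  then show "transversal n w k (flag b ! (k - 1))" using transversal_Borel[OF b k] by simp
qed

lemma annihilates_Borel_exists:
  assumes b: "b \<in> Borel n" and k: "k \<in> {1..n}"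
  shows "\<exists>f. annihilates w k ((*\<^sub>v) b ` W (k - 1)) f"
proof -
  have e: "(*\<^sub>v) (b * perm_matrix n w) ` coord_space n id (k - 1) = (*\<^sub>v) b ` W (k - 1)"
    using mult_mat_vec_image[OF Borel_carrier[OF b] perm_matrix_carrier]
      perm_matrix_coord_space[OF w] by simp
  show ?thesis
    using annihilates_exists[OF w k GL_mult[OF Borel_GL[OF b] perm_matrix_GL[OF w]]]
      transversal_Borel[OF b k] unfolding e by blast
qed

lemma annihilates_pos:
  "annihilates w k U f \<longleftrightarrow> (\<forall>v\<in>U. v $ pos k = (\<Sum>i\<in>{1..<k}. f i * v $ pos i))"
  by (simp add: annihilates_def pos_def)

text \<open>Apply the functional to the image under \<open>b\<close> of the basis vector labelled
  \<open>i\<close>. Triangularity removes the coordinate at \<open>k\<close> and those with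
  \<open>w j > w i\<close>, induction on \<open>w i\<close> removes those with
  \<open>w j < w i\<close>, and the nonzero diagonal entry times \<open>f i\<close> remains.\<close>

lemma annihilates_Borel_zero:
  assumes b: "b \<in> Borel n" and k: "k \<in> {1..n}"
    and f: "annihilates w k ((*\<^sub>v) b ` W (k - 1)) f"
    and i: "i \<in> {1..<k}" "w i < w k"
  shows "f i = 0"
  using i
proof (induction "w i" arbitrary: i rule: less_induct)
  case less
  have i: "i \<in> {1..n}" "i < k" using less.prems k by auto
  have bc: "b \<in> carrier_mat n n" by (rule Borel_carrier[OF b])
  have u: "b $$ (pos j, pos i) = 0" if "j \<in> {1..n}" "w i < w j" for j
    using b bc pos_mono[OF i(1) that(1)] pos_less[OF that(1)] that(2)
    by (auto simp: Borel_def upper_triangular_def)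
  have "unit_vec n (pos i) \<in> W (k - 1)"
    using i by (intro unit_vec_in_coord_space) auto
  with f have "(b *\<^sub>v unit_vec n (pos i)) $ pos k =
      (\<Sum>j\<in>{1..<k}. f j * (b *\<^sub>v unit_vec n (pos i)) $ pos j)"
    unfolding annihilates_pos by blast
  also have "(b *\<^sub>v unit_vec n (pos i)) $ pos k = 0"
    using u[OF k] less.prems(2) by (simp only: mult_unit_vec_pos[OF bc k i(1)])
  also have "(\<Sum>j\<in>{1..<k}. f j * (b *\<^sub>v unit_vec n (pos i)) $ pos j) =
      (\<Sum>j\<in>{1..<k}. if j = i then f i * b $$ (pos i, pos i) else 0)"
  proof (rule sum.cong[OF refl])
    fix j assume j: "j \<in> {1..<k}"
    then have jn: "j \<in> {1..n}" using k by auto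
    consider "j = i" | "w j < w i" | "w i < w j"
      using w_less_flip by blast
    then have "f j * b $$ (pos j, pos i) = (if j = i then f i * b $$ (pos i, pos i) else 0)"
      using less.hyps[OF _ j] less.prems(2) u[OF jn] by cases auto
    then show "f j * (b *\<^sub>v unit_vec n (pos i)) $ pos j =
        (if j = i then f i * b $$ (pos i, pos i) else 0)"
      by (simp only: mult_unit_vec_pos[OF bc jn i(1)])
  qed
  also have "\<dots> = f i * b $$ (pos i, pos i)" using less.prems(1) by simp
  finally show ?case using Borel_diag[OF b pos_less[OF i(1)]] by simp
qed

subsection \<open>The Springer condition\<close>

definition springer :: "complex mat \<Rightarrow> bool" where
  "springer g \<longleftrightarrow> (\<forall>i\<in>{1..n}. (*\<^sub>v) X ` (*\<^sub>v) g ` W i \<subseteq> (*\<^sub>v) g ` W (i - 1))"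

lemma springer_fiber_iff:
  assumes b: "b \<in> Borel n"
  shows "flag b \<in> springer_fiber n X \<longleftrightarrow> springer b"
proof -
  have "flag b ! i = (*\<^sub>v) b ` W i" "flag b ! (i - 1) = (*\<^sub>v) b ` W (i - 1)" if "i \<in> {1..n}" for i
    using that Borel_carrier[OF b] by (auto intro!: flag_nth)
  then show ?thesis
    unfolding springer_fiber_def springer_def using flag_in_Flags[OF b] by simp
qed

text \<open>The invariant of the splitting. For k = n the last clause holds for every
  \<open>b\<close> in the Borel group, since \<open>W i\<close> is then the whole space; for k = 1
  the flag of \<open>b\<close> is the permutation flag.\<close>

definition stable :: "nat \<Rightarrow> complex mat \<Rightarrow> bool" where
  "stable k b \<longleftrightarrow> b \<in> Borel n \<and> springer b \<and> (\<forall>i. k \<le> i \<longrightarrow> (*\<^sub>v) b ` W i = W i)"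

lemma stable_mono: "stable k b \<Longrightarrow> k \<le> k' \<Longrightarrow> stable k' b"
  by (auto simp: stable_def)

lemma stable_one: "stable k (1\<^sub>m n)"
proof -
  have W: "(*\<^sub>v) (1\<^sub>m n) ` W i = W i" for i by (force simp: coord_space_iff)
  then show ?thesis
    using unitri_one X_coord_space by (auto simp: stable_def springer_def unitri_def)
qed

lemma G_Borel: "G k y \<in> Borel n"
  using G_unitri by (simp add: unitri_def)

text \<open>Steps up to \<open>k\<close> lie in \<open>W k\<close>, where \<open>G k y\<close>
  commutes with \<open>X\<close>. Beyond \<open>k\<close> both subspaces in the Springer condition
  are coordinate spaces, for which it holds by \<open>X_coord_space\<close>.\<close>

lemma stable_G:
  assumes k: "k \<in> {1..n}" and b: "stable k b"
  shows "stable k (G k y * b)"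
proof -
  have bB: "b \<in> Borel n" and bs: "springer b" and bW: "\<And>i. k \<le> i \<Longrightarrow> (*\<^sub>v) b ` W i = W i"
    using b by (auto simp: stable_def)
  note im = mult_mat_vec_image[OF G_carrier Borel_carrier[OF bB]]
  have st: "(*\<^sub>v) (G k y * b) ` W i = W i" if "k \<le> i" for i
    unfolding im bW[OF that] by (rule G_coord_space[OF that])
  have "(*\<^sub>v) X ` (*\<^sub>v) (G k y * b) ` W i \<subseteq> (*\<^sub>v) (G k y * b) ` W (i - 1)" if i: "i \<in> {1..n}" for i
  proof (cases "i \<le> k")
    case True
    have "X *\<^sub>v (G k y *\<^sub>v u) \<in> (*\<^sub>v) (G k y) ` (*\<^sub>v) b ` W (i - 1)" if u: "u \<in> (*\<^sub>v) b ` W i" for u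
    proof -
      have "(*\<^sub>v) b ` W i \<subseteq> (*\<^sub>v) b ` W k" using coord_space_mono[OF True] by (rule image_mono)
      then have "u \<in> W k" using u bW[of k] by blast
      moreover have "X *\<^sub>v u \<in> (*\<^sub>v) b ` W (i - 1)" using bs u i unfolding springer_def by blast
      ultimately show ?thesis using X_G_commute[OF k] by simp
    qed
    then show ?thesis unfolding im by blast
  next
    case False
    then show ?thesis
      using st[of i] st[of "i - 1"] X_coord_space[of _ i] i by (auto simp: image_subset_iff)
  qed
  then show ?thesis
    using st Borel_mult[OF G_Borel bB] by (simp add: stable_def springer_def)
qed

text \<open>
  The hyperplane \<open>b W\<^sub>k\<^sub>-\<^sub>1\<close> of \<open>W\<^sub>k\<close> contains \<open>X W\<^sub>k\<close>, so the functional defining it is supported on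
  labels at the ends of rows of \<open>{1..k}\<close>, that is, on Springer inversions; its coefficients are
  the coordinates of the factor to be split off.
\<close>

lemma stable_reduce:
  assumes k: "k \<in> {1..n}" and b: "stable k b"
  obtains y where "stable (k - 1) (G k (\<lambda>l. - y l) * b)"
proof -
  have bB: "b \<in> Borel n" and bs: "springer b" and bW: "\<And>i. k \<le> i \<Longrightarrow> (*\<^sub>v) b ` W i = W i"
    using b by (auto simp: stable_def)
  obtain f where f: "annihilates w k ((*\<^sub>v) b ` W (k - 1)) f"
    using annihilates_Borel_exists[OF bB k] by blast
  have f0: "f i = 0" if i: "i \<in> {1..<k}" "i \<notin> invs k" for i
  proof (cases "w i < w k")
    case True
    then show ?thesis by (rule annihilates_Borel_zero[OF bB k f i(1)])
  next
    case False
    have ik: "i \<in> {1..n}" "i < k" using i k by auto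
    then have "w k < w i" using False w_less_flip by auto
    \<comment> \<open>All conditions on an inversion hold for \<open>i\<close> except the one on its
      right neighbour, so that neighbour exists and its label is at most \<open>k\<close>.
      \<open>X\<close> maps its basis vector to that of \<open>i\<close>, and the functional
      vanishes there.\<close>
    then obtain r where r: "r \<in> {1..n}" "rw r = rw i" "cl r = cl i + 1" "r \<le> k"
      using i(2) k ik unfolding invs_iff by (auto simp: not_less)
    let ?v = "X *\<^sub>v unit_vec n (pos r)"
    have v: "?v $ pos j = of_bool (j = i)" if "j \<in> {1..n}" for j
      unfolding mult_unit_vec_pos[OF X_carrier that r(1)] X_entry[OF that r(1)]
      using r(2,3) box_inj[OF that ik(1)] by auto
    have "unit_vec n (pos r) \<in> W k"
      using r by (intro unit_vec_in_coord_space)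
    then have "unit_vec n (pos r) \<in> (*\<^sub>v) b ` W k" using bW[of k] by simp
    then have "?v \<in> (*\<^sub>v) b ` W (k - 1)" using bs k unfolding springer_def by blast
    then have "?v $ pos k = (\<Sum>j\<in>{1..<k}. f j * ?v $ pos j)" using f unfolding annihilates_pos by blast
    also have "\<dots> = (\<Sum>j\<in>{1..<k}. if j = i then f i else 0)"
      using k by (intro sum.cong) (auto simp: v[simplified])
    also have "\<dots> = f i" using i(1) by simp
    finally show ?thesis using v[OF k] ik by simp
  qed
  let ?g = "G k (\<lambda>l. - f l)"
  have st: "stable k (?g * b)" by (rule stable_G[OF k b])
  note im = mult_mat_vec_image[OF G_carrier Borel_carrier[OF bB]]
  have "(*\<^sub>v) (?g * b) ` W (k - 1) \<subseteq> W (k - 1)"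
  proof
    fix z assume "z \<in> (*\<^sub>v) (?g * b) ` W (k - 1)"
    then obtain u where u: "u \<in> (*\<^sub>v) b ` W (k - 1)" and z: "z = ?g *\<^sub>v u" unfolding im by blast
    have "(*\<^sub>v) b ` W (k - 1) \<subseteq> (*\<^sub>v) b ` W k"
      using coord_space_mono[of "k - 1" k] by (intro image_mono) auto
    then have uk: "u \<in> W k" using u bW[of k] by blast
    then have uc: "u \<in> carrier_vec n" by (rule coord_space_carrier)
    have zk: "z \<in> W k" using G_coord_space[of k k] uk unfolding z by blast
    \<comment> \<open>The shifts reach row \<open>k\<close> of the matrix only from the labels
      \<open>l\<close> themselves. With the scalars \<open>- f l\<close> the new coordinate at
      \<open>k\<close> is thus the value of the functional at \<open>u\<close>, which is
      zero.\<close>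
    have "z $ pos k = u $ pos k + (\<Sum>l\<in>invs k. - f l * u $ pos l)"
      unfolding z G_mult[OF uc k]
    proof (intro arg_cong2[where f = "(+)"] sum.cong refl arg_cong2[where f = "(*)"])
      fix l assume l: "l \<in> invs k"
      have "(\<Sum>b\<in>{1..n}. of_bool (shift k l k b) * u $ pos b) = (\<Sum>b\<in>{1..n}. if b = l then u $ pos l else 0)"
      proof (intro sum.cong refl)
        fix b assume "b \<in> {1..n}"
        then have "shift k l k b \<longleftrightarrow> b = l"
          using box_inj[OF _ invsD(2)[OF l], of b] by (auto simp: shift_def)
        then show "of_bool (shift k l k b) * u $ pos b = (if b = l then u $ pos l else 0)" by simp
      qed
      then show "(\<Sum>b\<in>{1..n}. of_bool (shift k l k b) * u $ pos b) = u $ pos l"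
        using invsD(2)[OF l] by simp
    qed
    also have "(\<Sum>l\<in>invs k. - f l * u $ pos l) = - (\<Sum>i\<in>{1..<k}. f i * u $ pos i)"
    proof -
      have "invs k \<subseteq> {1..<k}" using invsD by auto
      then have "(\<Sum>l\<in>invs k. f l * u $ pos l) = (\<Sum>i\<in>{1..<k}. f i * u $ pos i)"
        using f0 by (intro sum.mono_neutral_left) auto
      then show ?thesis by (simp add: sum_negf)
    qed
    also have "u $ pos k + \<dots> = 0" using bspec[OF f[unfolded annihilates_pos] u] by simp
    finally have "z $ pos k = 0" .
    then show "z \<in> W (k - 1)"
      using zk unfolding coord_space_iff by (metis Suc_pred' Suc_lessI k atLeastAtMost_iff
        less_eq_Suc_le One_nat_def)
  qed
  then have "(*\<^sub>v) (?g * b) ` W (k - 1) = W (k - 1)"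
    using st by (intro Borel_coord_space[OF _ _ w]) (auto simp: stable_def)
  then have "(*\<^sub>v) (?g * b) ` W i = W i" if "k - 1 \<le> i" for i
    using st that unfolding stable_def by (cases "i = k - 1") auto
  then have "stable (k - 1) (?g * b)" using st by (simp add: stable_def)
  then show thesis by (rule that)
qed

subsection \<open>Products of the subgroups\<close>

text \<open>The \<open>m\<close> leftmost factors, with indices \<open>n\<close> down to n - m + 1;
  the complete product is \<open>H x (n - 1)\<close>, ending with index 2.\<close>

primrec H :: "(nat \<Rightarrow> nat \<Rightarrow> complex) \<Rightarrow> nat \<Rightarrow> complex mat" where
  "H x 0 = 1\<^sub>m n"
| "H x (Suc m) = H x m * G (n - m) (x (n - m))"

lemma H_unitri: "unitri (H x m)"
  by (induction m) (auto intro: unitri_one unitri_mult G_unitri)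

lemma H_Borel: "H x m \<in> Borel n"
  using H_unitri by (simp add: unitri_def)

lemma H_carrier: "H x m \<in> carrier_mat n n"
  by (rule Borel_carrier[OF H_Borel])

lemma H_cong:
  assumes "\<And>k l. n - m < k \<Longrightarrow> k \<le> n \<Longrightarrow> l \<in> invs k \<Longrightarrow> x k l = x' k l" "m \<le> n"
  shows "H x m = H x' m"
  using assms
proof (induction m)
  case (Suc m)
  then have "H x m = H x' m" by (intro Suc.IH) auto
  moreover have "G (n - m) (x (n - m)) = G (n - m) (x' (n - m))"
    using Suc.prems by (intro G_cong) auto
  ultimately show ?case by simp
qed simp

text \<open>The factors are absorbed from the inside out: the innermost has the smallest index, and
  each absorption raises the level of stability by one, as \<open>stable_G\<close> requires.\<close>

lemma H_stable:
  assumes "m < n" "stable (n - m) b"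
  shows "stable n (H x m * b)"
  using assms
proof (induction m arbitrary: b)
  case 0
  then show ?case using Borel_carrier[of b] by (simp add: stable_def)
next
  case (Suc m)
  have bc: "b \<in> carrier_mat n n" using Suc.prems Borel_carrier by (simp add: stable_def)
  have "stable (n - m) (G (n - m) (x (n - m)) * b)"
    using Suc.prems by (intro stable_G) (auto elim: stable_mono)
  then have "stable n (H x m * (G (n - m) (x (n - m)) * b))" using Suc by simp
  then show ?case using assoc_mult_mat[OF H_carrier G_carrier bc] by simp
qed

lemma H_exists:
  assumes b: "b \<in> Borel n" "springer b" and "m < n"
  shows "\<exists>x b'. stable (n - m) b' \<and> b = H x m * b'"
  using \<open>m < n\<close>
proof (induction m)
  case 0
  have "(*\<^sub>v) b ` W i = W i" if "n \<le> i" for i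
  proof (rule Borel_coord_space[OF b(1) _ w])
    have "W i = carrier_vec n" using that by (auto simp: coord_space_iff)
    then show "(*\<^sub>v) b ` W i \<subseteq> W i"
      using mult_mat_vec_carrier[OF Borel_carrier[OF b(1)]] by (simp only: image_subset_iff) blast
  qed
  then have "stable (n - 0) b" using b by (simp add: stable_def)
  moreover have "b = H (\<lambda>_ _. 0) 0 * b" using Borel_carrier[OF b(1)] by simp
  ultimately show ?case by blast
next
  case (Suc m)
  then obtain x b' where x: "stable (n - m) b'" "b = H x m * b'" by auto
  have "n - m \<in> {1..n}" using Suc.prems by auto
  then obtain y where y: "stable (n - m - 1) (G (n - m) (\<lambda>l. - y l) * b')"
    using stable_reduce x(1) by blast
  have bc: "b' \<in> carrier_mat n n" using x(1) Borel_carrier by (simp add: stable_def)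
  \<comment> \<open>\<open>H x m\<close> involves only indices above n - m, so the new scalars can
    be stored at n - m without changing it.\<close>
  let ?b = "G (n - m) (\<lambda>l. - y l) * b'" and ?x = "x(n - m := y)"
  have "H ?x m = H x m" using Suc.prems by (intro H_cong) auto
  then have "H ?x (Suc m) * ?b = H x m * (G (n - m) y * ?b)"
    using assoc_mult_mat[OF H_carrier G_carrier mult_carrier_mat[OF G_carrier bc]] by simp
  also have "G (n - m) y * ?b = b'"
    using assoc_mult_mat[OF G_carrier G_carrier bc, of "n - m" y "n - m" "\<lambda>l. - y l", symmetric]
      G_inverse[of "n - m" y] bc by simp
  finally show ?case using x(2) y by (intro exI[of _ ?x] exI[of _ ?b]) simp
qed

lemma foldr_H:
  assumes "m \<le> n"
  shows "foldr (*) (map (\<lambda>k. G k (x k)) (rev [n - m + 1..<n + 1])) (1\<^sub>m n) = H x m"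
  using assms
proof (induction m)
  case (Suc m)
  have "[n - Suc m + 1..<n + 1] = (n - m) # [n - m + 1..<n + 1]"
  proof -
    have "n - Suc m + 1 = n - m" using Suc.prems by simp
    then show ?thesis using upt_conv_Cons[of "n - m" "n + 1"] by (simp del: upt_Suc)
  qed
  then have "foldr (*) (map (\<lambda>k. G k (x k)) (rev [n - Suc m + 1..<n + 1])) (1\<^sub>m n) =
      foldr (*) (map (\<lambda>k. G k (x k)) (rev [n - m + 1..<n + 1])) (G (n - m) (x (n - m)) * 1\<^sub>m n)"
    by (simp del: upt_Suc)
  also have "\<dots> = foldr (*) (map (\<lambda>k. G k (x k)) (rev [n - m + 1..<n + 1])) (1\<^sub>m n) *
      (G (n - m) (x (n - m)) * 1\<^sub>m n)"
    by (rule conjunct2[OF foldr_mult_mat])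
      (use G_carrier mult_carrier_mat[OF G_carrier one_carrier_mat] in auto)
  finally show ?case using Suc G_carrier[of "n - m" "x (n - m)"] by simp
qed simp

subsection \<open>The parametrization\<close>

abbreviation Y :: "complex vec set list set" where
  "Y \<equiv> schubert_cell n w \<inter> springer_fiber n X"

definition param :: "(nat \<Rightarrow> nat \<Rightarrow> complex) \<Rightarrow> complex vec set list" where
  "param x = flag (H x (n - 1))"

lemma param_cong:
  assumes "\<And>k l. l \<in> invs k \<Longrightarrow> x k l = x' k l"
  shows "param x = param x'"
proof -
  have "H x (n - 1) = H x' (n - 1)" using assms by (intro H_cong) auto
  then show ?thesis by (simp add: param_def)
qed

lemma range_param:
  assumes "n > 0"
  shows "range param = Y"
proof (intro equalityI subsetI)
  fix V assume "V \<in> range param"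
  then obtain x where V: "V = flag (H x (n - 1))" by (auto simp: param_def)
  have "stable n (H x (n - 1) * 1\<^sub>m n)" using assms by (intro H_stable stable_one) auto
  then have "springer (H x (n - 1))" using H_carrier[of x "n - 1"] by (simp add: stable_def)
  then show "V \<in> Y"
    using springer_fiber_iff[OF H_Borel] H_Borel by (auto simp: V schubert_cell_eq)
next
  fix V assume "V \<in> Y"
  then obtain b where b: "b \<in> Borel n" "springer b" and V: "V = flag b"
    using springer_fiber_iff by (auto simp: schubert_cell_eq)
  obtain x b' where x: "stable (n - (n - 1)) b'" "b = H x (n - 1) * b'"
    using H_exists[OF b, of "n - 1"] assms by auto
  have bB: "b' \<in> Borel n" and bW: "\<And>i. 1 \<le> i \<Longrightarrow> (*\<^sub>v) b' ` W i = W i"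
    using x(1) assms by (auto simp: stable_def)
  \<comment> \<open>After n - 1 factors the remainder fixes all steps of positive dimension; the
    zero step is fixed by any matrix, so the remainder does not change the flag.\<close>
  have W0: "W 0 = {0\<^sub>v n}"
    by (auto simp: coord_space_iff pos_less intro!: vec_pos_eqI)
  have "(*\<^sub>v) b' ` W 0 = W 0" using Borel_carrier[OF bB] by (auto simp: W0)
  then have "(*\<^sub>v) b' ` W i = W i" for i using bW[of i] by (cases i) auto
  then have "(*\<^sub>v) b ` W i = (*\<^sub>v) (H x (n - 1)) ` W i" for i
    unfolding x(2) mult_mat_vec_image[OF H_carrier Borel_carrier[OF bB]] by simp
  then have "V = param x"
    unfolding V param_def by (intro flag_eqI Borel_carrier b(1) H_Borel)
  then show "V \<in> range param" by blast
qed

lemma D_set_eq: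
  assumes "n > 0"
  shows "D_set lam w = range param"
proof -
  have D: "D_set lam w = {flag (foldr (*) (map g (rev [2..<n + 1])) (1\<^sub>m n)) |g. \<forall>k\<in>{2..n}. g k \<in> B_sub lam w k}"
    by (simp only: D_set_def Let_def sum_lam flag_def)
  \<comment> \<open>With m = n - 1 the lower bound n - m + 1 is 2.\<close>
  have fold: "foldr (*) (map (\<lambda>k. G k (x k)) (rev [2..<n + 1])) (1\<^sub>m n) = H x (n - 1)" for x
    using foldr_H[of "n - 1" x] assms by (simp del: upt_Suc add: numeral_2_eq_2)
  show ?thesis
  proof (intro equalityI subsetI)
    fix V assume "V \<in> D_set lam w"
    then obtain g where g: "\<And>k. k \<in> {2..n} \<Longrightarrow> g k \<in> B_sub lam w k"
      and V: "V = flag (foldr (*) (map g (rev [2..<n + 1])) (1\<^sub>m n))" unfolding D by blast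
    have "\<exists>y. g k = G k y" if "k \<in> {2..n}" for k using g[OF that] B_sub_eq[of k] that by auto
    then obtain x where x: "\<And>k. k \<in> {2..n} \<Longrightarrow> g k = G k (x k)" by metis
    have "map g (rev [2..<n + 1]) = map (\<lambda>k. G k (x k)) (rev [2..<n + 1])"
      using x by (intro map_cong refl) auto
    then have "V = param x" by (simp only: V fold param_def)
    then show "V \<in> range param" by blast
  next
    fix V assume "V \<in> range param"
    then obtain x where "V = flag (foldr (*) (map (\<lambda>k. G k (x k)) (rev [2..<n + 1])) (1\<^sub>m n))"
      unfolding fold by (auto simp: param_def)
    moreover have "\<forall>k\<in>{2..n}. G k (x k) \<in> B_sub lam w k" using B_sub_eq by auto
    ultimately show "V \<in> D_set lam w" unfolding D by blast
  qed
qed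

subsection \<open>Recovering the coordinates\<close>

text \<open>Minus the value of the normalised functional on column \<open>l\<close> of
  \<open>M\<close> (in labels). For \<open>M\<close> the product of the outer factors this solves
  the linear equation for the coordinate belonging to the pair of \<open>k\<close> and
  \<open>l\<close>.\<close>

definition coeff :: "complex vec set list \<Rightarrow> nat \<Rightarrow> complex mat \<Rightarrow> nat \<Rightarrow> complex" where
  "coeff V k M l = (\<Sum>i\<in>{1..<k}. annihilator w V k i * M $$ (pos i, pos l)) - M $$ (pos k, pos l)"

text \<open>
  The product \<open>H x m\<close> for the unknown coordinates \<open>x\<close> of \<open>V\<close>, which are solved for one row at a
  time.
\<close>

primrec R :: "complex vec set list \<Rightarrow> nat \<Rightarrow> complex mat" where
  "R V 0 = 1\<^sub>m n"
| "R V (Suc m) = R V m * G (n - m) (coeff V (n - m) (R V m))"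

text \<open>Factors with index below \<open>k\<close> preserve \<open>W (k - 1)\<close>, so with H =
  \<open>H x (n - k)\<close> the step of dimension k - 1 contains H(e_l + x e_k), where x is
  \<open>x k l\<close> and e_k, e_l are the basis vectors labelled \<open>k\<close>,
  \<open>l\<close>. In the vanishing of the functional there, x has coefficient 1: the diagonal
  entry of H is 1, and each further product contains either \<open>f i\<close> with
  \<open>w i < w k\<close>, which is zero, or an entry of H below the diagonal.\<close>

lemma coeff_param:
  assumes l: "l \<in> invs k"
  shows "coeff (param x) k (H x (n - k)) l = x k l"
proof -
  let ?V = "param x" and ?H = "H x (n - k)" and ?f = "annihilator w (param x) k"
  have k: "k \<in> {1..n}" "l \<in> {1..n}" "l < k" using invsD[OF l] by auto
  have Vk: "?V ! (k - 1) = (*\<^sub>v) (H x (n - 1)) ` W (k - 1)"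
    unfolding param_def using k by (intro flag_nth H_carrier) auto
  have *: "(*\<^sub>v) (H x m) ` W (k - 1) = (*\<^sub>v) (H x (n - k + 1)) ` W (k - 1)"
    if "n - k + 1 \<le> m" "m < n" for m
    using that
  proof (induction m rule: dec_induct)
    case (step m)
    then have "n - m \<le> k - 1" by auto
    then show ?case
      using step G_coord_space[of "n - m" "k - 1" "x (n - m)"]
      by (simp add: mult_mat_vec_image[OF H_carrier G_carrier])
  qed simp
  have "(*\<^sub>v) (H x (n - 1)) ` W (k - 1) = (*\<^sub>v) (H x (n - k + 1)) ` W (k - 1)"
    using k by (intro *) auto
  also have "H x (n - k + 1) = ?H * G k (x k)" using k by simp
  finally have V: "?V ! (k - 1) = (*\<^sub>v) ?H ` (*\<^sub>v) (G k (x k)) ` W (k - 1)"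
    unfolding Vk mult_mat_vec_image[OF H_carrier G_carrier] .
  let ?el = "unit_vec n (pos l) :: complex vec" and ?ek = "unit_vec n (pos k) :: complex vec"
  have f: "annihilates w k (?V ! (k - 1)) ?f"
    unfolding annihilator_def Vk
    by (rule someI_ex[of "annihilates w k ((*\<^sub>v) (H x (n - 1)) ` W (k - 1))"])
      (rule annihilates_Borel_exists[OF H_Borel k(1)])
  have "?el \<in> W (k - 1)" using k by (intro unit_vec_in_coord_space) auto
  then have "?H *\<^sub>v (G k (x k) *\<^sub>v ?el) \<in> ?V ! (k - 1)" unfolding V by blast
  moreover have "G k (x k) *\<^sub>v ?el = ?el + x k l \<cdot>\<^sub>v ?ek"
    using G_unit_inv[OF l k(2) refl, of 0 "x k"] X_carrier by simp
  moreover have "?H *\<^sub>v (?el + x k l \<cdot>\<^sub>v ?ek) = ?H *\<^sub>v ?el + x k l \<cdot>\<^sub>v (?H *\<^sub>v ?ek)"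
    using H_carrier[of x "n - k"] by (simp add: mult_add_distrib_mat_vec[of _ n n] mult_mat_vec[of _ n n])
  ultimately have mem: "?H *\<^sub>v ?el + x k l \<cdot>\<^sub>v (?H *\<^sub>v ?ek) \<in> ?V ! (k - 1)" by simp
  have ent: "(?H *\<^sub>v ?el + x k l \<cdot>\<^sub>v (?H *\<^sub>v ?ek)) $ pos a =
      ?H $$ (pos a, pos l) + x k l * ?H $$ (pos a, pos k)" if a: "a \<in> {1..n}" for a
  proof -
    have "pos a < dim_vec (?H *\<^sub>v ?ek)" using pos_less[OF a] H_carrier[of x "n - k"] by simp
    then show ?thesis
      by (simp only: index_add_vec(1) index_smult_vec mult_unit_vec_pos[OF H_carrier a k(1)]
        mult_unit_vec_pos[OF H_carrier a k(2)])
  qed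
  have kk: "?H $$ (pos k, pos k) = 1" using H_unitri pos_less[OF k(1)] by (simp add: unitri_def)
  have ik: "?f i * ?H $$ (pos i, pos k) = 0" if i: "i \<in> {1..<k}" for i
  proof (cases "w i < w k")
    case True
    then show ?thesis using annihilates_Borel_zero[OF H_Borel k(1) f[unfolded Vk] i] by simp
  next
    case False
    have i': "i \<in> {1..n}" "i \<noteq> k" using i k by auto
    then have "w k < w i" using False w_less_flip by auto
    then have "pos k < pos i" using pos_mono[OF k(1) i'(1)] by simp
    then have "?H $$ (pos i, pos k) = 0"
      using H_Borel[of x "n - k"] H_carrier[of x "n - k"] pos_less[OF i'(1)]
      by (auto simp: Borel_def upper_triangular_def)
    then show ?thesis by simp
  qed
  have "?H $$ (pos k, pos l) + x k l =
      (\<Sum>i\<in>{1..<k}. ?f i * (?H $$ (pos i, pos l) + x k l * ?H $$ (pos i, pos k)))"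
  proof -
    have "?H $$ (pos k, pos l) + x k l = (?H *\<^sub>v ?el + x k l \<cdot>\<^sub>v (?H *\<^sub>v ?ek)) $ pos k"
      by (simp only: ent[OF k(1)] kk mult_1_right)
    also have "\<dots> = (\<Sum>i\<in>{1..<k}. ?f i * (?H *\<^sub>v ?el + x k l \<cdot>\<^sub>v (?H *\<^sub>v ?ek)) $ pos i)"
      using f mem unfolding annihilates_pos by blast
    also have "\<dots> = (\<Sum>i\<in>{1..<k}. ?f i * (?H $$ (pos i, pos l) + x k l * ?H $$ (pos i, pos k)))"
      using k by (intro sum.cong refl arg_cong2[where f = "(*)"] ent) auto
    finally show ?thesis .
  qed
  also have "\<dots> = (\<Sum>i\<in>{1..<k}. ?f i * ?H $$ (pos i, pos l))"
  proof (rule sum.cong[OF refl])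
    fix i assume i: "i \<in> {1..<k}"
    have "?f i * (?H $$ (pos i, pos l) + x k l * ?H $$ (pos i, pos k)) =
        ?f i * ?H $$ (pos i, pos l) + x k l * (?f i * ?H $$ (pos i, pos k))" by (simp only: algebra_simps)
    then show "?f i * (?H $$ (pos i, pos l) + x k l * ?H $$ (pos i, pos k)) = ?f i * ?H $$ (pos i, pos l)"
      by (simp only: ik[OF i]) simp
  qed
  finally show ?thesis unfolding coeff_def by (simp add: algebra_simps)
qed

lemma R_param: "m < n \<Longrightarrow> R (param x) m = H x m"
proof (induction m)
  case (Suc m)
  have "G (n - m) (coeff (param x) (n - m) (H x m)) = G (n - m) (x (n - m))"
    using Suc.prems by (intro G_cong) (metis Suc_lessD coeff_param diff_diff_cancel less_imp_le)
  then show ?case using Suc by simp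
qed simp

definition coordinate :: "complex vec set list \<Rightarrow> nat \<Rightarrow> nat \<Rightarrow> complex" where
  "coordinate V k l = coeff V k (R V (n - k)) l"

lemma coordinate_param:
  assumes "l \<in> invs k"
  shows "coordinate (param x) k l = x k l"
proof -
  have "n - k < n" using invsD[OF assms] by auto
  from R_param[OF this] show ?thesis using coeff_param[OF assms] by (simp add: coordinate_def)
qed

lemma Y_subset_big_cell: "Y \<subseteq> big_cell n w"
  using flag_in_big_cell by (auto simp: schubert_cell_eq)

end

section \<open>Regularity of the parametrization and of the recovered coordinates\<close>

lemma (in function_sheaf) regular_mult_G:
  assumes "row_strict_filling n w lam"
    and U: "openin (top_of X) U"
    and M: "\<And>p. M p \<in> carrier_mat n n"
      "\<And>i j. i < n \<Longrightarrow> j < n \<Longrightarrow> regular X U (\<lambda>p. M p $$ (i, j))"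
    and y: "\<And>l. l \<in> row_strict_filling.invs w lam k \<Longrightarrow> regular X U (\<lambda>p. y p l)"
    and ij: "i < n" "j < n"
  shows "regular X U (\<lambda>p. (M p * row_strict_filling.G n w lam k (y p)) $$ (i, j))"
proof -
  interpret T: row_strict_filling n w lam by fact
  have "(M p * T.G k (y p)) $$ (i, j) =
      (\<Sum>a<n. M p $$ (i, a) * (of_bool (a = j) + (\<Sum>l\<in>T.invs k. y p l *
        of_bool (T.shift k l (inv_into UNIV w (Suc a)) (inv_into UNIV w (Suc j))))))" for p
    using M(1)[of p] T.G_carrier[of k "y p"] ij
    by (simp add: scalar_prod_def atLeast0LessThan T.G_def)
  then show ?thesis
    by (simp only:) (intro regular_sum regular_mult regular_add regular_const U M(2) y ij; simp)
qed

context row_strict_filling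
begin

lemma regular_H:
  assumes "function_sheaf S" and U: "openin (top_of S) U"
    and x: "\<And>k l. l \<in> invs k \<Longrightarrow> regular S U (\<lambda>p. x p k l)"
    and ij: "i < n" "j < n"
  shows "regular S U (\<lambda>p. H (x p) m $$ (i, j))"
  using ij
proof (induction m arbitrary: i j)
  case 0
  then show ?case using function_sheaf.regular_const[OF assms(1) U] by simp
next
  case (Suc m)
  show ?case
    unfolding H.simps
    by (rule function_sheaf.regular_mult_G[OF assms(1) row_strict_filling_axioms U H_carrier
      Suc.IH x Suc.prems])
qed

lemma R_carrier: "R V m \<in> carrier_mat n n"
  by (induction m) (auto intro: mult_carrier_mat G_carrier)

lemma function_sheaf_flag_variety: "function_sheaf (flag_variety n)"
  unfolding flag_variety_def
  by (rule function_sheaf.quotient_space[OF function_sheaf_GL_variety])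

lemma regular_coeff:
  assumes k: "k \<in> {1..n}" "l \<in> {1..n}"
    and M: "\<And>i j. i < n \<Longrightarrow> j < n \<Longrightarrow> regular (flag_variety n) (big_cell n w) (\<lambda>V. M V $$ (i, j))"
  shows "regular (flag_variety n) (big_cell n w) (\<lambda>V. coeff V k (M V) l)"
proof -
  interpret F: function_sheaf "flag_variety n" by (rule function_sheaf_flag_variety)
  have "i \<in> {1..n}" if "i \<in> {1..<k}" for i using that k by auto
  then show ?thesis
    unfolding coeff_def
    by (intro F.regular_diff F.regular_sum F.regular_mult M regular_annihilator[OF w k(1)]
      openin_big_cell[OF w] pos_less k) auto
qed

text \<open>The recursion is triangular: the scalars of a new factor are polynomial in the
  functionals, which are regular on the chart, and in entries already known to be regular.\<close>

lemma regular_R: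
  assumes "m < n" "i < n" "j < n"
  shows "regular (flag_variety n) (big_cell n w) (\<lambda>V. R V m $$ (i, j))"
  using assms
proof (induction m arbitrary: i j)
  case 0
  then show ?case
    using function_sheaf.regular_const[OF function_sheaf_flag_variety openin_big_cell[OF w]] by simp
next
  case (Suc m)
  show ?case
    unfolding R.simps
  proof (rule function_sheaf.regular_mult_G[OF function_sheaf_flag_variety row_strict_filling_axioms
        openin_big_cell[OF w] R_carrier _ _ Suc.prems(2,3)])
    show "regular (flag_variety n) (big_cell n w) (\<lambda>V. R V m $$ (i, j))" if "i < n" "j < n" for i j
      using Suc.IH Suc.prems(1) that by simp
    fix l assume "l \<in> invs (n - m)"
    from invsD(1,2)[OF this]
    show "regular (flag_variety n) (big_cell n w) (\<lambda>V. coeff V (n - m) (R V m) l)"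
      using Suc.IH Suc.prems(1) by (intro regular_coeff) auto
  qed
qed

lemma regular_flag_coordinate:
  assumes "l \<in> invs k"
  shows "regular (flag_variety n) (big_cell n w) (\<lambda>V. coordinate V k l)"
  unfolding coordinate_def using invsD(1,2)[OF assms]
  by (intro regular_coeff regular_R) auto

text \<open>The parametrization lifts to \<open>GL n\<close>, where only matrix entries have to be
  checked; it is then composed with the quotient map and corestricted to its image.\<close>

lemma morphism_param:
  assumes "n > 0"
    and x: "\<And>k l. l \<in> invs k \<Longrightarrow> regular (affine_space d) (carrier_vec d) (\<lambda>v. x v k l)"
  shows "morphism (affine_space d) (subvariety (flag_variety n) Y) (\<lambda>v. param (x v))"
proof -
  let ?A = "affine_space d"
  have sheaf: "function_sheaf ?A"
    unfolding affine_space_def by (rule function_sheaf_quasi_affine)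
  interpret A: function_sheaf ?A by (rule sheaf)
  have top: "topspace (top_of ?A) = carrier_vec d"
    by (simp add: affine_space_def quasi_affine_def topspace_zariski_topology)
  have U: "openin (top_of ?A) (carrier_vec d)" using openin_topspace[of "top_of ?A"] by (simp add: top)
  let ?\<pi> = "\<lambda>g. flag_image g (standard_flag n)"
  let ?g = "\<lambda>v. H (x v) (n - 1) * perm_matrix n w"
  have "morphism ?A (GL_variety n) ?g"
    unfolding GL_variety_def
  proof (rule A.morphism_quasi_affine)
    fix v
    show "?g v \<in> GL n" by (intro GL_mult Borel_GL H_Borel perm_matrix_GL[OF w])
  next
    fix c :: "complex mat \<Rightarrow> complex"
    assume "c \<in> {\<lambda>g. g $$ (i, j) |i j. i < n \<and> j < n}"
    then obtain i j where ij: "c = (\<lambda>g. g $$ (i, j))" "i < n" "j < n" by blast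
    have "?g v $$ (i, j) = (\<Sum>a<n. H (x v) (n - 1) $$ (i, a) * perm_matrix n w $$ (a, j))" for v
      using ij H_carrier[of "x v" "n - 1"] perm_matrix_carrier[of n w]
      by (simp add: scalar_prod_def atLeast0LessThan)
    then have "c (?g v) = (\<Sum>a<n. H (x v) (n - 1) $$ (i, a) * perm_matrix n w $$ (a, j))" for v
      by (simp only: ij(1))
    then show "regular ?A (topspace (top_of ?A)) (\<lambda>v. c (?g v))"
      unfolding top
      by (simp only:) (intro A.regular_sum A.regular_mult A.regular_const U regular_H[OF sheaf U] x ij;
        simp)
  qed
  moreover have "morphism (GL_variety n) (flag_variety n) ?\<pi>"
    unfolding flag_variety_def
    by (rule morphism_quotient_space) (auto simp: topspace_GL_variety flag_image_in_Flags)
  ultimately have "morphism ?A (flag_variety n) (?\<pi> \<circ> ?g)" by (rule morphism_compose)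
  moreover have "?\<pi> \<circ> ?g = (\<lambda>v. param (x v))" by (simp add: fun_eq_iff param_def flag_def)
  ultimately have "morphism ?A (flag_variety n) (\<lambda>v. param (x v))" by simp
  moreover have "(\<lambda>v. param (x v)) ` topspace (top_of ?A) \<subseteq> Y"
    using range_param[OF assms(1)] by auto
  ultimately show ?thesis by (rule A.morphism_subvariety)
qed

lemma topspace_Y: "topspace (top_of (subvariety (flag_variety n) Y)) = Y"
proof -
  have "Y \<subseteq> topspace (top_of (flag_variety n))"
    using Y_subset_big_cell openin_subset[OF openin_big_cell[OF w]] by (rule subset_trans)
  then show ?thesis by (simp add: subvariety_def Int_absorb1)
qed

text \<open>The coordinates are regular on the whole open chart and are merely restricted to
  \<open>Y\<close>.\<close>

lemma morphism_coordinates: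
  assumes e: "\<And>i. i < d \<Longrightarrow> e i \<in> springer_inv lam w"
  shows "morphism (subvariety (flag_variety n) Y) (affine_space d)
    (\<lambda>V. vec d (\<lambda>i. coordinate V (fst (e i)) (snd (e i))))"
proof -
  let ?\<psi> = "\<lambda>V. vec d (\<lambda>i. coordinate V (fst (e i)) (snd (e i)))"
  have sheaf: "function_sheaf (subvariety (flag_variety n) Y)"
    by (rule function_sheaf.subvariety[OF function_sheaf_flag_variety])
  show ?thesis
    unfolding affine_space_def
  proof (rule function_sheaf.morphism_quasi_affine[OF sheaf])
    fix c :: "complex vec \<Rightarrow> complex"
    assume "c \<in> {\<lambda>v. v $ i |i. i < d}"
    then obtain i where i: "c = (\<lambda>v. v $ i)" "i < d" by blast
    have "snd (e i) \<in> invs (fst (e i))" using e[OF i(2)] by (simp add: invs_def)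
    then have "regular (subvariety (flag_variety n) Y) Y (\<lambda>V. coordinate V (fst (e i)) (snd (e i)))"
      by (intro regular_subvariety[OF openin_big_cell[OF w]] regular_flag_coordinate Y_subset_big_cell)
    then show "regular (subvariety (flag_variety n) Y)
        (topspace (top_of (subvariety (flag_variety n) Y))) (\<lambda>V. c (?\<psi> V))"
      using i by (simp add: topspace_Y)
  qed simp
qed

end

theorem theorem5p4:
  fixes n :: nat and w :: "nat \<Rightarrow> nat" and lam :: "nat list"
  assumes "n > 0"
    and "w permutes {1..n}"
    and "sum_list lam = n"
    and "filling lam w \<in> RS lam"
  shows "\<exists>\<phi>. isomorphism
           (affine_space (card (springer_inv lam w)))
           (subvariety (flag_variety n) (schubert_cell n w \<inter> springer_fiber n (X_mat lam)))
           \<phi> \<and>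
         \<phi> ` carrier_vec (card (springer_inv lam w)) = D_set lam w"
proof -
  interpret row_strict_filling n w lam using assms(2-4) by unfold_locales
  let ?d = "card (springer_inv lam w)"
  \<comment> \<open>An arbitrary enumeration of the inversions decides which coordinate of the
    affine space belongs to which inversion.\<close>
  obtain e where e: "bij_betw e {..<?d} (springer_inv lam w)"
    using ex_bij_betw_nat_finite[OF finite_springer_inv] by (auto simp: atLeast0LessThan)
  define e' where "e' = inv_into {..<?d} e"
  have e'e: "e' (e i) = i" if "i < ?d" for i
    using that bij_betw_inv_into_left[OF e] by (simp add: e'_def)
  have ee': "e (e' p) = p" "e' p < ?d" if "p \<in> springer_inv lam w" for p
    using that bij_betw_inv_into_right[OF e] bij_betw_apply[OF bij_betw_inv_into[OF e]]
    by (auto simp: e'_def)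
  have e_in: "e i \<in> springer_inv lam w" if "i < ?d" for i using that e by (auto dest: bij_betw_apply)
  \<comment> \<open>At pairs that are not inversions the value is unspecified; by
    \<open>param_cong\<close> the flag does not depend on it.\<close>
  define x where "x = (\<lambda>(v :: complex vec) k l. v $ e' (k, l))"
  define \<phi> where "\<phi> = (\<lambda>v. param (x v))"
  define \<psi> where "\<psi> = (\<lambda>V. vec ?d (\<lambda>i. coordinate V (fst (e i)) (snd (e i))))"
  have inv: "\<psi> (\<phi> v) = v" if "v \<in> carrier_vec ?d" for v
  proof (rule eq_vecI)
    fix i assume "i < dim_vec v"
    then have i: "i < ?d" using that by simp
    have "snd (e i) \<in> invs (fst (e i))" using e_in[OF i] by (simp add: invs_def)
    then show "\<psi> (\<phi> v) $ i = v $ i"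
      using i by (simp add: \<psi>_def \<phi>_def coordinate_param x_def e'e)
  qed (use that in \<open>simp add: \<psi>_def\<close>)
  have im: "\<phi> ` carrier_vec ?d = Y"
  proof -
    have "param y \<in> \<phi> ` carrier_vec ?d" for y
    proof -
      let ?v = "vec ?d (\<lambda>i. y (fst (e i)) (snd (e i)))"
      have "param y = \<phi> ?v"
        unfolding \<phi>_def by (rule param_cong) (simp add: x_def invs_def ee')
      then show ?thesis by simp
    qed
    then have "range param \<subseteq> \<phi> ` carrier_vec ?d" by (rule image_subsetI)
    moreover have "\<phi> ` carrier_vec ?d \<subseteq> range param"
      unfolding \<phi>_def image_subset_iff by simp
    ultimately have "\<phi> ` carrier_vec ?d = range param" by (rule subset_antisym[rotated])
    then show ?thesis using range_param[OF assms(1)] by simp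
  qed
  have "morphism (affine_space ?d) (subvariety (flag_variety n) Y) \<phi>"
    unfolding \<phi>_def
  proof (rule morphism_param[OF assms(1)])
    fix k l assume "l \<in> invs k"
    then have "e' (k, l) < ?d" by (intro ee') (simp add: invs_def)
    then show "regular (affine_space ?d) (carrier_vec ?d) (\<lambda>v. x v k l)"
      unfolding affine_space_def x_def by (intro regular_coordinate) blast
  qed
  moreover have "morphism (subvariety (flag_variety n) Y) (affine_space ?d) \<psi>"
    unfolding \<psi>_def by (rule morphism_coordinates[OF e_in])
  \<comment> \<open>A left inverse of a map that is onto \<open>Y\<close> is also a right inverse
    there.\<close>
  moreover have "\<phi> (\<psi> V) = V" if "V \<in> Y" for V
    using that inv unfolding im[symmetric] by auto
  ultimately have "isomorphism (affine_space ?d) (subvariety (flag_variety n) Y) \<phi>"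
    unfolding isomorphism_def topspace_Y using inv
    by (auto simp: affine_space_def quasi_affine_def topspace_zariski_topology)
  then show ?thesis using im range_param[OF assms(1)] D_set_eq[OF assms(1)] by auto
qed

end
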